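(* There exists a constant $c_0\in(0,+\infty)$ such that for all integers $n\ge 2$ and $p\ge 2$ the following holds. Let $S^\natural=\{R^\natural_1,\dots,R^\natural_{s}\}$ be a finite (possibly empty) set of rectangles on $\mathbb{Z}^2$ such that $$|\partial^\natural R^\natural_1|+\cdots+|\partial^\natural R^\natural_{s}|\le p \quad\text{and}\quad \inf_{i\ne j} d_\infty(R^\natural_i,R^\natural_j)>3,$$ and let $\underline z=(z_1,\dots,z_n)\in(\mathbb{Z}^2)^n$ be such that $$\inf_{i\ne j} d_1(z_i,z_j)>1 \quad\text{and}\quad \inf_{i,j} d_\infty(z_i,R^\natural_j)>3.$$ Let $P^\natural_{\underline z}$ be the law of $n$ independent continuous-time simple random walks $Z^\natural_1,\dots,Z^\natural_n$ on $\mathbb{Z}^2$ starting from $z_1,\dots,z_n$, and let $$\mathcal{T}^\natural_c:=\inf\Big\{t\ge 0:\ \min\Big(\inf_{i\ne j} d_1(Z^\natural_i(t),Z^\natural_j(t)),\ \inf_{i,j} d_1(Z^\natural_i(t),R^\natural_j)\Big)=1\Big\}.$$ Then, with $\nu=c_0n^4p^2\ln p$ and $T_0=\exp\{\nu^2\}$, $$\forall\, T\ge T_0,\qquad P^\natural_{\underline z}\big(\mathcal{T}^\natural_c>T\big)\ \ge\ \frac{1}{(\ln T)^\nu}.$$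
   Context: A rectangle on $\mathbb{Z}^2$ is a nonempty set of the form $([a,b]\times[c,d])\cap\mathbb{Z}^2$ with $a,b,c,d\in\mathbb{R}$. $d_q$ is the distance associated with the usual $q$-norm on $\mathbb{R}^2$ ($q=\infty$: sup norm); the distance between a point and a set, or between two sets, is the infimum of the distances between their points. For $A\subset\mathbb{Z}^2$, its external border is $\partial^\natural A:=\{z\in\mathbb{Z}^2\setminus A:\ \exists z'\in A,\ d_1(z,z')=1\}$, and $|E|$ denotes the cardinality of a finite set $E$. A continuous-time simple random walk on $\mathbb{Z}^2$ jumps at the times of a rate-1 Poisson process, each time to one of its four nearest neighbours chosen uniformly. Convention: $\inf\emptyset=+\infty$. The constant $c_0$ does not depend on $n$, $p$, $S^\natural$, $\underline z$ or $T$. *)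

theory Defs
  imports "HOL-Probability.Probability"
begin

definition rectangle :: "(int \<times> int) set \<Rightarrow> bool" where
  "rectangle R \<longleftrightarrow> R \<noteq> {} \<and>
     (\<exists>a b c d :: real. R = {(x, y). a \<le> real_of_int x \<and> real_of_int x \<le> b \<and>
                                      c \<le> real_of_int y \<and> real_of_int y \<le> d})"

definition d1 :: "int \<times> int \<Rightarrow> int \<times> int \<Rightarrow> real" where
  "d1 z w = \<bar>real_of_int (fst z) - real_of_int (fst w)\<bar> + \<bar>real_of_int (snd z) - real_of_int (snd w)\<bar>"

definition dinf :: "int \<times> int \<Rightarrow> int \<times> int \<Rightarrow> real" where
  "dinf z w = max \<bar>real_of_int (fst z) - real_of_int (fst w)\<bar> \<bar>real_of_int (snd z) - real_of_int (snd w)\<bar>"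

text \<open>Infima are taken in the extended reals, so that the infimum over the empty set is \<open>\<infinity>\<close>.\<close>

definition pt_set_dist :: "(int \<times> int \<Rightarrow> int \<times> int \<Rightarrow> real) \<Rightarrow> int \<times> int \<Rightarrow> (int \<times> int) set \<Rightarrow> ereal" where
  "pt_set_dist d z A = (INF w\<in>A. ereal (d z w))"

definition set_set_dist :: "(int \<times> int \<Rightarrow> int \<times> int \<Rightarrow> real) \<Rightarrow> (int \<times> int) set \<Rightarrow> (int \<times> int) set \<Rightarrow> ereal" where
  "set_set_dist d A B = (INF z\<in>A. INF w\<in>B. ereal (d z w))"

definition points_sep :: "nat \<Rightarrow> (nat \<Rightarrow> int \<times> int) \<Rightarrow> ereal" where
  "points_sep n z = (INF i\<in>{..<n}. INF j\<in>{..<n} - {i}. ereal (d1 (z i) (z j)))"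

definition rects_sep :: "(int \<times> int) set set \<Rightarrow> ereal" where
  "rects_sep S = (INF R\<in>S. INF R'\<in>S - {R}. set_set_dist dinf R R')"

definition points_rects_sep ::
    "(int \<times> int \<Rightarrow> int \<times> int \<Rightarrow> real) \<Rightarrow> nat \<Rightarrow> (nat \<Rightarrow> int \<times> int) \<Rightarrow> (int \<times> int) set set \<Rightarrow> ereal" where
  "points_rects_sep d n z S = (INF i\<in>{..<n}. INF R\<in>S. pt_set_dist d (z i) R)"

definition ext_border :: "(int \<times> int) set \<Rightarrow> (int \<times> int) set" where
  "ext_border A = {z. z \<notin> A \<and> (\<exists>z'\<in>A. d1 z z' = 1)}"

text \<open>One walk is driven by an i.i.d. sequence of pairs consisting of an Exp(1) waiting time and
  an independent uniform nearest-neighbour step; the partial sums of the waiting times are the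
  points of a rate-1 Poisson process.\<close>

definition step_pmf :: "(int \<times> int) pmf" where
  "step_pmf = pmf_of_set {(1, 0), (-1, 0), (0, 1), (0, -1)}"

definition walk_noise :: "(nat \<Rightarrow> real \<times> (int \<times> int)) measure" where
  "walk_noise = (\<Pi>\<^sub>M k\<in>UNIV. density lborel (\<lambda>x. ennreal (exponential_density 1 x)) \<Otimes>\<^sub>M measure_pmf step_pmf)"

text \<open>The product is completed because trajectories are irregular on a null set (negative or summable
  waiting times), so that hitting events are only required to be measurable up to null sets.\<close>

definition walks_noise :: "nat \<Rightarrow> (nat \<Rightarrow> nat \<Rightarrow> real \<times> (int \<times> int)) measure" where
  "walks_noise n = completion (\<Pi>\<^sub>M i\<in>{..<n}. walk_noise)"

definition jump_time :: "(nat \<Rightarrow> real \<times> (int \<times> int)) \<Rightarrow> nat \<Rightarrow> real" where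
  "jump_time \<xi> k = (\<Sum>j\<le>k. fst (\<xi> j))"

text \<open>The set below is almost surely finite for every \<open>t\<close>; on the remaining null set the
  cardinality is 0 by convention.\<close>

definition jump_count :: "(nat \<Rightarrow> real \<times> (int \<times> int)) \<Rightarrow> real \<Rightarrow> nat" where
  "jump_count \<xi> t = card {k. jump_time \<xi> k \<le> t}"

definition walk :: "int \<times> int \<Rightarrow> (nat \<Rightarrow> real \<times> (int \<times> int)) \<Rightarrow> real \<Rightarrow> int \<times> int" where
  "walk z \<xi> t = z + (\<Sum>k<jump_count \<xi> t. snd (\<xi> k))"

definition walks :: "(nat \<Rightarrow> int \<times> int) \<Rightarrow> (nat \<Rightarrow> nat \<Rightarrow> real \<times> (int \<times> int)) \<Rightarrow> real \<Rightarrow> nat \<Rightarrow> int \<times> int" where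
  "walks z \<omega> t i = walk (z i) (\<omega> i) t"

definition collision_time ::
    "nat \<Rightarrow> (int \<times> int) set set \<Rightarrow> (real \<Rightarrow> nat \<Rightarrow> int \<times> int) \<Rightarrow> ereal" where
  "collision_time n S Z =
     (INF t\<in>{t. 0 \<le> t \<and> min (points_sep n (Z t)) (points_rects_sep d1 n (Z t) S) = 1}. ereal t)"

lemma prob_space_walk_noise: "prob_space walk_noise"
proof -
  interpret E: prob_space "density lborel (\<lambda>x. ennreal (exponential_density 1 x))"
    by (rule prob_space_exponential_density) simp
  interpret P: pair_prob_space "density lborel (\<lambda>x. ennreal (exponential_density 1 x))" "measure_pmf step_pmf"
    by unfold_locales
  show ?thesis
    unfolding walk_noise_def by (rule prob_space_PiM) (rule P.prob_space_axioms)
qed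

lemma prob_space_walks_noise: "prob_space (walks_noise n)"
  unfolding walks_noise_def by (intro prob_space.prob_space_completion prob_space_PiM prob_space_walk_noise)

end

(* Given the order in which the walks jump, the probability of surviving is the killed expectation
   "surv" of a discrete-time walk along the list of jumping labels, and the order is a function of the
   waiting times alone. With small but explicit probability the waiting times make the walks jump first
   in a prescribed order, and afterwards at nearly equal rates up to time T.

   The prescribed first jumps lead the walks around the rectangles to positions that are far from each
   other and from all borders. By pigeonhole there is then a direction that misses the borders from every
   position. For a while the walks are kept in tubes that drift in this direction at different speeds;
   the cost is bounded through the eigenfunction exp(l x) cos(theta x) of a drifting one-dimensional walk.
   Once all distances exceed a large L, a logarithmic supermartingale and anti-concentration
   show that they grow from L to L powr (1 + 1/(8N)) without collision with probability at least 1/2,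
   where N is the number of pairs. About 32 N ln(ln T) such blocks reach time T, which gives the power of ln T. *)
theory Submission
  imports Defs
begin

text \<open>Since \<open>1 / (ln T) powr \<nu>\<close> is exp(- \<nu> ln ln T), every cost has to
  stay below a constant times n^4 p^2 ln ln T in the exponent. The hypothesis on \<open>T\<close>
  makes logarithms of polynomials in \<open>n\<close> and \<open>p\<close> at most of order ln ln T.
  The barriers of all N = n^2 + n p pairs add up, so a logarithmic block works only once ln L is of
  order N ln N. A distance exponential in N ln N cannot be forced jump by jump. The tubes reach it
  in about N ln N doublings of their width, each costing exp(-O(P)) per walk with P = n p + 1; the
  product n P N is at most of order n^4 p^2. The tubes are indexed by each walk's own number of
  jumps and not by time, so that the steps can be averaged with the order of the jumps held fixed.
  Two walks are then at slightly different scales, and their counts must agree up to 1 / (4 n)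
  because their speeds differ only by 1 / n.\<close>

abbreviation steps :: "(int \<times> int) set" where
  "steps \<equiv> {(1, 0), (-1, 0), (0, 1), (0, -1)}"

section \<open>Killed expectations along a list of jumping labels\<close>

fun surv :: "((nat \<Rightarrow> int \<times> int) \<Rightarrow> bool) \<Rightarrow> ((nat \<Rightarrow> int \<times> int) \<Rightarrow> real) \<Rightarrow>
    nat list \<Rightarrow> (nat \<Rightarrow> int \<times> int) \<Rightarrow> real" where
  "surv G g [] x = (if G x then g x else 0)"
| "surv G g (l # ls) x = (if G x then (\<Sum>e\<in>steps. surv G g ls (x(l := x l + e))) / 4 else 0)"

lemma sum_steps: "(\<Sum>e\<in>steps. f e) = f (1, 0) + f (-1, 0) + f (0, 1) + f (0, -1)"
  for f :: "int \<times> int \<Rightarrow> real"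
  by simp

lemma surv_nonneg: "(\<And>y. 0 \<le> g y) \<Longrightarrow> 0 \<le> surv G g xs x"
  by (induction xs arbitrary: x) (auto intro!: add_nonneg_nonneg)

text \<open>The final position is tested by \<open>G\<close> too, so \<open>g\<close> and
  \<open>g'\<close> are compared only on \<open>G\<close>. Only the larger function is assumed
  nonnegative: in \<open>surv_spread\<close> the smaller one takes negative values.\<close>

lemma surv_mono:
  assumes "\<And>y. G y \<Longrightarrow> G' y" "\<And>y. G y \<Longrightarrow> g y \<le> g' y" "\<And>y. 0 \<le> g' y"
  shows "surv G g xs x \<le> surv G' g' xs x"
proof (induction xs arbitrary: x)
  case (Cons l ls)
  have "(\<Sum>e\<in>steps. surv G g ls (x(l := x l + e))) \<le> (\<Sum>e\<in>steps. surv G' g' ls (x(l := x l + e)))"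
    by (intro sum_mono Cons.IH)
  moreover have "0 \<le> surv G' g' (l # ls) x" by (rule surv_nonneg) (rule assms)
  ultimately show ?case using assms(1)[of x] by (auto simp del: sum.insert)
qed (use assms in auto)

text \<open>The Markov property at the junction of the lists. Both pieces test the junction with
  \<open>G\<close>, and a repeated test changes nothing.\<close>

lemma surv_append: "surv G g (xs @ ys) x = surv G (surv G g ys) xs x"
proof (induction xs arbitrary: x)
  case Nil
  show ?case by (cases ys) auto
qed auto

lemma surv_append_le:
  assumes "\<And>y. 0 \<le> g y" "\<And>y. g y \<le> 1"
  shows "surv G g (xs @ ys) x \<le> surv G (\<lambda>_. 1) xs x"
proof -
  have "surv G g ys y \<le> 1" for y
  proof (induction ys arbitrary: y)
    case (Cons l ys)
    have "(\<Sum>e\<in>steps. surv G g ys (y(l := y l + e))) \<le> (\<Sum>e\<in>steps. 1)" by (intro sum_mono Cons.IH)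
    also have "\<dots> = (4::real)" by simp
    finally show ?case by (simp del: sum.insert)
  qed (simp add: assms)
  then show ?thesis unfolding surv_append by (intro surv_mono) auto
qed

lemma surv_scale: "surv G (\<lambda>y. c * g y) xs x = c * surv G g xs x"
  by (induction xs arbitrary: x) (auto simp: algebra_simps)

lemma surv_forced:
  assumes "G x" "e \<in> steps" "\<And>y. 0 \<le> g y"
  shows "surv G g ls (x(l := x l + e)) / 4 \<le> surv G g (l # ls) x"
proof -
  have "surv G g ls (x(l := x l + e)) \<le> (\<Sum>e\<in>steps. surv G g ls (x(l := x l + e)))"
    using assms by (intro member_le_sum surv_nonneg) auto
  then show ?thesis using assms(1) by (simp del: sum.insert)
qed

text \<open>Up to a drift of \<open>c\<close> per jump, \<open>H\<close> is a nonnegative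
  supermartingale that is at least 1 wherever \<open>G\<close> fails. Optional stopping bounds the
  probability of ever leaving \<open>G\<close> by \<open>H x + c * length xs\<close>, and since
  \<open>g\<close> is at most 1, killing loses no more than this probability.\<close>

lemma surv_hit_bound:
  assumes H0: "\<And>x. 0 \<le> H x" and H1: "\<And>x. \<not> G x \<Longrightarrow> 1 \<le> H x"
    and step: "\<And>l x. (\<Sum>e\<in>steps. H (x(l := x l + e))) \<le> 4 * (H x + c)" and "0 \<le> c"
    and g: "\<And>x. g x \<le> 1" "\<And>x. 0 \<le> g x"
  shows "surv (\<lambda>_. True) g xs x - H x - c * length xs \<le> surv G g xs x"
proof (induction xs arbitrary: x)
  case Nil
  show ?case using g(1)[of x] H0[of x] H1[of x] by auto
next
  case (Cons l ls)
  let ?T = "\<lambda>e. surv (\<lambda>_. True) g ls (x(l := x l + e))"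
  show ?case
  proof (cases "G x")
    case False
    have "surv (\<lambda>_. True) g (l # ls) x \<le> surv (\<lambda>_. True) (\<lambda>_. 1) [] x"
      using surv_append_le[of g "\<lambda>_. True" "[]" "l # ls" x] g by auto
    then have "surv (\<lambda>_. True) g (l # ls) x \<le> 1" by simp
    moreover have "0 \<le> c * length (l # ls)" using \<open>0 \<le> c\<close> by simp
    moreover have "surv G g (l # ls) x = 0" using False by simp
    ultimately show ?thesis using H1[OF False] by linarith
  next
    case True
    have "(\<Sum>e\<in>steps. ?T e - H (x(l := x l + e)) - c * length ls) \<le>
        (\<Sum>e\<in>steps. surv G g ls (x(l := x l + e)))"
      by (intro sum_mono Cons.IH)
    moreover have "(\<Sum>e\<in>steps. ?T e - H (x(l := x l + e)) - c * length ls) =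
        (\<Sum>e\<in>steps. ?T e) - (\<Sum>e\<in>steps. H (x(l := x l + e))) - 4 * c * length ls"
      by simp
    ultimately show ?thesis using step[of x l] True by (simp del: sum.insert add: algebra_simps)
  qed
qed

lemma surv_diff:
  "surv (\<lambda>_. True) (\<lambda>y. f y - g y) xs x = surv (\<lambda>_. True) f xs x - surv (\<lambda>_. True) g xs x"
  by (induction xs arbitrary: x) (simp_all add: sum_subtractf diff_divide_distrib del: sum.insert)

lemma surv_sum:
  "finite A \<Longrightarrow> surv (\<lambda>_. True) (\<lambda>y. \<Sum>a\<in>A. f a y) xs x = (\<Sum>a\<in>A. surv (\<lambda>_. True) (f a) xs x)"
  by (induction xs arbitrary: x) (simp_all add: sum.distrib sum_divide_distrib add_divide_distrib)

lemma surv_one: "surv (\<lambda>_. True) (\<lambda>_. 1) xs x = 1"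
  by (induction xs arbitrary: x) auto

text \<open>\<open>pdiff x (i, Inl j)\<close> is the position of particle \<open>i\<close> relative to particle \<open>j\<close>,
  and \<open>pdiff x (i, Inr b)\<close> its position relative to the site \<open>b\<close>.\<close>

fun pdiff :: "(nat \<Rightarrow> int \<times> int) \<Rightarrow> nat \<times> (nat + int \<times> int) \<Rightarrow> int \<times> int" where
  "pdiff x (i, Inl j) = x i - x j"
| "pdiff x (i, Inr b) = x i - b"

definition prs :: "nat \<Rightarrow> (int \<times> int) set \<Rightarrow> (nat \<times> (nat + int \<times> int)) set" where
  "prs n B = {(i, Inl j) |i j. i < n \<and> j < n \<and> i \<noteq> j} \<union> {(i, Inr b) |i b. i < n \<and> b \<in> B}"

definition d1z :: "int \<times> int \<Rightarrow> real" where
  "d1z D = \<bar>real_of_int (fst D)\<bar> + \<bar>real_of_int (snd D)\<bar>"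

definition sepc :: "nat \<Rightarrow> (int \<times> int) set \<Rightarrow> real \<Rightarrow> (nat \<Rightarrow> int \<times> int) \<Rightarrow> bool" where
  "sepc n B R x \<longleftrightarrow> (\<forall>q\<in>prs n B. R \<le> d1z (pdiff x q))"

lemma finite_prs: "finite B \<Longrightarrow> finite (prs n B)"
  and card_prs: "finite B \<Longrightarrow> card (prs n B) \<le> n * n + n * card B"
proof -
  assume B: "finite B"
  have s: "prs n B \<subseteq> (\<lambda>(i, j). (i, Inl j)) ` ({..<n} \<times> {..<n}) \<union> (\<lambda>(i, b). (i, Inr b)) ` ({..<n} \<times> B)"
    unfolding prs_def by auto
  show "finite (prs n B)" by (rule finite_subset[OF s]) (use B in auto)
  have "card (prs n B) \<le> card ((\<lambda>(i, j). (i, Inl j :: nat + int \<times> int)) ` ({..<n} \<times> {..<n}) \<union>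
      (\<lambda>(i, b). (i, Inr b)) ` ({..<n} \<times> B))"
    by (rule card_mono[OF _ s]) (use B in auto)
  also have "\<dots> \<le> card ({..<n} \<times> {..<n}) + card ({..<n} \<times> B)"
    by (intro order_trans[OF card_Un_le] add_mono card_image_le) (use B in auto)
  finally show "card (prs n B) \<le> n * n + n * card B" by (simp add: card_cartesian_product)
qed

definition involved :: "nat \<Rightarrow> nat \<times> (nat + int \<times> int) \<Rightarrow> bool" where
  "involved l q \<longleftrightarrow> l = fst q \<or> Inl l = snd q"

lemma pdiff_step_cases:
  assumes "q \<in> prs n B"
  obtains "\<not> involved l q" "\<And>e. pdiff (x(l := x l + e)) q = pdiff x q"
  | "involved l q" "\<And>e. pdiff (x(l := x l + e)) q = pdiff x q + e"
  | "involved l q" "\<And>e. pdiff (x(l := x l + e)) q = pdiff x q - e"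
proof -
  consider i j where "q = (i, Inl j)" "i \<noteq> j" | i b where "q = (i, Inr b)"
    using assms unfolding prs_def by blast
  then show ?thesis
  proof cases
    case 1
    then show ?thesis
      by (cases "l = i"; cases "l = j") (auto simp: involved_def algebra_simps intro: that)
  next
    case 2
    then show ?thesis
      by (cases "l = i") (auto simp: involved_def algebra_simps intro: that)
  qed
qed

text \<open>The step set is symmetric, so a jump of the second particle, which subtracts
  \<open>e\<close>, gives the same sum. Hence every difference performs a simple random walk driven
  by the jumps that involve it.\<close>

lemma sum_steps_pdiff:
  fixes f :: "int \<times> int \<Rightarrow> real"
  assumes "q \<in> prs n B"
  shows "(\<Sum>e\<in>steps. f (pdiff (x(l := x l + e)) q)) =
    (if involved l q then (\<Sum>e\<in>steps. f (pdiff x q + e)) else 4 * f (pdiff x q))"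
proof -
  have m: "p - (1, 0) = p + (-1, 0)" "p - (-1, 0) = p + (1, 0)" "p - (0, 1) = p + (0, -1)"
    "p - (0, -1) = p + (0, 1)" for p :: "int \<times> int"
    by (cases p, simp)+
  show ?thesis by (rule pdiff_step_cases[OF assms, of l x]) (simp_all add: m)
qed

subsection \<open>A logarithmic supermartingale\<close>

definition lf :: "real \<Rightarrow> int \<times> int \<Rightarrow> real" where
  "lf M D = ln ((of_int (fst D))\<^sup>2 + (of_int (snd D))\<^sup>2 + 1/2 + M)"

lemma lf_arg_pos: "0 \<le> M \<Longrightarrow> 0 < (a::real)\<^sup>2 + b\<^sup>2 + 1/2 + M"
  by (smt (verit) zero_le_power2 field_sum_of_halves)

text \<open>With r = A^2 + B^2 the four neighbouring arguments multiply to ((r + 3/2)^2 - 4 A^2) ((r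
  + 3/2)^2 - 4 B^2), which exceeds (r + 1/2)^4 by 16 A^2 B^2 + 4 r + 5. A shift below 1/2 would
  leave a negative multiple of r^2 on the axes, so 1/2 is the least shift for which the logarithm is
  subharmonic on the whole lattice.\<close>

lemma lf_sub:
  "4 * lf 0 D \<le> (\<Sum>e\<in>steps. lf 0 (D + e))"
proof -
  obtain a b where D: "D = (a, b)" by (cases D)
  define A B where "A = real_of_int a" and "B = real_of_int b"
  define r where "r = A\<^sup>2 + B\<^sup>2"
  have pos: "0 < x\<^sup>2 + y\<^sup>2 + 1/2" for x y :: real using lf_arg_pos[of 0 x y] by simp
  have e1: "((A+1)\<^sup>2 + B\<^sup>2 + 1/2) * ((A-1)\<^sup>2 + B\<^sup>2 + 1/2) = (r + 3/2)\<^sup>2 - 4 * A\<^sup>2"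
    unfolding r_def by (simp add: power2_eq_square algebra_simps)
  have e2: "(A\<^sup>2 + (B+1)\<^sup>2 + 1/2) * (A\<^sup>2 + (B-1)\<^sup>2 + 1/2) = (r + 3/2)\<^sup>2 - 4 * B\<^sup>2"
    unfolding r_def by (simp add: power2_eq_square algebra_simps)
  have r0: "0 \<le> r" unfolding r_def by simp
  have "((r + 3/2)\<^sup>2 - 4 * A\<^sup>2) * ((r + 3/2)\<^sup>2 - 4 * B\<^sup>2) - (r + 1/2)^4
      = 16 * A\<^sup>2 * B\<^sup>2 + 4 * r + 5"
    unfolding r_def by (simp add: power2_eq_square power4_eq_xxxx field_simps)
  moreover have "0 \<le> 16 * A\<^sup>2 * B\<^sup>2 + 4 * r + 5" using r0 by simp
  ultimately have key: "(r + 1/2)^4 \<le> ((r + 3/2)\<^sup>2 - 4 * A\<^sup>2) * ((r + 3/2)\<^sup>2 - 4 * B\<^sup>2)" by simp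
  have "4 * lf 0 D = ln ((r + 1/2)^4)"
    unfolding lf_def D r_def A_def B_def
    using pos[of "real_of_int a" "real_of_int b"] by (simp add: ln_realpow)
  also have "\<dots> \<le> ln (((A+1)\<^sup>2 + B\<^sup>2 + 1/2) * ((A-1)\<^sup>2 + B\<^sup>2 + 1/2) * ((A\<^sup>2 + (B+1)\<^sup>2 + 1/2) * (A\<^sup>2 + (B-1)\<^sup>2 + 1/2)))"
    unfolding e1 e2 using key r0 by (intro ln_mono) auto
  also have "\<dots> = (\<Sum>e\<in>steps. lf 0 (D + e))"
    unfolding sum_steps lf_def D A_def B_def
    using pos by (simp add: ln_mult_pos[OF mult_pos_pos mult_pos_pos] ln_mult_pos)
  finally show ?thesis .
qed

text \<open>Concavity: ln (q' / q) is at most q' / q - 1. The linear terms cancel over the four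
  steps, and the squares leave 4 / q, at most 4 / M.\<close>

lemma lf_super:
  assumes "0 < M"
  shows "(\<Sum>e\<in>steps. lf M (D + e)) \<le> 4 * (lf M D + 1 / M)"
proof -
  obtain a b where D: "D = (a, b)" by (cases D)
  define A B where "A = real_of_int a" and "B = real_of_int b"
  define q where "q = A\<^sup>2 + B\<^sup>2 + 1/2 + M"
  have q: "0 < q" "M \<le> q" unfolding q_def using assms by (auto intro: add_nonneg_pos)
  have ub: "lf M (D + (e, f)) \<le> lf M D + (2 * A * e + 2 * B * f + e\<^sup>2 + f\<^sup>2) / q" for e f
  proof -
    define q' where "q' = (A + e)\<^sup>2 + (B + f)\<^sup>2 + 1/2 + M"
    have q': "0 < q'" unfolding q'_def using lf_arg_pos[of M "A+e" "B+f"] assms by simp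
    have "ln (q' / q) \<le> q' / q - 1" using q q' by (intro ln_le_minus_one) auto
    also have "\<dots> = (2 * A * e + 2 * B * f + e\<^sup>2 + f\<^sup>2) / q"
      using q unfolding q'_def q_def by (simp add: field_simps power2_eq_square)
    finally show ?thesis using q q'
      unfolding lf_def D by (simp add: ln_div q_def q'_def A_def B_def)
  qed
  have "(\<Sum>e\<in>steps. lf M (D + e)) \<le> 4 * lf M D + 4 / q"
    unfolding sum_steps using ub[of 1 0] ub[of "-1" 0] ub[of 0 1] ub[of 0 "-1"] q
    by (simp add: field_simps)
  moreover have "4 / q \<le> 4 / M" using q assms by (intro divide_left_mono) auto
  ultimately show ?thesis by simp
qed

text \<open>The barrier against collisions: about ln M next to the origin, small far beyond distance
  sqrt M, and a supermartingale up to a drift of 1 / M per jump.\<close>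

definition fM :: "real \<Rightarrow> int \<times> int \<Rightarrow> real" where
  "fM M D = lf M D - lf 0 D"

lemma fM_nonneg: "0 \<le> M \<Longrightarrow> 0 \<le> fM M D"
  unfolding fM_def lf_def
  using lf_arg_pos[of 0 "real_of_int (fst D)" "real_of_int (snd D)"] by (simp add: ln_mono)

lemma fM_super: "0 < M \<Longrightarrow> (\<Sum>e\<in>steps. fM M (D + e)) \<le> 4 * (fM M D + 1 / M)"
  unfolding fM_def using lf_sub[of D] lf_super[of M D] by (simp only: sum_subtractf) simp

lemma fM_far:
  assumes "0 < L" "L \<le> d1z D" "0 \<le> M"
  shows "fM M D \<le> ln (1 + 2 * M / L\<^sup>2)"
proof -
  define A B where "A = real_of_int (fst D)" and "B = real_of_int (snd D)"
  define r where "r = A\<^sup>2 + B\<^sup>2 + 1/2"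
  have "L\<^sup>2 \<le> (\<bar>A\<bar> + \<bar>B\<bar>)\<^sup>2" using assms unfolding d1z_def A_def B_def by (intro power_mono) auto
  also have "\<dots> \<le> 2 * (A\<^sup>2 + B\<^sup>2)"
    using zero_le_power2[of "\<bar>A\<bar> - \<bar>B\<bar>"] by (simp add: power2_sum power2_diff)
  finally have L: "L\<^sup>2 \<le> 2 * r" unfolding r_def by simp
  have r: "0 < r" unfolding r_def using lf_arg_pos[of 0 A B] by simp
  have "fM M D = ln ((r + M) / r)"
    unfolding fM_def lf_def using r assms(3) by (simp add: ln_div r_def A_def B_def)
  also have "\<dots> \<le> ln (1 + 2 * M / L\<^sup>2)"
  proof (rule ln_mono)
    have "2 * M / (2 * r) \<le> 2 * M / L\<^sup>2" using L assms by (intro divide_left_mono) (auto simp: r)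
    then show "(r + M) / r \<le> 1 + 2 * M / L\<^sup>2" using r by (simp add: field_simps)
  qed (use r assms in auto)
  finally show ?thesis .
qed

text \<open>A lattice vector of 1-norm below 2 is the origin or a unit vector, so its squared length
  is at most 1 and the denominator \<open>r\<close> at most 3/2.\<close>

lemma fM_near:
  assumes "d1z D < 2" "0 < M"
  shows "ln (M / (3/2)) \<le> fM M D"
proof -
  define r where "r = (real_of_int (fst D))\<^sup>2 + (real_of_int (snd D))\<^sup>2 + 1/2"
  have "\<bar>fst D\<bar> + \<bar>snd D\<bar> < 2" using assms(1) unfolding d1z_def by linarith
  then have "fst D = 0 \<and> \<bar>snd D\<bar> \<le> 1 \<or> snd D = 0 \<and> \<bar>fst D\<bar> \<le> 1" by linarith
  then have "(fst D)\<^sup>2 + (snd D)\<^sup>2 \<le> 1" by (auto simp: abs_square_le_1)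
  then have "real_of_int ((fst D)\<^sup>2 + (snd D)\<^sup>2) \<le> 1" by linarith
  then have r: "r \<le> 3/2" "0 < r"
    unfolding r_def using lf_arg_pos[of 0 "real_of_int (fst D)" "real_of_int (snd D)"] by simp_all
  have "ln (M / (3/2)) \<le> ln ((r + M) / r)"
  proof (rule ln_mono)
    have "M / (3/2) \<le> M / r" using r assms by (intro divide_left_mono) auto
    also have "\<dots> \<le> (r + M) / r" using r by (intro divide_right_mono) auto
    finally show "M / (3/2) \<le> (r + M) / r" .
  qed (use assms in auto)
  also have "\<dots> = fM M D"
    unfolding fM_def lf_def using r assms(2) by (simp add: ln_div r_def)
  finally show ?thesis .
qed

subsection \<open>Anti-concentration\<close>

fun walk1 :: "nat \<Rightarrow> int \<Rightarrow> real" where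
  "walk1 0 h = (if h = 0 then 1 else 0)"
| "walk1 (Suc k) h = (walk1 k (h - 1) + walk1 k (h + 1)) / 2"

lemma walk1_binomial:
  "walk1 k h * 2 ^ k = (if even (h + k) \<and> 0 \<le> h + k then real (k choose nat ((h + k) div 2)) else 0)"
proof (induction k arbitrary: h)
  case (Suc k)
  have "walk1 (Suc k) h * 2 ^ Suc k = walk1 k (h - 1) * 2 ^ k + walk1 k (h + 1) * 2 ^ k"
    by (simp add: algebra_simps)
  also have "\<dots> = (if even (h + Suc k) \<and> 0 \<le> h + Suc k then real (Suc k choose nat ((h + Suc k) div 2)) else 0)"
  proof (cases "even (h + Suc k) \<and> 0 \<le> h + Suc k")
    case True
    then obtain m :: nat where m: "h + Suc k = 2 * int m"
      by (metis evenE nonneg_int_cases zero_le_mult_iff zero_less_numeral not_less)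
    have a: "h + 1 + int k = 2 * int m" "h - 1 + int k = 2 * (int m - 1)" using m by auto
    have b: "even (h + 1 + int k)" "even (h - 1 + int k)" unfolding a by auto
    show ?thesis
    proof (cases m)
      case 0
      then show ?thesis using m a b unfolding Suc.IH by auto
    next
      case (Suc m')
      then have "(h + 1 + int k) div 2 = int (Suc m')" "(h - 1 + int k) div 2 = int m'" "(h + Suc k) div 2 = int (Suc m')"
        "0 \<le> h - 1 + int k" "0 \<le> h + 1 + int k"
        using m a by auto
      moreover have "nat (int (Suc m')) = Suc m'" by (rule nat_int)
      ultimately show ?thesis using True b unfolding Suc.IH by (simp del: of_nat_Suc)
    qed
  next
    case False
    then have n: "\<not> (even (h - 1 + int k) \<and> 0 \<le> h - 1 + int k)" "\<not> (even (h + 1 + int k) \<and> 0 \<le> h + 1 + int k)"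
      by auto
    show ?thesis unfolding Suc.IH if_not_P[OF n(1)] if_not_P[OF n(2)] if_not_P[OF False] by simp
  qed
  finally show ?case .
qed auto

text \<open>An elementary substitute for Stirling's formula: consecutive central binomials have
  ratio 2 (2m + 1) / (m + 1), and the induction closes by (2m + 1) (2m + 3) <= 4 (m + 1)^2.\<close>

lemma central_binomial_sq: "(real (2 * m choose m))\<^sup>2 * (2 * m + 1) \<le> 16 ^ m"
proof (induction m)
  case (Suc m)
  have "(2 * Suc m choose Suc m) * Suc m = (2 * m choose m) * (2 * (2 * m + 1))"
  proof -
    have "Suc m * (Suc (Suc (2 * m)) choose Suc m) = Suc (Suc (2 * m)) * (Suc (2 * m) choose m)"
      using Suc_times_binomial_eq[of "Suc (2 * m)" m] by (simp only: mult.commute)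
    moreover have "Suc m * (Suc (2 * m) choose m) = Suc (2 * m) * (2 * m choose m)"
    proof -
      have "(Suc (2 * m) choose m) = (Suc (2 * m) choose Suc m)"
        by (subst binomial_symmetric) auto
      then show ?thesis using Suc_times_binomial_eq[of "2 * m" m] by (simp add: mult.commute)
    qed
    moreover have "s * (s * a) = s * (2 * (t * c))" if "s * a = 2 * s * b" "s * b = t * c" for s t a b c :: nat
      using that by (metis mult.assoc mult.left_commute)
    moreover have "Suc (Suc (2 * m)) = 2 * Suc m" by simp
    ultimately have "Suc m * (Suc m * (Suc (Suc (2 * m)) choose Suc m)) = Suc m * (2 * (Suc (2 * m) * (2 * m choose m)))"
      by metis
    then have "Suc m * (Suc (Suc (2 * m)) choose Suc m) = 2 * (Suc (2 * m) * (2 * m choose m))"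
      by (simp only: mult_cancel1) simp
    moreover have "2 * Suc m = Suc (Suc (2 * m))" "2 * m + 1 = Suc (2 * m)" by simp_all
    ultimately show ?thesis by (metis mult.assoc mult.commute)
  qed
  then have e: "real (2 * Suc m choose Suc m) * (m + 1) = real (2 * m choose m) * (2 * (2 * m + 1))"
    by (metis of_nat_mult Suc_eq_plus1)
  define C where "C = real (2 * Suc m choose Suc m)"
  have "C\<^sup>2 * (2 * Suc m + 1) * (real m + 1)\<^sup>2 = (C * (m + 1))\<^sup>2 * (2 * m + 3)"
    by (simp add: power2_eq_square algebra_simps)
  also have "\<dots> = ((real (2 * m choose m))\<^sup>2 * (2 * m + 1)) * (4 * (2 * m + 1) * (2 * m + 3))"
    unfolding e C_def by (simp add: power2_eq_square algebra_simps)
  also have "\<dots> \<le> 16 ^ m * (16 * (real m + 1)\<^sup>2)"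
    by (intro mult_mono Suc.IH) (auto simp: power2_eq_square algebra_simps)
  finally have "C\<^sup>2 * (2 * Suc m + 1) * (real m + 1)\<^sup>2 \<le> 16 ^ Suc m * (real m + 1)\<^sup>2"
    by (simp add: algebra_simps)
  then have "C\<^sup>2 * (2 * Suc m + 1) \<le> 16 ^ Suc m"
    by (rule mult_right_le_imp_le) simp
  then show ?case unfolding C_def .
qed simp

lemma walk1_le_even: "walk1 (2 * m) h \<le> 1 / sqrt (2 * m + 1)"
proof -
  have "walk1 (2 * m) h * 2 ^ (2 * m) \<le> real (2 * m choose m)"
    unfolding walk1_binomial using binomial_maximum[of "2 * m"] by auto
  also have "\<dots> \<le> 4 ^ m / sqrt (2 * m + 1)"
  proof (rule power2_le_imp_le)
    show "(real (2 * m choose m))\<^sup>2 \<le> (4 ^ m / sqrt (2 * m + 1))\<^sup>2"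
      using central_binomial_sq[of m] by (simp add: power_divide field_simps power_mult_distrib flip: power_mult)
         (simp add: power_mult mult.commute[of m 2])?
  qed simp
  finally have "walk1 (2 * m) h * 4 ^ m \<le> 1 / sqrt (2 * m + 1) * 4 ^ m" by (simp add: power_mult)
  then show ?thesis by (simp only: mult_le_cancel_right) simp
qed

text \<open>An odd number k of steps averages two values taken after k - 1 = 2 m steps, where the
  bound is already 1 / sqrt (2 m + 1) = 1 / sqrt k.\<close>

lemma walk1_le: "0 < k \<Longrightarrow> walk1 k h \<le> 1 / sqrt k"
proof (cases "even k")
  case True
  assume "0 < k"
  obtain m where "k = 2 * m" using True by (elim evenE)
  then show ?thesis using walk1_le_even[of m h] \<open>0 < k\<close>
    by (intro order_trans[OF walk1_le_even[of m h, folded \<open>k = 2 * m\<close>]] divide_left_mono) auto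
next
  case False
  then obtain m where k: "k = Suc (2 * m)" by (auto elim!: oddE)
  then show ?thesis using walk1_le_even[of m "h - 1"] walk1_le_even[of m "h + 1"] by (simp add: add.commute)
qed

text \<open>Each of the four planar steps changes this diagonal coordinate by 1 or -1, so it
  performs a one-dimensional simple random walk.\<close>

definition uu :: "int \<times> int \<Rightarrow> int" where "uu D = fst D + snd D"

text \<open>By \<open>sum_steps_pdiff\<close> a difference ignores all jumps that do not involve it,
  and every other jump moves its diagonal coordinate up or down with probability 1/2.\<close>

lemma surv_uu:
  assumes "q \<in> prs n B"
  shows "surv (\<lambda>_. True) (\<lambda>y. if uu (pdiff y q) = a then 1 else 0) xs x
    = walk1 (length (filter (\<lambda>l. involved l q) xs)) (a - uu (pdiff x q))"
proof (induction xs arbitrary: x)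
  case (Cons l xs)
  let ?k = "length (filter (\<lambda>l. involved l q) xs)"
  have u: "a - (uu D + 1) = a - uu D - 1" "a - (uu D - 1) = a - uu D + 1" for D by auto
  have "(\<Sum>e\<in>steps. surv (\<lambda>_. True) (\<lambda>y. if uu (pdiff y q) = a then 1 else 0) xs (x(l := x l + e)))
      = (\<Sum>e\<in>steps. (\<lambda>D. walk1 ?k (a - uu D)) (pdiff (x(l := x l + e)) q))"
    by (simp only: Cons.IH)
  also have "\<dots> = (if involved l q then \<Sum>e\<in>steps. walk1 ?k (a - uu (pdiff x q + e)) else 4 * walk1 ?k (a - uu (pdiff x q)))"
    by (rule sum_steps_pdiff[OF assms])
  finally have "(\<Sum>e\<in>steps. surv (\<lambda>_. True) (\<lambda>y. if uu (pdiff y q) = a then 1 else 0) xs (x(l := x l + e)))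
      = 4 * walk1 (length (filter (\<lambda>l. involved l q) (l # xs))) (a - uu (pdiff x q))"
    by (auto simp: uu_def algebra_simps)
  then show ?case by (simp only: surv.simps) simp
qed auto

text \<open>A difference of 1-norm below \<open>R\<close> has its diagonal coordinate among the at
  most 2 R + 1 integers of modulus below \<open>R\<close>, and each of them has probability at most
  1 / sqrt k. Jumps of the partner only add further steps.\<close>

lemma surv_close:
  assumes q: "q \<in> prs n B" and "0 < k" "k \<le> count_list xs (fst q)" "0 \<le> R"
  shows "surv (\<lambda>_. True) (\<lambda>y. if d1z (pdiff y q) < R then 1 else 0) xs x \<le> (2 * R + 1) / sqrt k"
proof -
  let ?A = "{a :: int. \<bar>real_of_int a\<bar> < R}"
  let ?K = "length (filter (\<lambda>l. involved l q) xs)"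
  have sub: "?A \<subseteq> {-\<lfloor>R\<rfloor>..\<lfloor>R\<rfloor>}"
    by auto linarith+
  have fin: "finite ?A" by (rule finite_subset[OF sub]) simp
  have "card ?A \<le> card {-\<lfloor>R\<rfloor>..\<lfloor>R\<rfloor>}" by (rule card_mono[OF _ sub]) simp
  then have "card ?A \<le> nat (2 * \<lfloor>R\<rfloor> + 1)" by (simp add: algebra_simps)
  then have cA: "real (card ?A) \<le> 2 * R + 1" using \<open>0 \<le> R\<close> by linarith
  have "count_list xs (fst q) \<le> ?K"
    by (induction xs) (auto simp: involved_def)
  then have K: "k \<le> ?K" using assms by simp
  have "surv (\<lambda>_. True) (\<lambda>y. if d1z (pdiff y q) < R then 1 else 0) xs x
      \<le> surv (\<lambda>_. True) (\<lambda>y. \<Sum>a\<in>?A. if uu (pdiff y q) = a then 1 else 0) xs x"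
  proof (rule surv_mono)
    fix y
    show "(if d1z (pdiff y q) < R then 1 else 0) \<le> (\<Sum>a\<in>?A. if uu (pdiff y q) = a then 1 else (0::real))"
      using fin by (auto simp: d1z_def uu_def)
  qed (auto intro: sum_nonneg)
  also have "\<dots> = (\<Sum>a\<in>?A. walk1 ?K (a - uu (pdiff x q)))"
    by (simp only: surv_sum[OF fin] surv_uu[OF q])
  also have "\<dots> \<le> (\<Sum>a\<in>?A. 1 / sqrt k)"
  proof (rule sum_mono)
    fix a
    have "walk1 ?K (a - uu (pdiff x q)) \<le> 1 / sqrt ?K" using K assms by (intro walk1_le) auto
    also have "\<dots> \<le> 1 / sqrt k" using K assms by (intro divide_left_mono mult_pos_pos) auto
    finally show "walk1 ?K (a - uu (pdiff x q)) \<le> 1 / sqrt k" .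
  qed
  also have "\<dots> \<le> (2 * R + 1) / sqrt k" using cA by (simp add: divide_right_mono)
  finally show ?thesis .
qed

section \<open>Growth of the separation along lists with nearly equal counts\<close>

definition synced :: "nat \<Rightarrow> real \<Rightarrow> real \<Rightarrow> nat list \<Rightarrow> bool" where
  "synced n k0 \<epsilon> ys \<longleftrightarrow> set ys \<subseteq> {..<n} \<and>
     (\<forall>m. \<forall>i<n. \<forall>j<n. real (count_list (take m ys) i) \<le>
        (1 + \<epsilon>) * max (real (count_list (take m ys) j)) k0)"

text \<open>The maximum with \<open>k0\<close> in \<open>synced\<close> is there because the law of
  large numbers controls nothing before \<open>k0\<close> jumps. In a prefix with 2 n k0 entries
  every count exceeds \<open>k0\<close>: otherwise all counts would be at most 5/4 k0, too few in
  total. Then all counts are within a factor 5/4 of each other and hence of their mean.\<close>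

lemma synced_counts:
  assumes s: "synced n k0 (1/4) ys" and n: "0 < n" and m: "m \<le> length ys" "2 * n * k0 \<le> m" and k0: "0 < k0"
    and i: "i < n"
  shows "4/5 * m / n \<le> count_list (take m ys) i" "count_list (take m ys) i \<le> 5/4 * m / n"
proof -
  let ?c = "\<lambda>i. real (count_list (take m ys) i)"
  have "set (take m ys) \<subseteq> {..<n}" using s set_take_subset[of m ys] unfolding synced_def by auto
  then have "sum (count_list (take m ys)) {..<n} = length (take m ys)" by (rule sum_count_set) simp
  then have sum: "(\<Sum>i<n. ?c i) = m" using m by (simp flip: of_nat_sum)
  have sy: "?c i \<le> 5/4 * max (?c j) k0" if "i < n" "j < n" for i j
    using s that unfolding synced_def by auto
  have big: "k0 < ?c j" if j: "j < n" for j
  proof (rule ccontr)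
    assume "\<not> k0 < ?c j"
    then have "?c i \<le> 5/4 * k0" if "i < n" for i using sy[OF that j] by simp
    then have "(\<Sum>i<n. ?c i) \<le> (\<Sum>i<n. 5/4 * k0)" by (intro sum_mono) auto
    moreover have "0 < real n * k0" using n k0 by simp
    ultimately show False using m sum by simp
  qed
  have le: "?c i \<le> 5/4 * ?c j" if "i < n" "j < n" for i j
    using sy[OF that] big[OF that(2)] by (simp add: max_def)
  have "(\<Sum>j<n. ?c j) \<le> (\<Sum>j<n. 5/4 * ?c i)" by (intro sum_mono le) (use i in auto)
  then show "4/5 * m / n \<le> ?c i" using n sum by (simp add: field_simps)
  have "(\<Sum>j<n. ?c i) \<le> (\<Sum>j<n. 5/4 * ?c j)" by (intro sum_mono le) (use i in auto)
  also have "\<dots> = 5/4 * m" by (simp only: sum_distrib_left[symmetric] sum)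
  finally show "?c i \<le> 5/4 * m / n" using n by (simp add: field_simps)
qed

text \<open>\<open>surv_hit_bound\<close> applied to the sum of the barriers of all pairs, divided
  by \<open>a\<close>. A pair at distance below 2 alone contributes at least \<open>a\<close> by
  \<open>fM_near\<close>, so the quotient is at least 1 there.\<close>

lemma surv_hit_prs:
  fixes N :: real
  assumes B: "finite B" and N: "card (prs n B) \<le> N" and "0 < M" "0 < a" "a \<le> ln (M / (3/2))"
    and L: "0 < L" "sepc n B L x" and g: "\<And>y. 0 \<le> g y" "\<And>y. g y \<le> 1"
  shows "surv (\<lambda>_. True) g xs x - N * ln (1 + 2 * M / L\<^sup>2) / a - N / (M * a) * length xs
    \<le> surv (sepc n B 2) g xs x"
proof -
  let ?P = "prs n B"
  define H where "H = (\<lambda>y. (\<Sum>q\<in>?P. fM M (pdiff y q)) / a)"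
  have fin: "finite ?P" using finite_prs[OF B] .
  have fM0: "0 \<le> fM M D" for D using fM_nonneg \<open>0 < M\<close> by simp
  have main: "surv (\<lambda>_. True) g xs x - H x - N / (M * a) * length xs \<le> surv (sepc n B 2) g xs x"
  proof (rule surv_hit_bound)
    show "0 \<le> H y" for y unfolding H_def using fM0 \<open>0 < a\<close> by (simp add: sum_nonneg)
    show "1 \<le> H y" if ns: "\<not> sepc n B 2 y" for y
    proof -
      obtain q where q: "q \<in> ?P" "d1z (pdiff y q) < 2" using ns unfolding sepc_def by (meson not_less)
      have "a \<le> fM M (pdiff y q)" using fM_near[OF q(2) \<open>0 < M\<close>] assms by simp
      also have "\<dots> \<le> (\<Sum>q\<in>?P. fM M (pdiff y q))" using q fin fM0 by (intro member_le_sum) auto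
      finally show ?thesis unfolding H_def using \<open>0 < a\<close> by (simp add: field_simps)
    qed
    show "(\<Sum>e\<in>steps. H (y(l := y l + e))) \<le> 4 * (H y + N / (M * a))" for l y
    proof -
      have "(\<Sum>e\<in>steps. \<Sum>q\<in>?P. fM M (pdiff (y(l := y l + e)) q)) =
          (\<Sum>q\<in>?P. \<Sum>e\<in>steps. fM M (pdiff (y(l := y l + e)) q))" by (rule sum.swap)
      also have "\<dots> \<le> (\<Sum>q\<in>?P. 4 * (fM M (pdiff y q) + 1 / M))"
      proof (rule sum_mono)
        fix q assume q: "q \<in> ?P"
        show "(\<Sum>e\<in>steps. fM M (pdiff (y(l := y l + e)) q)) \<le> 4 * (fM M (pdiff y q) + 1 / M)"
          unfolding sum_steps_pdiff[OF q] using fM_super[OF \<open>0 < M\<close>] \<open>0 < M\<close> by auto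
      qed
      also have "\<dots> = 4 * (\<Sum>q\<in>?P. fM M (pdiff y q)) + 4 * (card ?P / M)"
        by (simp add: sum.distrib sum_distrib_left distrib_left)
      also have "\<dots> \<le> 4 * (\<Sum>q\<in>?P. fM M (pdiff y q)) + 4 * (N / M)"
        using N \<open>0 < M\<close> by (simp add: divide_right_mono)
      finally have "(\<Sum>e\<in>steps. \<Sum>q\<in>?P. fM M (pdiff (y(l := y l + e)) q)) / a \<le>
          (4 * (\<Sum>q\<in>?P. fM M (pdiff y q)) + 4 * (N / M)) / a"
        using \<open>0 < a\<close> by (intro divide_right_mono) auto
      then show ?thesis unfolding H_def sum_divide_distrib[symmetric]
        using \<open>0 < a\<close> \<open>0 < M\<close> by (simp add: add_divide_distrib del: sum.insert)
    qed
    show "0 \<le> N / (M * a)" using \<open>0 < M\<close> \<open>0 < a\<close> N by (simp add: order_trans[OF of_nat_0_le_iff])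
  qed (rule g)+
  have Hx: "H x \<le> N * ln (1 + 2 * M / L\<^sup>2) / a"
  proof -
    have l0: "0 \<le> ln (1 + 2 * M / L\<^sup>2)" using \<open>0 < M\<close> by simp
    have "(\<Sum>q\<in>?P. fM M (pdiff x q)) \<le> (\<Sum>q\<in>?P. ln (1 + 2 * M / L\<^sup>2))"
      using L \<open>0 < M\<close> unfolding sepc_def by (intro sum_mono fM_far) auto
    also have "\<dots> \<le> N * ln (1 + 2 * M / L\<^sup>2)" using N l0 by (simp add: mult_right_mono)
    finally show ?thesis unfolding H_def using \<open>0 < a\<close> by (simp add: divide_right_mono)
  qed
  then show ?thesis using main by linarith
qed

lemma surv_spread:
  fixes N :: real
  assumes B: "finite B" and N: "card (prs n B) \<le> N"
    and k: "0 < k" "\<And>i. i < n \<Longrightarrow> k \<le> count_list xs i" and R: "0 \<le> R"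
  shows "1 - N * ((2 * R + 1) / sqrt k) \<le> surv (\<lambda>_. True) (\<lambda>y. if sepc n B R y then 1 else 0) xs x"
proof -
    let ?P = "prs n B"
    have fin: "finite ?P" using finite_prs[OF B] .
    have "surv (\<lambda>_. True) (\<lambda>y. 1 - (\<Sum>q\<in>?P. if d1z (pdiff y q) < R then 1 else 0)) xs x
      \<le> surv (\<lambda>_. True) (\<lambda>y. if sepc n B R y then 1 else 0) xs x"
    proof (rule surv_mono)
      fix y
      show "1 - (\<Sum>q\<in>?P. if d1z (pdiff y q) < R then 1 else 0) \<le> (if sepc n B R y then 1 else (0::real))"
      proof (cases "sepc n B R y")
        case False
        then obtain q where q: "q \<in> ?P" "d1z (pdiff y q) < R" unfolding sepc_def by (meson not_less)
        have "(1::real) = (if d1z (pdiff y q) < R then 1 else 0)" using q by simp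
        also have "\<dots> \<le> (\<Sum>q\<in>?P. if d1z (pdiff y q) < R then 1 else 0)"
          using q fin by (intro member_le_sum) auto
        finally show ?thesis using False by simp
      qed (simp add: sum_nonneg)
    qed auto
    moreover have "surv (\<lambda>_. True) (\<lambda>y. 1 - (\<Sum>q\<in>?P. if d1z (pdiff y q) < R then 1 else 0)) xs x
      = 1 - (\<Sum>q\<in>?P. surv (\<lambda>_. True) (\<lambda>y. if d1z (pdiff y q) < R then 1 else 0) xs x)"
      by (simp add: surv_diff surv_one surv_sum[OF fin])
    moreover have "(\<Sum>q\<in>?P. surv (\<lambda>_. True) (\<lambda>y. if d1z (pdiff y q) < R then 1 else 0) xs x)
      \<le> (\<Sum>q\<in>?P. (2 * R + 1) / sqrt k)"
    proof (rule sum_mono)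
      fix q assume q: "q \<in> ?P"
      then have "fst q < n" by (auto simp: prs_def)
      then show "surv (\<lambda>_. True) (\<lambda>y. if d1z (pdiff y q) < R then 1 else 0) xs x \<le> (2 * R + 1) / sqrt k"
        using k R by (intro surv_close[OF q]) auto
    qed
    moreover have "\<dots> \<le> N * ((2 * R + 1) / sqrt k)" using N R by (simp add: mult_right_mono divide_right_mono)
    ultimately show ?thesis by linarith
qed

text \<open>The block lengths grow like \<open>R\<^sup>2\<close> while the separation grows from \<open>L\<close> to \<open>R = L powr (1 + 1/(8N))\<close>:
  the chance of a collision of one pair is about \<open>ln (R/L) / ln L\<close>, which stays below \<open>1/N\<close>.\<close>

lemma super_block_numbers:
  fixes n :: nat and L N :: real
  assumes n: "0 < n" "real n \<le> N" and N1: "1 \<le> N" and L: "0 < L" "8 * N * (6 + 2 * ln N) \<le> ln L"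
  defines "R \<equiv> L powr (1 + 1 / (8 * N))"
  defines "m \<equiv> nat \<lceil>1152 * real n * N\<^sup>2 * R\<^sup>2\<rceil>"
  defines "M \<equiv> 8 * N * m"
  shows "1 \<le> L" "L \<le> R" "1152 * real n * N\<^sup>2 * R\<^sup>2 \<le> m" "5 * real m \<le> 1152 * real n * N\<^sup>2 * (R powr (1 + 1 / (8 * N)))\<^sup>2"
    "L \<le> m" "0 < M" "2 * ln L \<le> ln (M / (3/2))" "0 < ln L"
    "N * ln (1 + 2 * M / L\<^sup>2) / (2 * ln L) \<le> 1 / 4"
    "N / (M * (2 * ln L)) * m \<le> 1 / 8"
    "N * ((2 * R + 1) / sqrt (m / (2 * n))) \<le> 1 / 8"
proof -
  have lnN: "0 \<le> ln N" using N1 by simp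
  have "48 \<le> 8 * N * (6 + 2 * ln N)" using N1 lnN mult_mono[of 8 "8 * N" 6 "6 + 2 * ln N"] by simp
  then have lnL: "48 \<le> ln L" using L by simp
  then show "0 < ln L" by simp
  show L1: "1 \<le> L" using lnL L by (metis ln_ge_zero_iff order_trans zero_le_numeral)
  show LR: "L \<le> R" unfolding R_def using powr_mono[of 1 "1 + 1 / (8 * N)" L] L1 N1 by simp
  have R1: "1 \<le> R" using LR L1 by simp
  show m: "1152 * real n * N\<^sup>2 * R\<^sup>2 \<le> m" unfolding m_def by (rule real_nat_ceiling_ge)
  have X1: "1 \<le> n * N\<^sup>2 * R\<^sup>2"
  proof -
    have "1 \<le> real n * (N\<^sup>2 * R\<^sup>2)"
      using n N1 R1 mult_mono[of 1 "N\<^sup>2" 1 "R\<^sup>2"] mult_mono[of 1 "real n" 1 "N\<^sup>2 * R\<^sup>2"]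
      by (simp add: one_le_power)
    then show ?thesis by (simp add: mult.assoc)
  qed
  \<comment> \<open>The ceiling adds at most 1, which is at most one more multiple of n N^2 R^2;
    hence 1153.\<close>
  have mu: "m \<le> 1153 * (n * N\<^sup>2 * R\<^sup>2)"
  proof -
    have "real m = of_int \<lceil>1152 * real n * N\<^sup>2 * R\<^sup>2\<rceil>" unfolding m_def using X1 by (simp add: mult.assoc)
    then have "m \<le> 1152 * real n * N\<^sup>2 * R\<^sup>2 + 1" by linarith
    then show ?thesis using X1 by (simp add: mult.assoc)
  qed
  have Lp: "L = exp (ln L)" using L by simp
  have R2: "R\<^sup>2 = L\<^sup>2 * exp (ln L / (4 * N))"
  proof -
    have "R = exp (ln L + ln L / (8 * N))"
      unfolding R_def powr_def using L by (simp add: algebra_simps)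
    then have "R\<^sup>2 = exp (2 * ln L + 2 * (ln L / (8 * N)))"
      by (simp add: power2_eq_square flip: exp_add)
    also have "\<dots> = exp (2 * ln L) * exp (ln L / (4 * N))" by (simp add: exp_add)
    also have "exp (2 * ln L) = L\<^sup>2" using L by (simp add: exp_double)
    finally show ?thesis .
  qed
  have mR: "R\<^sup>2 \<le> m"
  proof -
    have "1 * R\<^sup>2 \<le> (1152 * real n * N\<^sup>2) * R\<^sup>2" 
    proof (rule mult_right_mono)
      have "1 \<le> real n * N\<^sup>2" using n N1 mult_mono[of 1 "real n" 1 "N\<^sup>2"] by (simp add: one_le_power)
      then show "1 \<le> 1152 * real n * N\<^sup>2" by simp
    qed simp
    then show ?thesis using m by simp
  qed
  have "L * 1 \<le> R * R" using LR L1 by (intro mult_mono) auto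
  then show Lm: "L \<le> m" using mR by (simp add: power2_eq_square)
  then have m0: "0 < real m" using L1 by simp
  show M0: "0 < M" unfolding M_def using N1 m0 by simp
  show a: "2 * ln L \<le> ln (M / (3/2))"
  proof -
    have "L\<^sup>2 \<le> R\<^sup>2" using LR L1 by simp
    then have "L\<^sup>2 \<le> m" using mR by simp
    moreover have "8 * 1 * real m \<le> 8 * N * m" using N1 m0 by (intro mult_mono) auto
    ultimately have "3 / 2 * L\<^sup>2 \<le> M" unfolding M_def using m0 by linarith
    then have "L\<^sup>2 \<le> M / (3/2)" by simp
    then have "ln (L\<^sup>2) \<le> ln (M / (3/2))" using L by (intro ln_mono) auto
    then show ?thesis using L by (simp add: ln_realpow)
  qed
  show "N / (M * (2 * ln L)) * m \<le> 1 / 8"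
  proof -
    have "N / (M * (2 * ln L)) * m = 1 / (16 * ln L)" unfolding M_def using m0 N1 lnL by (simp add: field_simps)
    then show ?thesis using lnL by (simp add: field_simps)
  qed
  show "N * ((2 * R + 1) / sqrt (m / (2 * n))) \<le> 1 / 8"
  proof -
    \<comment> \<open>The constant 1152 = 2 * 24^2 is made for this line: with 2 R + 1 <= 3 R, the
      chance that a given pair ends too close is at most 1 / (8 N).\<close>
    have "(24 * N * R)\<^sup>2 \<le> m / (2 * n)" using m n by (simp add: field_simps power2_eq_square)
    then have "24 * N * R \<le> sqrt (m / (2 * n))" by (rule real_le_rsqrt)
    moreover have "0 < 24 * N * R" using N1 R1 by simp
    ultimately have "(2 * R + 1) / sqrt (m / (2 * n)) \<le> (3 * R) / (24 * N * R)"
      using R1 by (intro frac_le) auto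
    then have "N * ((2 * R + 1) / sqrt (m / (2 * n))) \<le> N * ((3 * R) / (24 * N * R))"
      using N1 by (intro mult_left_mono) auto
    then show ?thesis using N1 R1 by simp
  qed
  have e27: "(27/10::real) \<le> exp 1"
  proof -
    have "exp 1 = exp (1/8::real) ^ 8" by (simp flip: exp_of_nat_mult)
    moreover have "exp (1/8::real) \<ge> 1 + 1/8 + (1/8)^2/2"
      by (rule exp_lower_Taylor_quadratic) simp
    then have "exp (1/8::real) ^ 8 \<ge> (1 + 1/8 + (1/8)^2/2) ^ 8" by (intro power_mono) auto
    moreover have "(1 + 1/8 + (1/8)^2/2) ^ 8 \<ge> (27/10::real)" by (simp add: power_divide)
    ultimately show ?thesis by linarith
  qed
  \<comment> \<open>18449 = 16 * 1153 + 1: the factor 16 N in 2 M = 16 N m times the constant of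
    \<open>mu\<close>, plus the summand 1 inside the logarithm.\<close>
  have e10: "18449 \<le> exp (10::real)"
  proof -
    have "exp (10::real) = exp 1 ^ 10" by (simp flip: exp_of_nat_mult)
    moreover have "(27/10::real) ^ 10 \<le> exp 1 ^ 10" using e27 by (intro power_mono) auto
    ultimately show ?thesis by (simp add: power_divide)
  qed
  show "N * ln (1 + 2 * M / L\<^sup>2) / (2 * ln L) \<le> 1 / 4"
  proof -
    define E where "E = exp (ln L / (4 * N))"
    have E1: "1 \<le> E" unfolding E_def using lnL N1 by simp
    have "2 * M / L\<^sup>2 = 16 * N * (m / L\<^sup>2)" unfolding M_def by simp
    also have "m / L\<^sup>2 \<le> 1153 * (n * N\<^sup>2 * R\<^sup>2) / L\<^sup>2" using mu by (intro divide_right_mono) auto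
    also have "\<dots> = 1153 * (n * N\<^sup>2 * E)" unfolding R2 E_def using L by simp
    also have "\<dots> \<le> 1153 * (N * N\<^sup>2 * E)" using n N1 E1 by (intro mult_left_mono mult_right_mono) auto
    finally have "2 * M / L\<^sup>2 \<le> 18448 * (N ^ 4 * E)" using N1 by (simp add: power2_eq_square power4_eq_xxxx algebra_simps)
    moreover have "1 \<le> N ^ 4 * E" using N1 E1 mult_mono[of 1 "N^4" 1 E] by (simp add: one_le_power)
    ultimately have le: "1 + 2 * M / L\<^sup>2 \<le> 18449 * (N ^ 4 * E)" by simp
    also have "\<dots> \<le> exp 10 * (N ^ 4 * E)" using e10 \<open>1 \<le> N ^ 4 * E\<close> by (intro mult_right_mono) auto
    finally have "ln (1 + 2 * M / L\<^sup>2) \<le> ln (exp 10 * (N ^ 4 * E))" using M0 by (intro ln_mono) (auto intro!: add_pos_nonneg)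
    also have "\<dots> = 10 + (4 * ln N + ln L / (4 * N))"
      using N1 E1 unfolding E_def by (simp add: ln_mult_pos ln_realpow)
    finally have "N * ln (1 + 2 * M / L\<^sup>2) \<le> N * (10 + (4 * ln N + ln L / (4 * N)))" using N1 by (intro mult_left_mono) auto
    \<comment> \<open>The growth exponent 1 / (8 N) uses up one quarter of ln L, and the lower bound
      on ln L makes the remaining term another quarter. Dividing by 2 ln L gives 1/4.\<close>
    also have "\<dots> = N * (10 + 4 * ln N) + ln L / 4" using N1 by (simp add: field_simps)
    also have "N * (10 + 4 * ln N) \<le> ln L / 4" using L(2) N1 lnN by (simp add: algebra_simps)
    finally show ?thesis using lnL by (simp add: field_simps)
  qed
  show "5 * real m \<le> 1152 * real n * N\<^sup>2 * (R powr (1 + 1 / (8 * N)))\<^sup>2"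
  proof -
    have lnR: "ln R = ln L + ln L / (8 * N)" unfolding R_def using L by (simp add: ln_powr algebra_simps)
    have "1 / N * (48 * N) \<le> 1 / N * ln L" 
    proof (intro mult_left_mono)
      have "48 * N \<le> 8 * N * (6 + 2 * ln N)" using N1 lnN by (simp add: algebra_simps)
      then show "48 * N \<le> ln L" using L(2) by simp
    qed (use N1 in simp)
    then have big: "48 \<le> ln L / N" using N1 by simp
    have "(R powr (1 + 1 / (8 * N)))\<^sup>2 = R\<^sup>2 * (R powr (1 / (8 * N)))\<^sup>2"
      using R1 by (simp add: powr_add power_mult_distrib)
    \<comment> \<open>The gain 7 of the next squared scale beats the factor 5 and also the
      difference between 1153 and 1152, so the labels consumed so far are at most a fifth of the
      next block.\<close>
    moreover have "7 \<le> (R powr (1 / (8 * N)))\<^sup>2"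
    proof -
      have "6 \<le> ln R / (8 * N)" unfolding lnR using big lnL N1 by (simp add: add_divide_distrib add_increasing2)
      then have "1 + 6 \<le> R powr (1 / (8 * N))" 
        unfolding powr_def using R1 by (simp add: order_trans[OF exp_ge_add_one_self] order_trans[of 7 "1 + ln R / (8 * N)"])
      then have "1 * 7 \<le> R powr (1 / (8 * N)) * R powr (1 / (8 * N))" by (intro mult_mono) auto
      then show ?thesis by (simp add: power2_eq_square)
    qed
    ultimately have "R\<^sup>2 * 7 \<le> (R powr (1 + 1 / (8 * N)))\<^sup>2" by (simp add: mult_left_mono)
    then have "(n * N\<^sup>2) * (R\<^sup>2 * 7) \<le> (n * N\<^sup>2) * (R powr (1 + 1 / (8 * N)))\<^sup>2" by (intro mult_left_mono) auto
    then show ?thesis using mu by (simp add: mult.assoc)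
  qed
qed

text \<open>The list is cut at the absolute index \<open>m\<close>, with \<open>pre\<close> holding
  the labels already consumed, because \<open>synced\<close> speaks of counts from the start. The
  bound on \<open>length pre\<close> makes the past at most a fifth of the coming block, so that
  every walk still jumps often inside it. A block multiplies ln L by 1 + 1 / (8 N) and costs a
  factor 1/2; after \<open>b\<close> blocks the list is exhausted.\<close>

lemma surv_super_phase:
  fixes n :: nat and N k0 :: real
  assumes B: "finite B" "card (prs n B) \<le> N" and n: "0 < n" "real n \<le> N" and N1: "1 \<le> N"
    and s: "synced n k0 (1/4) (pre @ zs)" and k0: "0 < k0"
    and L: "0 < L" "8 * N * (6 + 2 * ln N) \<le> ln L"
    and pre: "2 * n * k0 \<le> length pre" "5 * real (length pre) \<le> 1152 * real n * N\<^sup>2 * (L powr (1 + 1 / (8 * N)))\<^sup>2"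
    and len: "length (pre @ zs) \<le> exp (ln L * (1 + 1 / (8 * N)) ^ b)"
    and x: "sepc n B L x"
  shows "(1/2) ^ (b + 1) \<le> surv (sepc n B 2) (\<lambda>_. 1) zs x"
  using s L pre len x
proof (induction b arbitrary: pre zs L x rule: less_induct)
  case (less b)
  note num = super_block_numbers[OF n N1 less.prems(2,3)]
  define R where "R = L powr (1 + 1 / (8 * N))"
  define m where "m = nat \<lceil>1152 * real n * N\<^sup>2 * R\<^sup>2\<rceil>"
  define M where "M = 8 * N * m"
  note num = num[folded R_def, folded m_def, folded M_def]
  \<comment> \<open>The chance of a collision within the block: 1/4 from the separation at its start
    plus 1/8 from the drift of the barriers.\<close>
  have hit: "surv (\<lambda>_. True) g ws x - 3 / 8 \<le> surv (sepc n B 2) g ws x"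
    if ws: "length ws \<le> m" and g: "\<And>y. 0 \<le> g y" "\<And>y. g y \<le> 1" for ws g
  proof -
    have "N / (M * (2 * ln L)) * length ws \<le> N / (M * (2 * ln L)) * m"
      using ws num N1 by (intro mult_left_mono) auto
    moreover have "surv (\<lambda>_. True) g ws x - N * ln (1 + 2 * M / L\<^sup>2) / (2 * ln L) - N / (M * (2 * ln L)) * length ws
      \<le> surv (sepc n B 2) g ws x"
      by (rule surv_hit_prs[OF B num(6) _ num(7) less.prems(2,7) g]) (use num in auto)
    ultimately show ?thesis using num(9,10) by linarith
  qed
  show ?case
  proof (cases "length (pre @ zs) \<le> m")
    case True
    have "(1/2::real) ^ (b + 1) \<le> 1 / 2" by (simp add: power_le_one)
    also have "\<dots> \<le> surv (sepc n B 2) (\<lambda>_. 1) zs x"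
      using hit[of zs "\<lambda>_. 1"] True by (simp add: surv_one)
    finally show ?thesis .
  next
    case False
    then have lm: "m < length (pre @ zs)" by simp
    \<comment> \<open>For \<open>b = 0\<close> the length bound says that the list has at most
      \<open>L\<close> entries, and L <= m would end it inside this block.\<close>
    have "b \<noteq> 0"
    proof
      assume "b = 0"
      then show False using less.prems(2,6) num(5) lm by simp
    qed
    then obtain b' where b: "b = Suc b'" by (cases b) auto
    have pm: "5 * real (length pre) \<le> m" using less.prems(5) num(3) unfolding R_def by linarith
    then have pm': "length pre \<le> m" by simp
    define zs1 where "zs1 = take (m - length pre) zs"
    define zs2 where "zs2 = drop (m - length pre) zs"
    have zs: "zs = zs1 @ zs2" unfolding zs1_def zs2_def by simp
    have l1: "length (pre @ zs1) = m" using lm pm' unfolding zs1_def by auto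
    have tk: "take m (pre @ zs) = pre @ zs1" "take (length pre) (pre @ zs) = pre"
      using l1 unfolding zs by auto
    have m0: "0 < real m" using num(1,5) by simp
    \<comment> \<open>After subtracting the past, 4/5 - 1/4 = 11/20 of the mean number m / n of
      jumps is left for \<open>zs1\<close>.\<close>
    have cnt: "m / (2 * n) \<le> count_list zs1 i" if i: "i < n" for i
    proof -
      have "4/5 * m / n \<le> count_list (pre @ zs1) i"
        using synced_counts(1)[OF less.prems(1) n(1) _ _ k0 i, of m] lm less.prems(4) pm' unfolding tk by simp
      moreover have "count_list pre i \<le> 5/4 * length pre / n"
        using synced_counts(2)[OF less.prems(1) n(1) _ _ k0 i, of "length pre"] less.prems(4) unfolding tk by simp
      moreover have "5/4 * length pre / n \<le> (m / 4) / n" using pm by (intro divide_right_mono) auto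
      ultimately have "4/5 * m / n - (m / 4) / n \<le> count_list zs1 i" by simp
      moreover have "m / (2 * n) \<le> 4/5 * m / n - (m / 4) / n" using n m0 by (simp add: field_simps)
      ultimately show ?thesis by linarith
    qed
    define k where "k = nat \<lceil>real m / (2 * n)\<rceil>"
    have k: "m / (2 * n) \<le> k" unfolding k_def by linarith
    have kc: "k \<le> count_list zs1 i" if "i < n" for i using cnt[OF that] unfolding k_def by linarith
    have mn: "0 < m / (2 * n)" using m0 n by simp
    have R0: "0 \<le> R" unfolding R_def by simp
    have "N * ((2 * R + 1) / sqrt k) \<le> N * ((2 * R + 1) / sqrt (m / (2 * n)))"
      using k mn R0 N1 by (intro mult_left_mono divide_left_mono mult_pos_pos) auto
    moreover have "0 < k" using k mn by (cases k) auto
    then have "1 - N * ((2 * R + 1) / sqrt k) \<le> surv (\<lambda>_. True) (\<lambda>y. if sepc n B R y then 1 else 0) zs1 x"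
      by (rule surv_spread[OF B _ kc R0])
    ultimately have "7 / 8 \<le> surv (\<lambda>_. True) (\<lambda>y. if sepc n B R y then 1 else 0) zs1 x"
      using num(11) by linarith
    moreover have "surv (\<lambda>_. True) (\<lambda>y. if sepc n B R y then 1 else 0) zs1 x - 3 / 8
        \<le> surv (sepc n B 2) (\<lambda>y. if sepc n B R y then 1 else 0) zs1 x"
      by (rule hit) (use l1 in auto)
    ultimately have half: "1 / 2 \<le> surv (sepc n B 2) (\<lambda>y. if sepc n B R y then 1 else 0) zs1 x"
      by linarith
    have lnR: "ln R = ln L * (1 + 1 / (8 * N))" unfolding R_def using less.prems(2) by (simp add: ln_powr)
    have IH: "(1/2) ^ (b' + 1) \<le> surv (sepc n B 2) (\<lambda>_. 1) zs2 y" if y: "sepc n B R y" for y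
    proof (rule less.IH[OF _ _ _ _ _ _ _ y])
      show "b' < b" using b by simp
      show "synced n k0 (1/4) ((pre @ zs1) @ zs2)" using less.prems(1) zs by simp
      show "0 < R" using num(1,2) by simp
      show "8 * N * (6 + 2 * ln N) \<le> ln R"
        using less.prems(3) num(1,2) ln_mono[of L R] less.prems(2) by linarith
      show "2 * n * k0 \<le> length (pre @ zs1)" using l1 less.prems(4) pm' by simp
      show "5 * real (length (pre @ zs1)) \<le> 1152 * real n * N\<^sup>2 * (R powr (1 + 1 / (8 * N)))\<^sup>2" unfolding l1 by (rule num(4))
      show "length ((pre @ zs1) @ zs2) \<le> exp (ln R * (1 + 1 / (8 * N)) ^ b')"
        using less.prems(6) unfolding lnR b zs by (simp add: mult.assoc)
    qed
    have "(1/2) ^ (b + 1) = (1/2) ^ (b' + 1) * (1 / 2 :: real)" by (simp add: b)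
    also have "\<dots> \<le> (1/2) ^ (b' + 1) * surv (sepc n B 2) (\<lambda>y. if sepc n B R y then 1 else 0) zs1 x"
      using half by (intro mult_left_mono) auto
    also have "\<dots> = surv (sepc n B 2) (\<lambda>y. (1/2) ^ (b' + 1) * (if sepc n B R y then 1 else 0)) zs1 x"
      by (rule surv_scale[symmetric])
    also have "\<dots> \<le> surv (sepc n B 2) (surv (sepc n B 2) (\<lambda>_. 1) zs2) zs1 x"
      by (rule surv_mono) (use IH in \<open>auto intro: surv_nonneg\<close>)
    also have "\<dots> = surv (sepc n B 2) (\<lambda>_. 1) zs x" unfolding zs surv_append ..
    finally show ?thesis .
  qed
qed

section \<open>Splitting the noise into independent waiting times and steps\<close>

definition expm :: "real measure" where
  "expm = density lborel (\<lambda>x. ennreal (exponential_density 1 x))"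

definition waitm :: "(nat \<Rightarrow> real) measure" where
  "waitm = (\<Pi>\<^sub>M k\<in>UNIV. expm)"

definition stepm :: "(nat \<Rightarrow> int \<times> int) measure" where
  "stepm = (\<Pi>\<^sub>M k\<in>UNIV. measure_pmf step_pmf)"

lemma prob_expm: "prob_space expm"
  unfolding expm_def by (rule prob_space_exponential_density) simp

lemma sets_expm [measurable_cong]: "sets expm = sets borel" and space_expm [simp]: "space expm = UNIV"
  unfolding expm_def by simp_all

lemma space_waitm [simp]: "space waitm = UNIV" and space_stepm [simp]: "space stepm = UNIV"
  unfolding waitm_def stepm_def by (simp_all add: space_PiM)

lemma sets_waitm [measurable_cong]: "sets waitm = sets (\<Pi>\<^sub>M k\<in>UNIV. borel)"
  unfolding waitm_def by (rule sets_PiM_cong) (simp_all add: sets_expm)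

lemma sets_stepm [measurable_cong]: "sets stepm = sets (\<Pi>\<^sub>M k\<in>UNIV. count_space UNIV)"
  unfolding stepm_def by (rule sets_PiM_cong) simp_all

lemma prob_waitm: "prob_space waitm" and prob_stepm: "prob_space stepm"
  unfolding waitm_def stepm_def by (intro prob_space_PiM prob_expm prob_space_measure_pmf)+

lemma walk_noise_alt: "walk_noise = (\<Pi>\<^sub>M k\<in>UNIV. expm \<Otimes>\<^sub>M measure_pmf step_pmf)"
  unfolding walk_noise_def expm_def ..

text \<open>The index set may be infinite, but the integrand sees only the finite set
  \<open>J\<close>; projecting to \<open>J\<close> reduces the claim to finite products.\<close>

lemma nn_integral_PiM_prod:
  assumes p: "prob_space A" and "finite J" "J \<subseteq> I" and h [measurable]: "\<And>j. j \<in> J \<Longrightarrow> h j \<in> borel_measurable A"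
  shows "(\<integral>\<^sup>+ w. (\<Prod>j\<in>J. h j (w j)) \<partial>(\<Pi>\<^sub>M i\<in>I. A)) = (\<Prod>j\<in>J. \<integral>\<^sup>+ x. h j x \<partial>A)"
proof -
  interpret p: prob_space A by fact
  interpret P: product_prob_space "\<lambda>_. A" I by unfold_locales
  have "(\<integral>\<^sup>+ w. (\<Prod>j\<in>J. h j (w j)) \<partial>(\<Pi>\<^sub>M i\<in>I. A)) =
      (\<integral>\<^sup>+ w. (\<Prod>j\<in>J. h j (restrict w J j)) \<partial>(\<Pi>\<^sub>M i\<in>I. A))"
    by (intro nn_integral_cong prod.cong) auto
  also have "\<dots> = (\<integral>\<^sup>+ v. (\<Prod>j\<in>J. h j (v j)) \<partial>distr (\<Pi>\<^sub>M i\<in>I. A) (\<Pi>\<^sub>M i\<in>J. A) (\<lambda>w. restrict w J))"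
    using assms(2,3) by (subst nn_integral_distr) (auto intro!: measurable_restrict_subset)
  also have "\<dots> = (\<integral>\<^sup>+ v. (\<Prod>j\<in>J. h j (v j)) \<partial>(\<Pi>\<^sub>M i\<in>J. A))"
    using P.distr_PiM_restrict_finite[OF assms(2,3)] by simp
  also have "\<dots> = (\<Prod>j\<in>J. \<integral>\<^sup>+ x. h j x \<partial>A)"
    by (rule P.product_nn_integral_prod) (use assms in auto)
  finally show ?thesis .
qed

text \<open>The two measures are compared on cylinders. For fixed \<open>w\<close> the section of a
  cylinder is a product set over \<open>J\<close>, so Fubini turns its measure into a product of one
  integral for each index in \<open>J\<close>.\<close>

lemma PiM_zip:
  assumes A: "prob_space A" and B: "prob_space B"
  shows "distr ((\<Pi>\<^sub>M i\<in>I. A) \<Otimes>\<^sub>M (\<Pi>\<^sub>M i\<in>I. B)) (\<Pi>\<^sub>M i\<in>I. A \<Otimes>\<^sub>M B) (\<lambda>(w, u). \<lambda>i\<in>I. (w i, u i))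
    = (\<Pi>\<^sub>M i\<in>I. A \<Otimes>\<^sub>M B)" (is "?L = ?R")
proof (rule measure_eqI_PiM_infinite[symmetric, OF refl])
  interpret A: prob_space A by fact
  interpret B: prob_space B by fact
  interpret AB: pair_prob_space A B ..
  interpret PA: prob_space "\<Pi>\<^sub>M i\<in>I. A" by (intro prob_space_PiM A)
  interpret PB: prob_space "\<Pi>\<^sub>M i\<in>I. B" by (intro prob_space_PiM B)
  interpret PP: pair_prob_space "\<Pi>\<^sub>M i\<in>I. A" "\<Pi>\<^sub>M i\<in>I. B" ..
  interpret B': product_prob_space "\<lambda>_. B" I by unfold_locales
  interpret AB': product_prob_space "\<lambda>_. A \<Otimes>\<^sub>M B" I by unfold_locales
  show "finite_measure ?R" by (intro prob_space.finite_measure prob_space_PiM AB.prob_space_axioms)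
  show "sets ?L = sets ?R" by simp
  fix C J assume J: "finite J" "J \<subseteq> I" and C: "\<And>i. i \<in> J \<Longrightarrow> C i \<in> sets (A \<Otimes>\<^sub>M B)"
  let ?f = "\<lambda>(w, u). \<lambda>i\<in>I. (w i, u i)"
  let ?X = "prod_emb I (\<lambda>i. A \<Otimes>\<^sub>M B) J (Pi\<^sub>E J C)"
  have X: "?X \<in> sets ?R" using J C by (intro sets_PiM_I) auto
  have f: "?f \<in> (\<Pi>\<^sub>M i\<in>I. A) \<Otimes>\<^sub>M (\<Pi>\<^sub>M i\<in>I. B) \<rightarrow>\<^sub>M ?R" by measurable
  have sec: "Pair w -` (?f -` ?X \<inter> space ((\<Pi>\<^sub>M i\<in>I. A) \<Otimes>\<^sub>M (\<Pi>\<^sub>M i\<in>I. B)))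
      = {u \<in> space (\<Pi>\<^sub>M i\<in>I. B). \<forall>j\<in>J. u j \<in> Pair (w j) -` C j}" if "w \<in> space (\<Pi>\<^sub>M i\<in>I. A)" for w
  proof (rule set_eqI)
    fix u
    show "u \<in> Pair w -` (?f -` ?X \<inter> space ((\<Pi>\<^sub>M i\<in>I. A) \<Otimes>\<^sub>M (\<Pi>\<^sub>M i\<in>I. B))) \<longleftrightarrow>
        u \<in> {u \<in> space (\<Pi>\<^sub>M i\<in>I. B). \<forall>j\<in>J. u j \<in> Pair (w j) -` C j}"
    proof (cases "u \<in> space (\<Pi>\<^sub>M i\<in>I. B)")
      case True
      then have wu: "(w, u) \<in> space ((\<Pi>\<^sub>M i\<in>I. A) \<Otimes>\<^sub>M (\<Pi>\<^sub>M i\<in>I. B))" using that by (simp add: space_pair_measure)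
      have "?f (w, u) \<in> (\<Pi>\<^sub>E i\<in>I. space (A \<Otimes>\<^sub>M B))"
        using measurable_space[OF f wu] by (simp add: space_PiM)
      then have "?f (w, u) \<in> ?X \<longleftrightarrow> (\<forall>j\<in>J. (w j, u j) \<in> C j)"
        using J(2) by (simp add: prod_emb_def restrict_PiE_iff Int_absorb1) (auto simp: Pi_iff)
      then show ?thesis using wu True by simp
    next
      case False
      then show ?thesis by (simp add: space_pair_measure)
    qed
  qed
  have "emeasure ?L ?X = emeasure ((\<Pi>\<^sub>M i\<in>I. A) \<Otimes>\<^sub>M (\<Pi>\<^sub>M i\<in>I. B))
      (?f -` ?X \<inter> space ((\<Pi>\<^sub>M i\<in>I. A) \<Otimes>\<^sub>M (\<Pi>\<^sub>M i\<in>I. B)))"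
    by (rule emeasure_distr[OF f X])
  also have "\<dots> = (\<integral>\<^sup>+ w. emeasure (\<Pi>\<^sub>M i\<in>I. B) (Pair w -` (?f -` ?X \<inter> space ((\<Pi>\<^sub>M i\<in>I. A) \<Otimes>\<^sub>M (\<Pi>\<^sub>M i\<in>I. B)))) \<partial>(\<Pi>\<^sub>M i\<in>I. A))"
    by (rule PB.emeasure_pair_measure_alt) (rule measurable_sets[OF f X])
  also have "\<dots> = (\<integral>\<^sup>+ w. (\<Prod>j\<in>J. emeasure B (Pair (w j) -` C j)) \<partial>(\<Pi>\<^sub>M i\<in>I. A))"
    by (intro nn_integral_cong, subst sec, assumption, rule B'.emeasure_PiM_Collect)
       (use J C in \<open>auto intro: sets_Pair1\<close>)
  also have "\<dots> = (\<Prod>j\<in>J. \<integral>\<^sup>+ x. emeasure B (Pair x -` C j) \<partial>A)"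
    using J C by (intro nn_integral_PiM_prod[OF A]) (auto intro: B.measurable_emeasure_Pair)
  also have "\<dots> = (\<Prod>j\<in>J. emeasure (A \<Otimes>\<^sub>M B) (C j))"
    using C by (intro prod.cong refl B.emeasure_pair_measure_alt[symmetric]) auto
  also have "\<dots> = emeasure ?R ?X"
    using J C by (intro AB'.emeasure_PiM_emb[symmetric]) auto
  finally show "emeasure ?R ?X = emeasure ?L ?X" ..
qed

definition zipn :: "nat \<Rightarrow> (nat \<Rightarrow> nat \<Rightarrow> real) \<times> (nat \<Rightarrow> nat \<Rightarrow> int \<times> int) \<Rightarrow> nat \<Rightarrow> nat \<Rightarrow> real \<times> (int \<times> int)" where
  "zipn n = (\<lambda>(w, u). \<lambda>i\<in>{..<n}. \<lambda>k. (w i k, u i k))"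

definition allwaits :: "nat \<Rightarrow> (nat \<Rightarrow> nat \<Rightarrow> real) measure" where
  "allwaits n = (\<Pi>\<^sub>M i\<in>{..<n}. waitm)"

definition allsteps :: "nat \<Rightarrow> (nat \<Rightarrow> nat \<Rightarrow> int \<times> int) measure" where
  "allsteps n = (\<Pi>\<^sub>M i\<in>{..<n}. stepm)"

lemma prob_allwaits: "prob_space (allwaits n)" and prob_allsteps: "prob_space (allsteps n)"
  unfolding allwaits_def allsteps_def by (intro prob_space_PiM prob_waitm prob_stepm)+

lemma walk_noise_zip:
  "walk_noise = distr (waitm \<Otimes>\<^sub>M stepm) walk_noise (\<lambda>(w, u) k. (w k, u k))"
  using PiM_zip[OF prob_expm prob_space_measure_pmf, of UNIV step_pmf]
  unfolding waitm_def stepm_def walk_noise_alt restrict_UNIV by (rule sym)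

lemma measurable_zip1 [measurable]: "(\<lambda>(w, u) k. (w k, u k)) \<in> waitm \<Otimes>\<^sub>M stepm \<rightarrow>\<^sub>M walk_noise"
proof -
  have "(\<lambda>x. \<lambda>k\<in>UNIV. (fst x k, snd x k)) \<in> waitm \<Otimes>\<^sub>M stepm \<rightarrow>\<^sub>M walk_noise"
    unfolding waitm_def stepm_def walk_noise_alt by measurable
  then show ?thesis by (simp add: restrict_UNIV case_prod_beta')
qed

lemma measurable_zipn: "zipn n \<in> allwaits n \<Otimes>\<^sub>M allsteps n \<rightarrow>\<^sub>M (\<Pi>\<^sub>M i\<in>{..<n}. walk_noise)"
proof -
  have "(\<lambda>p. \<lambda>i\<in>{..<n}. (\<lambda>(w, u) k. (w k, u k)) (fst p i, snd p i)) \<in> allwaits n \<Otimes>\<^sub>M allsteps n \<rightarrow>\<^sub>M (\<Pi>\<^sub>M i\<in>{..<n}. walk_noise)"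
    unfolding allwaits_def allsteps_def by (intro measurable_restrict measurable_compose[OF _ measurable_zip1]) measurable
  then show ?thesis unfolding zipn_def by (simp add: case_prod_beta')
qed

lemma walks_noise_zip:
  "(\<Pi>\<^sub>M i\<in>{..<n}. walk_noise) = distr (allwaits n \<Otimes>\<^sub>M allsteps n) (\<Pi>\<^sub>M i\<in>{..<n}. walk_noise) (zipn n)"
proof -
  let ?z = "\<lambda>(w :: nat \<Rightarrow> real, u :: nat \<Rightarrow> int \<times> int) k. (w k, u k)"
  let ?I = "{..<n}"
  interpret W: prob_space waitm by (rule prob_waitm)
  interpret S: prob_space stepm by (rule prob_stepm)
  interpret WS: pair_prob_space waitm stepm ..
  have "(\<Pi>\<^sub>M i\<in>?I. walk_noise) = (\<Pi>\<^sub>M i\<in>?I. distr (waitm \<Otimes>\<^sub>M stepm) walk_noise ?z)"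
    using walk_noise_zip by simp
  also have "\<dots> = distr (\<Pi>\<^sub>M i\<in>?I. waitm \<Otimes>\<^sub>M stepm) (\<Pi>\<^sub>M i\<in>?I. walk_noise) (compose ?I ?z)"
    by (rule distr_PiM_finite_prob_space'[symmetric]) (auto intro: prob_space_walk_noise WS.prob_space_axioms)
  also have "(\<Pi>\<^sub>M i\<in>?I. waitm \<Otimes>\<^sub>M stepm) =
      distr (allwaits n \<Otimes>\<^sub>M allsteps n) (\<Pi>\<^sub>M i\<in>?I. waitm \<Otimes>\<^sub>M stepm) (\<lambda>(w, u). \<lambda>i\<in>?I. (w i, u i))"
    unfolding allwaits_def allsteps_def using PiM_zip[OF prob_waitm prob_stepm, of ?I] by simp
  also have "distr \<dots> (\<Pi>\<^sub>M i\<in>?I. walk_noise) (compose ?I ?z) =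
      distr (allwaits n \<Otimes>\<^sub>M allsteps n) (\<Pi>\<^sub>M i\<in>?I. walk_noise) (compose ?I ?z \<circ> (\<lambda>(w, u). \<lambda>i\<in>?I. (w i, u i)))"
  proof (rule distr_distr)
    show "compose ?I ?z \<in> (\<Pi>\<^sub>M i\<in>?I. waitm \<Otimes>\<^sub>M stepm) \<rightarrow>\<^sub>M (\<Pi>\<^sub>M i\<in>?I. walk_noise)"
      unfolding compose_def by (intro measurable_restrict measurable_compose[OF _ measurable_zip1]) measurable
    show "(\<lambda>(w, u). \<lambda>i\<in>?I. (w i, u i)) \<in> allwaits n \<Otimes>\<^sub>M allsteps n \<rightarrow>\<^sub>M (\<Pi>\<^sub>M i\<in>?I. waitm \<Otimes>\<^sub>M stepm)"
      unfolding allwaits_def allsteps_def by measurable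
  qed
  also have "compose ?I ?z \<circ> (\<lambda>(w, u). \<lambda>i\<in>?I. (w i, u i)) = zipn n"
    by (auto simp: zipn_def compose_def fun_eq_iff)
  finally show ?thesis .
qed

text \<open>Fubini with the waiting times held fixed: the probability over the steps is estimated by
  \<open>q\<close> for waiting times in \<open>G\<close> and by 0 for all others.\<close>

lemma noise_lower_bound:
  assumes P: "{\<omega> \<in> space (\<Pi>\<^sub>M i\<in>{..<n}. walk_noise). P \<omega>} \<in> sets (\<Pi>\<^sub>M i\<in>{..<n}. walk_noise)"
    and G: "G \<in> sets (allwaits n)" and "0 \<le> q"
    and q: "\<And>w. w \<in> G \<Longrightarrow> q \<le> measure (allsteps n) {u \<in> space (allsteps n). P (zipn n (w, u))}"
  shows "q * measure (allwaits n) G \<le> measure (\<Pi>\<^sub>M i\<in>{..<n}. walk_noise) {\<omega> \<in> space (\<Pi>\<^sub>M i\<in>{..<n}. walk_noise). P \<omega>}"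
proof -
  let ?M = "\<Pi>\<^sub>M i\<in>{..<n}. walk_noise"
  let ?X = "{\<omega> \<in> space ?M. P \<omega>}"
  interpret W: prob_space "allwaits n" by (rule prob_allwaits)
  interpret S: prob_space "allsteps n" by (rule prob_allsteps)
  interpret M: prob_space ?M by (intro prob_space_PiM prob_space_walk_noise)
  let ?Y = "zipn n -` ?X \<inter> space (allwaits n \<Otimes>\<^sub>M allsteps n)"
  have Y: "?Y \<in> sets (allwaits n \<Otimes>\<^sub>M allsteps n)" by (rule measurable_sets[OF measurable_zipn P])
  have "ennreal q * emeasure (allwaits n) G = (\<integral>\<^sup>+ w. ennreal q * indicator G w \<partial>allwaits n)"
    using G by (simp add: nn_integral_cmult)
  also have "\<dots> \<le> (\<integral>\<^sup>+ w. emeasure (allsteps n) (Pair w -` ?Y) \<partial>allwaits n)"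
  proof (rule nn_integral_mono)
    fix w assume w: "w \<in> space (allwaits n)"
    have "Pair w -` ?Y = {u \<in> space (allsteps n). P (zipn n (w, u))}"
      using w measurable_space[OF measurable_zipn, of "(w, _)" n] by (auto simp: space_pair_measure)
    then show "ennreal q * indicator G w \<le> emeasure (allsteps n) (Pair w -` ?Y)"
      using q[of w] by (auto simp: indicator_def S.emeasure_eq_measure intro!: ennreal_leI)
  qed
  also have "\<dots> = emeasure (allwaits n \<Otimes>\<^sub>M allsteps n) ?Y" by (rule S.emeasure_pair_measure_alt[symmetric, OF Y])
  also have "\<dots> = emeasure (distr (allwaits n \<Otimes>\<^sub>M allsteps n) ?M (zipn n)) ?X"
    by (rule emeasure_distr[symmetric, OF measurable_zipn P])
  also have "\<dots> = emeasure ?M ?X" using walks_noise_zip[of n] by simp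
  finally show ?thesis using \<open>0 \<le> q\<close>
    by (simp add: M.emeasure_eq_measure W.emeasure_eq_measure ennreal_mult'[symmetric] measure_nonneg)
qed

subsection \<open>Waiting times\<close>

interpretation expm: prob_space expm by (rule prob_expm)
interpretation waitm: prob_space waitm by (rule prob_waitm)

lemma expm_window:
  assumes "0 \<le> a" "a \<le> b"
  shows "(b - a) * exp (- b) \<le> measure expm {a<..<b}"
proof -
  have "ennreal ((b - a) * exp (- b)) = (\<integral>\<^sup>+ x. ennreal (exp (- b)) * indicator {a<..<b} x \<partial>lborel)"
    by (subst nn_integral_cmult_indicator) (use assms in \<open>auto simp: mult.commute simp flip: ennreal_mult\<close>)
  also have "\<dots> \<le> (\<integral>\<^sup>+ x. ennreal (exponential_density 1 x) * indicator {a<..<b} x \<partial>lborel)"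
    using assms by (intro nn_integral_mono) (auto simp: indicator_def exponential_density_def intro!: ennreal_leI)
  also have "\<dots> = emeasure expm {a<..<b}"
    unfolding expm_def by (subst emeasure_density) auto
  finally show ?thesis by (simp add: expm.emeasure_eq_measure)
qed

lemma expm_mgf:
  assumes "\<theta> < 1"
  shows "(\<integral>\<^sup>+ x. ennreal (exp (\<theta> * x)) \<partial>expm) = ennreal (1 / (1 - \<theta>))"
proof -
  interpret d: prob_space "density lborel (\<lambda>x. ennreal (exponential_density (1 - \<theta>) x))"
    using assms by (intro prob_space_exponential_density) simp
  have "(\<integral>\<^sup>+ x. ennreal (exp (\<theta> * x)) \<partial>expm) =
      (\<integral>\<^sup>+ x. ennreal (exponential_density 1 x) * ennreal (exp (\<theta> * x)) \<partial>lborel)"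
    unfolding expm_def by (subst nn_integral_density) auto
  also have "\<dots> = (\<integral>\<^sup>+ x. ennreal (1 / (1 - \<theta>)) * ennreal (exponential_density (1 - \<theta>) x) \<partial>lborel)"
    using assms by (intro nn_integral_cong)
      (auto simp: exponential_density_def algebra_simps eq_divide_eq simp flip: ennreal_mult' exp_add)
  also have "\<dots> = ennreal (1 / (1 - \<theta>)) * (\<integral>\<^sup>+ x. ennreal (exponential_density (1 - \<theta>) x) \<partial>lborel)"
    by (rule nn_integral_cmult) measurable
  also have "(\<integral>\<^sup>+ x. ennreal (exponential_density (1 - \<theta>) x) \<partial>lborel) = 1"
    using d.emeasure_space_1 by (subst (asm) emeasure_density) auto
  finally show ?thesis by simp
qed

lemma waitm_mgf:
  assumes "\<theta> < 1"
  shows "(\<integral>\<^sup>+ w. ennreal (exp (\<theta> * (\<Sum>j<k. w j))) \<partial>waitm) = ennreal ((1 / (1 - \<theta>)) ^ k)"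
proof -
  have "(\<integral>\<^sup>+ w. ennreal (exp (\<theta> * (\<Sum>j<k. w j))) \<partial>waitm) =
      (\<integral>\<^sup>+ w. (\<Prod>j<k. ennreal (exp (\<theta> * w j))) \<partial>waitm)"
    by (intro nn_integral_cong) (simp add: sum_distrib_left exp_sum prod_ennreal)
  also have "\<dots> = (\<Prod>j<k. \<integral>\<^sup>+ x. ennreal (exp (\<theta> * x)) \<partial>expm)"
    unfolding waitm_def by (rule nn_integral_PiM_prod[OF prob_expm]) auto
  also have "\<dots> = ennreal ((1 / (1 - \<theta>)) ^ k)"
    using assms by (simp add: expm_mgf ennreal_power)
  finally show ?thesis .
qed

lemma waitm_exp_markov:
  assumes "\<theta> < 1"
  shows "measure waitm {w. c \<le> \<theta> * (\<Sum>j<k. w j)} \<le> (1 / (1 - \<theta>)) ^ k * exp (- c)"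
proof -
  have [measurable]: "(\<lambda>w. \<Sum>j<k. w j) \<in> borel_measurable waitm" by measurable
  have "emeasure waitm {w \<in> space waitm. c \<le> \<theta> * (\<Sum>j<k. w j)} \<le>
    (\<integral>\<^sup>+ w. ennreal (exp (- c)) * ennreal (exp (\<theta> * (\<Sum>j<k. w j))) \<partial>waitm)"
  proof -
    have "emeasure waitm {w \<in> space waitm. c \<le> \<theta> * (\<Sum>j<k. w j)} = (\<integral>\<^sup>+ w. indicator {w \<in> space waitm. c \<le> \<theta> * (\<Sum>j<k. w j)} w \<partial>waitm)"
      by (rule nn_integral_indicator[symmetric]) measurable
    also have "\<dots> \<le> (\<integral>\<^sup>+ w. ennreal (exp (- c)) * ennreal (exp (\<theta> * (\<Sum>j<k. w j))) \<partial>waitm)"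
      by (intro nn_integral_mono) (auto simp: indicator_def simp flip: ennreal_mult exp_add)
    finally show ?thesis .
  qed
  also have "\<dots> = ennreal (exp (- c)) * ennreal ((1 / (1 - \<theta>)) ^ k)"
    unfolding waitm_mgf[OF assms, symmetric] by (rule nn_integral_cmult) measurable
  finally show ?thesis using assms
    by (simp add: waitm.emeasure_eq_measure mult.commute flip: ennreal_mult)
qed

text \<open>Chernoff bound at \<theta> = \<epsilon> / 2. From 1 / (1 - \<theta>) <= exp (\<theta> +
  \<theta>^2) for \<theta> <= 1/2, the exponent per waiting time is \<theta>^2 - \<theta> \<epsilon>
  = - \<epsilon>^2 / 4. The lower tail uses - \<theta> in the same way.\<close>

lemma waitm_upper_tail:
  assumes "0 < \<epsilon>" "\<epsilon> \<le> 1"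
  shows "measure waitm {w. (1 + \<epsilon>) * k \<le> (\<Sum>j<k. w j)} \<le> exp (- (\<epsilon>\<^sup>2 / 4)) ^ k"
proof -
  define \<theta> where "\<theta> = \<epsilon> / 2"
  have th: "0 < \<theta>" "\<theta> \<le> 1/2" unfolding \<theta>_def using assms by auto
  have "{w. (1 + \<epsilon>) * k \<le> (\<Sum>j<k. w j)} = {w. \<theta> * ((1 + \<epsilon>) * k) \<le> \<theta> * (\<Sum>j<k. w j)}"
    using th by simp
  then have "measure waitm {w. (1 + \<epsilon>) * k \<le> (\<Sum>j<k. w j)} \<le> (1 / (1 - \<theta>)) ^ k * exp (- (\<theta> * ((1 + \<epsilon>) * k)))"
    using waitm_exp_markov[of \<theta> "\<theta> * ((1 + \<epsilon>) * k)" k] th by simp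
  also have "\<dots> \<le> exp (\<theta> + \<theta>\<^sup>2) ^ k * exp (- (\<theta> * ((1 + \<epsilon>) * k)))"
  proof (intro mult_right_mono power_mono)
    have "1 \<le> exp (\<theta> + \<theta>\<^sup>2) * (1 - \<theta>)"
    proof -
      have "1 \<le> (1 + (\<theta> + \<theta>\<^sup>2) + (\<theta> + \<theta>\<^sup>2)\<^sup>2 / 2) * (1 - \<theta>)"
      proof -
        have "(1 + (\<theta> + \<theta>\<^sup>2) + (\<theta> + \<theta>\<^sup>2)\<^sup>2 / 2) * (1 - \<theta>) - 1 = \<theta>\<^sup>2 / 2 * (1 - \<theta> - \<theta>\<^sup>2 - \<theta> * \<theta>\<^sup>2)"
          by (simp add: power2_eq_square field_simps)
        moreover have "0 \<le> 1 - \<theta> - \<theta>\<^sup>2 - \<theta> * \<theta>\<^sup>2"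
          using th mult_mono[of \<theta> "1/2" \<theta> "1/2"] mult_mono[of \<theta> "1/2" "\<theta>\<^sup>2" "1/4"] by (simp add: power2_eq_square)
        ultimately show ?thesis by (smt (verit) mult_nonneg_nonneg zero_le_power2 divide_nonneg_nonneg)
      qed
      also have "\<dots> \<le> exp (\<theta> + \<theta>\<^sup>2) * (1 - \<theta>)"
        using th by (intro mult_right_mono exp_lower_Taylor_quadratic) auto
      finally show ?thesis .
    qed
    then show "1 / (1 - \<theta>) \<le> exp (\<theta> + \<theta>\<^sup>2)" using th by (simp add: field_simps)
  qed (use th in auto)
  also have "\<dots> = exp (- (\<epsilon>\<^sup>2 / 4)) ^ k"
    unfolding \<theta>_def by (simp add: power2_eq_square field_simps flip: exp_of_nat_mult exp_add)
  finally show ?thesis .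
qed

lemma waitm_lower_tail:
  assumes "0 < \<epsilon>" "\<epsilon> \<le> 1"
  shows "measure waitm {w. (\<Sum>j<k. w j) \<le> (1 - \<epsilon>) * k} \<le> exp (- (\<epsilon>\<^sup>2 / 4)) ^ k"
proof -
  define \<theta> where "\<theta> = \<epsilon> / 2"
  have th: "0 < \<theta>" "\<theta> \<le> 1/2" unfolding \<theta>_def using assms by auto
  have "{w. (\<Sum>j<k. w j) \<le> (1 - \<epsilon>) * k} = {w. - \<theta> * ((1 - \<epsilon>) * k) \<le> - \<theta> * (\<Sum>j<k. w j)}"
    using th by simp
  then have "measure waitm {w. (\<Sum>j<k. w j) \<le> (1 - \<epsilon>) * k} \<le> (1 / (1 + \<theta>)) ^ k * exp (\<theta> * ((1 - \<epsilon>) * k))"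
    using waitm_exp_markov[of "- \<theta>" "- \<theta> * ((1 - \<epsilon>) * k)" k] th by simp
  also have "\<dots> \<le> exp (- \<theta> + \<theta>\<^sup>2) ^ k * exp (\<theta> * ((1 - \<epsilon>) * k))"
  proof (intro mult_right_mono power_mono)
    have "1 \<le> exp (- \<theta> + \<theta>\<^sup>2) * (1 + \<theta>)"
    proof -
      have "1 \<le> (1 + (- \<theta> + \<theta>\<^sup>2)) * (1 + \<theta>)" using th by (simp add: power2_eq_square algebra_simps)
      also have "\<dots> \<le> exp (- \<theta> + \<theta>\<^sup>2) * (1 + \<theta>)"
        using th by (intro mult_right_mono exp_ge_add_one_self) auto
      finally show ?thesis .
    qed
    then show "1 / (1 + \<theta>) \<le> exp (- \<theta> + \<theta>\<^sup>2)" using th by (simp add: field_simps)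
  qed (use th in auto)
  also have "\<dots> = exp (- (\<epsilon>\<^sup>2 / 4)) ^ k"
    unfolding \<theta>_def by (simp add: power2_eq_square field_simps flip: exp_of_nat_mult exp_add)
  finally show ?thesis .
qed

definition lln_set :: "real \<Rightarrow> nat \<Rightarrow> (nat \<Rightarrow> real) set" where
  "lln_set \<epsilon> k0 = {w. (\<forall>k. 0 < w k) \<and> (\<forall>k\<ge>k0. (1 - \<epsilon>) * k < (\<Sum>j<k. w j) \<and> (\<Sum>j<k. w j) < (1 + \<epsilon>) * k)}"

lemma lln_set_measurable [measurable]: "lln_set \<epsilon> k0 \<in> sets waitm"
proof -
  have "{w \<in> space waitm. (\<forall>k. 0 < w k) \<and> (\<forall>k\<ge>k0. (1 - \<epsilon>) * k < (\<Sum>j<k. w j) \<and> (\<Sum>j<k. w j) < (1 + \<epsilon>) * k)} \<in> sets waitm"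
    by measurable
  then show ?thesis by (simp add: lln_set_def)
qed

lemma AE_waitm_pos: "AE w in waitm. \<forall>k. 0 < w k"
proof -
  have "AE x in expm. 0 < x"
  proof -
    have "AE x in lborel. x \<noteq> (0::real)" by (rule AE_lborel_singleton)
    then show ?thesis unfolding expm_def by (subst AE_density) (auto simp: exponential_density_def elim!: eventually_mono)
  qed
  then have "AE w in waitm. 0 < w k" for k
    unfolding waitm_def by (intro AE_PiM_component prob_expm) auto
  then show ?thesis by (simp add: AE_all_countable)
qed

text \<open>The exponential Markov inequality with exponent -1 shows that the first \<open>k\<close>
  waiting times sum to at most \<open>m\<close> with probability at most 2^(-k) e^m. If all partial
  sums stay below \<open>m\<close>, this applies for every \<open>k\<close>.\<close>

lemma AE_waitm_unbounded: "AE w in waitm. \<forall>t. \<exists>k. t < (\<Sum>j<k. w j)"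
proof -
  have "AE w in waitm. \<exists>k. real m < (\<Sum>j<k. w j)" for m :: nat
  proof -
    let ?N = "{w \<in> space waitm. \<forall>k. (\<Sum>j<k. w j) \<le> real m}"
    have N: "?N \<in> sets waitm" by measurable
    have "measure waitm ?N \<le> (1 / 2) ^ k * exp m" for k
    proof -
      have "measure waitm ?N \<le> measure waitm {w. - real m \<le> - 1 * (\<Sum>j<k. w j)}"
      proof (rule waitm.finite_measure_mono)
        have "{w \<in> space waitm. - real m \<le> - 1 * (\<Sum>j<k. w j)} \<in> sets waitm" by measurable
        then show "{w. - real m \<le> - 1 * (\<Sum>j<k. w j)} \<in> sets waitm" by simp
      qed auto
      also have "\<dots> \<le> (1 / 2) ^ k * exp m" using waitm_exp_markov[of "-1" "- real m" k] by simp
      finally show ?thesis .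
    qed
    moreover have "(\<lambda>k. (1 / 2) ^ k * exp (real m)) \<longlonglongrightarrow> 0 * exp (real m)"
      by (intro tendsto_intros LIMSEQ_realpow_zero) auto
    ultimately have "measure waitm ?N \<le> 0 * exp (real m)"
      by (intro LIMSEQ_le_const[of "\<lambda>k. (1 / 2) ^ k * exp (real m)"]) auto
    then have "emeasure waitm ?N = 0" by (simp add: waitm.emeasure_eq_measure measure_le_0_iff)
    then show ?thesis using N by (intro AE_I[of _ _ ?N]) (auto simp: not_less)
  qed
  then have "AE w in waitm. \<forall>m::nat. \<exists>k. real m < (\<Sum>j<k. w j)" by (simp add: AE_all_countable)
  then show ?thesis
    by (rule eventually_mono) (meson reals_Archimedean2 less_trans)
qed

text \<open>A union bound over all k >= k0. The tail bounds form a geometric series with ratio r =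
  exp (- \<epsilon>^2 / 4) and 1 - r >= \<epsilon>^2 / 8; the hypothesis on \<open>k0\<close> makes
  its sum at most 1/2.\<close>

lemma measure_lln_set:
  assumes e: "0 < \<epsilon>" "\<epsilon> \<le> 1" and k0: "32 / \<epsilon>\<^sup>2 \<le> exp (k0 * \<epsilon>\<^sup>2 / 4)"
  shows "1 / 2 \<le> measure waitm (lln_set \<epsilon> k0)"
proof -
  define r where "r = exp (- (\<epsilon>\<^sup>2 / 4))"
  have e2: "0 < \<epsilon>\<^sup>2" "\<epsilon>\<^sup>2 \<le> 1" using e by (auto simp: power_le_one)
  have r: "0 < r" "r < 1" unfolding r_def using e2 by auto
  define A where "A = (\<lambda>m. {w. (1 + \<epsilon>) * real (k0 + m) \<le> (\<Sum>j<k0 + m. w j)} \<union> {w. (\<Sum>j<k0 + m. w j) \<le> (1 - \<epsilon>) * real (k0 + m)})"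
  have U: "{w. (1 + \<epsilon>) * real k \<le> (\<Sum>j<k. w j)} \<in> sets waitm" "{w. (\<Sum>j<k. w j) \<le> (1 - \<epsilon>) * real k} \<in> sets waitm" for k
  proof -
    have "{w \<in> space waitm. (1 + \<epsilon>) * real k \<le> (\<Sum>j<k. w j)} \<in> sets waitm"
      "{w \<in> space waitm. (\<Sum>j<k. w j) \<le> (1 - \<epsilon>) * real k} \<in> sets waitm" by measurable
    then show "{w. (1 + \<epsilon>) * real k \<le> (\<Sum>j<k. w j)} \<in> sets waitm" "{w. (\<Sum>j<k. w j) \<le> (1 - \<epsilon>) * real k} \<in> sets waitm"
      by simp_all
  qed
  then have A: "A m \<in> sets waitm" for m unfolding A_def by (intro sets.Un U)
  have mA: "measure waitm (A m) \<le> 2 * r ^ k0 * r ^ m" for m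
  proof -
    have "measure waitm (A m) \<le> r ^ (k0 + m) + r ^ (k0 + m)"
      unfolding A_def r_def
      by (intro order_trans[OF measure_Un_le[OF U]] add_mono waitm_upper_tail waitm_lower_tail e)
    then show ?thesis by (simp add: power_add)
  qed
  have sg: "summable (\<lambda>m. 2 * r ^ k0 * r ^ m)" using r by (intro summable_mult summable_geometric) auto
  have sA: "summable (\<lambda>m. measure waitm (A m))"
    by (rule summable_comparison_test[OF _ sg]) (use mA in \<open>auto simp: measure_nonneg\<close>)
  have "measure waitm (\<Union>m. A m) \<le> (\<Sum>m. measure waitm (A m))"
    by (rule waitm.finite_measure_subadditive_countably) (use A sA in auto)
  also have "\<dots> \<le> (\<Sum>m. 2 * r ^ k0 * r ^ m)" by (intro suminf_le mA sA sg)
  also have "\<dots> = 2 * r ^ k0 / (1 - r)" using r by (simp add: suminf_mult suminf_geometric)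
  also have "\<dots> \<le> 1 / 2"
  proof -
    define y where "y = \<epsilon>\<^sup>2 / 4"
    have "exp (- y) \<le> 1 - y / 2"
    proof -
      have "y * y \<le> 1 * y" unfolding y_def using e2 by (intro mult_right_mono) auto
      then have "1 \<le> (1 - y / 2) * (1 + y)" by (simp add: field_simps)
      also have "\<dots> \<le> (1 - y / 2) * exp y" using e2 unfolding y_def by (intro mult_left_mono) auto
      finally show ?thesis by (simp add: exp_minus field_simps)
    qed
    then have "\<epsilon>\<^sup>2 / 8 \<le> 1 - r" unfolding r_def y_def by simp
    then have "2 * r ^ k0 / (1 - r) \<le> 2 * r ^ k0 / (\<epsilon>\<^sup>2 / 8)"
      by (intro divide_left_mono mult_pos_pos) (use r(1) in simp, use r(1) in simp, rule diff_gt_0_iff_gt[THEN iffD2, OF r(2)], use e2(1) in simp)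
    also have "\<dots> = (16 / \<epsilon>\<^sup>2) / exp (k0 * \<epsilon>\<^sup>2 / 4)"
      unfolding r_def by (simp add: exp_minus field_simps flip: exp_of_nat_mult)
    also have "\<dots> \<le> 1 / 2"
    proof (subst pos_divide_le_eq)
      have "16 / \<epsilon>\<^sup>2 = (32 / \<epsilon>\<^sup>2) / 2" by simp
      then show "16 / \<epsilon>\<^sup>2 \<le> 1 / 2 * exp (k0 * \<epsilon>\<^sup>2 / 4)" using k0 by linarith
    qed simp
    finally show ?thesis .
  qed
  finally have b: "measure waitm (\<Union>m. A m) \<le> 1 / 2" .
  have "1 - 1 / 2 \<le> measure waitm (space waitm - (\<Union>m. A m))"
    using b A by (subst waitm.prob_compl) auto
  also have "\<dots> \<le> measure waitm (lln_set \<epsilon> k0)"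
  proof (rule waitm.finite_measure_mono_AE)
    show "AE w in waitm. w \<in> space waitm - (\<Union>m. A m) \<longrightarrow> w \<in> lln_set \<epsilon> k0"
      using AE_waitm_pos
    proof (rule eventually_mono)
      fix w :: "nat \<Rightarrow> real" assume pos: "\<forall>k. 0 < w k"
      show "w \<in> space waitm - (\<Union>m. A m) \<longrightarrow> w \<in> lln_set \<epsilon> k0"
      proof
        assume w: "w \<in> space waitm - (\<Union>m. A m)"
        have "(1 - \<epsilon>) * k < (\<Sum>j<k. w j) \<and> (\<Sum>j<k. w j) < (1 + \<epsilon>) * k" if "k0 \<le> k" for k
        proof -
          have "w \<notin> A (k - k0)" using w by blast
          then show ?thesis using that unfolding A_def by auto
        qed
        then show "w \<in> lln_set \<epsilon> k0" unfolding lln_set_def using pos by auto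
      qed
    qed
  qed measurable
  finally show ?thesis by simp
qed

text \<open>Splicing an independent sequence behind the first \<open>l\<close> entries preserves the
  law of the waiting times, and it turns the event into a product of two events.\<close>

lemma waitm_prefix:
  assumes I: "\<And>k. k < l \<Longrightarrow> I k \<in> sets borel" and A: "A \<in> sets waitm"
  shows "measure waitm {w. (\<forall>k<l. w k \<in> I k) \<and> (\<lambda>k. w (l + k)) \<in> A} = (\<Prod>k<l. measure expm (I k)) * measure waitm A"
proof -
  let ?C = "{w \<in> space waitm. \<forall>k\<in>{..<l}. w k \<in> I k}"
  let ?X = "{w. (\<forall>k<l. w k \<in> I k) \<and> (\<lambda>k. w (l + k)) \<in> A}"
  let ?c = "\<lambda>(\<omega>, \<omega>'). comb_seq l \<omega> \<omega>'"
  interpret WW: pair_prob_space waitm waitm ..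
  interpret P: product_prob_space "\<lambda>_. expm" "UNIV :: nat set" by unfold_locales
  have ss: "sequence_space expm" by unfold_locales
  have C: "?C \<in> sets waitm"
  proof (intro sets.sets_Collect_finite_All)
    fix k assume "k \<in> {..<l}"
    then show "{w \<in> space waitm. w k \<in> I k} \<in> sets waitm"
      using measurable_sets[of "\<lambda>w. w k" waitm borel "I k"] I[of k] by (simp add: vimage_def)
  qed simp
  have sh: "(\<lambda>w k. w (l + k)) \<in> waitm \<rightarrow>\<^sub>M waitm"
    unfolding waitm_def by (rule measurable_PiM_single') (auto simp: space_PiM)
  have X: "?X \<in> sets waitm"
  proof -
    have e: "?X = ?C \<inter> ((\<lambda>w k. w (l + k)) -` A \<inter> space waitm)" by auto
    show ?thesis unfolding e by (rule sets.Int[OF C measurable_sets[OF sh A]])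
  qed
  have D: "distr (waitm \<Otimes>\<^sub>M waitm) waitm ?c = waitm"
    using sequence_space.PiM_comb_seq[OF ss, of l] unfolding waitm_def .
  have c: "?c \<in> waitm \<Otimes>\<^sub>M waitm \<rightarrow>\<^sub>M waitm" unfolding waitm_def by measurable
  have "emeasure waitm ?X = emeasure (waitm \<Otimes>\<^sub>M waitm) (?c -` ?X \<inter> space (waitm \<Otimes>\<^sub>M waitm))"
    by (subst D[symmetric], rule emeasure_distr[OF c X])
  also have "?c -` ?X \<inter> space (waitm \<Otimes>\<^sub>M waitm) = ?C \<times> A"
    by (auto simp: space_pair_measure comb_seq_def)
  also have "emeasure (waitm \<Otimes>\<^sub>M waitm) (?C \<times> A) = emeasure waitm ?C * emeasure waitm A"
    by (rule waitm.emeasure_pair_measure_Times[OF C A])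
  also have "emeasure waitm ?C = (\<Prod>k<l. emeasure expm (I k))"
    unfolding waitm_def by (rule P.emeasure_PiM_Collect) (use I in \<open>auto simp: sets_expm\<close>)
  finally show ?thesis
    by (simp add: waitm.emeasure_eq_measure expm.emeasure_eq_measure prod_ennreal prod_nonneg flip: ennreal_mult)
qed

subsection \<open>From noise to killed expectations\<close>

text \<open>The pathwise counterpart of \<open>surv\<close>: \<open>c i\<close> counts how many
  entries of its own step sequence walk \<open>i\<close> has consumed, so interleaving the walks
  never reuses or skips a step.\<close>

fun avoid :: "((nat \<Rightarrow> int \<times> int) \<Rightarrow> bool) \<Rightarrow> nat list \<Rightarrow> (nat \<Rightarrow> nat) \<Rightarrow> (nat \<Rightarrow> int \<times> int) \<Rightarrow>
    (nat \<Rightarrow> nat \<Rightarrow> int \<times> int) \<Rightarrow> bool" where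
  "avoid G [] c x u \<longleftrightarrow> G x"
| "avoid G (l # ls) c x u \<longleftrightarrow> G x \<and> avoid G ls (c(l := Suc (c l))) (x(l := x l + u l (c l))) u"

lemma avoid_cong:
  "(\<And>i k. c i \<le> k \<Longrightarrow> u i k = u' i k) \<Longrightarrow> avoid G ls c x u = avoid G ls c x u'"
proof (induction ls arbitrary: c x)
  case (Cons l ls)
  have "avoid G ls (c(l := Suc (c l))) y u = avoid G ls (c(l := Suc (c l))) y u'" for y
    by (rule Cons.IH) (use Cons.prems in \<open>auto split: if_splits\<close>)
  then show ?case using Cons.prems[of l "c l"] by simp
qed simp

lemma avoid_prefix:
  assumes "avoid G ls c x u" "m \<le> length ls"
  shows "G (\<lambda>i. x i + (\<Sum>k<count_list (take m ls) i. u i (c i + k)))"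
  using assms
proof (induction ls arbitrary: c x m)
  case (Cons l ls)
  show ?case
  proof (cases m)
    case 0
    then show ?thesis using Cons.prems by simp
  next
    case (Suc m')
    let ?c = "c(l := Suc (c l))" and ?x = "x(l := x l + u l (c l))"
    have "G (\<lambda>i. ?x i + (\<Sum>k<count_list (take m' ls) i. u i (?c i + k)))"
    proof (rule Cons.IH)
      show "avoid G ls ?c ?x u" using Cons.prems(1) by (simp only: avoid.simps)
      show "m' \<le> length ls" using Cons.prems(2) Suc by simp
    qed
    also have "(\<lambda>i. ?x i + (\<Sum>k<count_list (take m' ls) i. u i (?c i + k))) =
        (\<lambda>i. x i + (\<Sum>k<count_list (take m (l # ls)) i. u i (c i + k)))"
      unfolding Suc by (auto simp: fun_eq_iff sum.lessThan_Suc_shift simp del: sum.lessThan_Suc)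
    finally show ?thesis .
  qed
qed simp

text \<open>Replacing one coordinate by an independent copy does not change a product measure;
  Fubini over that copy gives the iterated integral.\<close>

lemma nn_integral_PiM_resample:
  assumes M: "\<And>i. i \<in> I \<Longrightarrow> prob_space (M i)" and i: "i \<in> I" and f: "f \<in> borel_measurable (PiM I M)"
  shows "(\<integral>\<^sup>+ v. f v \<partial>PiM I M) = (\<integral>\<^sup>+ x. (\<integral>\<^sup>+ v. f (v(i := x)) \<partial>PiM I M) \<partial>M i)"
    and "(\<lambda>x. \<integral>\<^sup>+ v. f (v(i := x)) \<partial>PiM I M) \<in> borel_measurable (M i)"
proof -
  interpret P: prob_space "PiM I M" by (intro prob_space_PiM M)
  have ins: "insert i I = I" using i by auto
  have upd: "(\<lambda>(x, v). v(i := x)) \<in> M i \<Otimes>\<^sub>M PiM I M \<rightarrow>\<^sub>M PiM I M"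
    using measurable_compose[OF measurable_pair_swap' measurable_add_dim[of i I M]] unfolding ins
    by (simp add: case_prod_beta')
  have fm: "(\<lambda>p. f (case p of (x, v) \<Rightarrow> v(i := x))) \<in> borel_measurable (M i \<Otimes>\<^sub>M PiM I M)"
    by (rule measurable_compose[OF upd f])
  have "distr (M i \<Otimes>\<^sub>M PiM I M) (PiM I M) (\<lambda>(x, v). v(i := x)) = PiM I M"
    using distr_pair_PiM_eq_PiM[of I M i] M i unfolding ins by auto
  then have "(\<integral>\<^sup>+ v. f v \<partial>PiM I M) = (\<integral>\<^sup>+ v. f v \<partial>distr (M i \<Otimes>\<^sub>M PiM I M) (PiM I M) (\<lambda>(x, v). v(i := x)))"
    by simp
  also have "\<dots> = (\<integral>\<^sup>+ p. f (case p of (x, v) \<Rightarrow> v(i := x)) \<partial>(M i \<Otimes>\<^sub>M PiM I M))"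
    by (rule nn_integral_distr[OF upd]) (use f in simp)
  also have "\<dots> = (\<integral>\<^sup>+ x. (\<integral>\<^sup>+ v. f (v(i := x)) \<partial>PiM I M) \<partial>M i)"
    using P.nn_integral_fst[OF fm] by simp
  finally show "(\<integral>\<^sup>+ v. f v \<partial>PiM I M) = (\<integral>\<^sup>+ x. (\<integral>\<^sup>+ v. f (v(i := x)) \<partial>PiM I M) \<partial>M i)" .
  show "(\<lambda>x. \<integral>\<^sup>+ v. f (v(i := x)) \<partial>PiM I M) \<in> borel_measurable (M i)"
    using P.borel_measurable_nn_integral_fst[OF fm] by simp
qed

lemma nn_integral_allsteps_resample:
  assumes i: "i < n" and f: "f \<in> borel_measurable (allsteps n)"
  shows "(\<integral>\<^sup>+ u. f u \<partial>allsteps n) =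
    (\<integral>\<^sup>+ e. (\<integral>\<^sup>+ u. f (u(i := (u i)(k := e))) \<partial>allsteps n) \<partial>measure_pmf step_pmf)"
proof -
  define h where "h = (\<lambda>v. \<integral>\<^sup>+ u. f (u(i := v)) \<partial>allsteps n)"
  have h: "h \<in> borel_measurable stepm" "(\<integral>\<^sup>+ u. f u \<partial>allsteps n) = (\<integral>\<^sup>+ v. h v \<partial>stepm)"
    unfolding h_def using nn_integral_PiM_resample[of "{..<n}" "\<lambda>_. stepm" i f] i f prob_stepm
    unfolding allsteps_def by auto
  have upd: "(\<lambda>u. u(i := (u i)(k := e))) \<in> allsteps n \<rightarrow>\<^sub>M allsteps n" for e
  proof -
    have "(\<lambda>u. \<lambda>j\<in>{..<n}. \<lambda>m\<in>UNIV. if j = i \<and> m = k then e else u j m) \<in> allsteps n \<rightarrow>\<^sub>M allsteps n"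
    proof -
      have c: "(\<lambda>u. u j m) \<in> allsteps n \<rightarrow>\<^sub>M measure_pmf step_pmf" if "j < n" for j m
        unfolding allsteps_def stepm_def using that
        by (intro measurable_compose[OF measurable_component_singleton[of j "{..<n}"] measurable_component_singleton[of m UNIV]]) auto
      have "(\<lambda>u. \<lambda>j\<in>{..<n}. \<lambda>m\<in>UNIV. if j = i \<and> m = k then e else u j m) \<in> allsteps n \<rightarrow>\<^sub>M
          (\<Pi>\<^sub>M j\<in>{..<n}. \<Pi>\<^sub>M m\<in>UNIV. measure_pmf step_pmf)"
      proof (intro measurable_restrict)
        fix j m assume "j \<in> {..<n}"
        then show "(\<lambda>u. if j = i \<and> m = k then e else u j m) \<in> allsteps n \<rightarrow>\<^sub>M measure_pmf step_pmf"
          using c[of j m] by (cases "j = i \<and> m = k") auto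
      qed
      then show ?thesis by (simp add: allsteps_def stepm_def)
    qed
    moreover have "(\<lambda>j\<in>{..<n}. \<lambda>m\<in>UNIV. if j = i \<and> m = k then e else u j m) = u(i := (u i)(k := e))"
      if "u \<in> space (allsteps n)" for u
      using that i by (auto simp: fun_eq_iff allsteps_def space_PiM PiE_def extensional_def)
    ultimately show ?thesis by (simp cong: measurable_cong)
  qed
  have "(\<integral>\<^sup>+ u. f (u(i := (u i)(k := e))) \<partial>allsteps n) = (\<integral>\<^sup>+ v. h (v(k := e)) \<partial>stepm)" for e
    using nn_integral_PiM_resample(1)[of "{..<n}" "\<lambda>_. stepm" i "\<lambda>u. f (u(i := (u i)(k := e)))"]
      measurable_compose[OF upd f] i prob_stepm
    unfolding allsteps_def h_def by simp
  moreover have "(\<integral>\<^sup>+ v. h v \<partial>stepm) = (\<integral>\<^sup>+ e. (\<integral>\<^sup>+ v. h (v(k := e)) \<partial>stepm) \<partial>measure_pmf step_pmf)"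
    unfolding stepm_def
    by (rule nn_integral_PiM_resample(1)[OF prob_space_measure_pmf UNIV_I h(1)[unfolded stepm_def]])
  ultimately show ?thesis using h(2) by simp
qed

lemma avoid_measurable:
  assumes "set ls \<subseteq> {..<n}"
  shows "{u \<in> space (allsteps n). avoid G ls c x u} \<in> sets (allsteps n)"
  using assms
proof (induction ls arbitrary: c x)
  case (Cons l ls)
  have m: "(\<lambda>u. u l (c l)) \<in> allsteps n \<rightarrow>\<^sub>M count_space UNIV"
    unfolding allsteps_def stepm_def using Cons.prems
    by (intro measurable_compose[OF measurable_component_singleton]) auto
  have "{u \<in> space (allsteps n). avoid G (l # ls) c x u} =
    (if G x then (\<Union>e. ((\<lambda>u. u l (c l)) -` {e} \<inter> space (allsteps n)) \<inter>
       {u \<in> space (allsteps n). avoid G ls (c(l := Suc (c l))) (x(l := x l + e)) u}) else {})"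
    by auto
  also have "\<dots> \<in> sets (allsteps n)"
  proof (cases "G x")
    case True
    have "(\<Union>e. ((\<lambda>u. u l (c l)) -` {e} \<inter> space (allsteps n)) \<inter>
       {u \<in> space (allsteps n). avoid G ls (c(l := Suc (c l))) (x(l := x l + e)) u}) \<in> sets (allsteps n)"
    proof (rule sets.countable_UN'[OF countableI_type], rule image_subsetI)
      fix e
      show "((\<lambda>u. u l (c l)) -` {e} \<inter> space (allsteps n)) \<inter>
         {u \<in> space (allsteps n). avoid G ls (c(l := Suc (c l))) (x(l := x l + e)) u} \<in> sets (allsteps n)"
        by (rule sets.Int[OF measurable_sets[OF m] Cons.IH]) (use Cons.prems in auto)
    qed
    then show ?thesis using True by simp
  qed simp
  finally show ?case .
qed (auto intro!: sets.top)

text \<open>The first label \<open>l\<close> reads the step \<open>u l (c l)\<close>. Resampling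
  this entry does not affect the rest of the event, because the raised counter prevents it from
  being read again. So the measure is an average over the four steps, which is the recursion of
  \<open>surv\<close>.\<close>

lemma measure_avoid:
  assumes "set ls \<subseteq> {..<n}"
  shows "measure (allsteps n) {u \<in> space (allsteps n). avoid G ls c x u} = surv G (\<lambda>_. 1) ls x"
  using assms
proof (induction ls arbitrary: c x)
  case Nil
  interpret prob_space "allsteps n" by (rule prob_allsteps)
  show ?case using prob_space by simp
next
  case (Cons l ls)
  interpret P: prob_space "allsteps n" by (rule prob_allsteps)
  let ?c = "c(l := Suc (c l))"
  show ?case
  proof (cases "G x")
    case True
    let ?A = "{u \<in> space (allsteps n). avoid G (l # ls) c x u}"
    let ?B = "\<lambda>e. {u \<in> space (allsteps n). avoid G ls ?c (x(l := x l + e)) u}"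
    have l: "l < n" using Cons.prems by simp
    have A: "?A \<in> sets (allsteps n)" by (rule avoid_measurable[OF Cons.prems])
    have B: "?B e \<in> sets (allsteps n)" for e using Cons.prems by (intro avoid_measurable) auto
    have ind: "indicator ?A (u(l := (u l)(c l := e))) = (indicator (?B e) u :: ennreal)"
      if "u \<in> space (allsteps n)" for u e
    proof -
      have "u(l := (u l)(c l := e)) \<in> space (allsteps n)"
        using that l by (auto simp: allsteps_def space_PiM PiE_def extensional_def)
      moreover have "avoid G ls ?c (x(l := x l + e)) (u(l := (u l)(c l := e))) = avoid G ls ?c (x(l := x l + e)) u"
        by (rule avoid_cong) (auto split: if_splits)
      ultimately show ?thesis using that True by (simp add: indicator_def)
    qed
    have "emeasure (allsteps n) ?A = (\<integral>\<^sup>+ u. indicator ?A u \<partial>allsteps n)" using A by simp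
    also have "\<dots> = (\<integral>\<^sup>+ e. (\<integral>\<^sup>+ u. indicator ?A (u(l := (u l)(c l := e))) \<partial>allsteps n) \<partial>measure_pmf step_pmf)"
      by (rule nn_integral_allsteps_resample[OF l]) (use A in simp)
    also have "\<dots> = (\<integral>\<^sup>+ e. emeasure (allsteps n) (?B e) \<partial>measure_pmf step_pmf)"
    proof (rule nn_integral_cong)
      fix e
      have "(\<integral>\<^sup>+ u. indicator ?A (u(l := (u l)(c l := e))) \<partial>allsteps n) = (\<integral>\<^sup>+ u. indicator (?B e) u \<partial>allsteps n)"
        by (rule nn_integral_cong) (rule ind)
      also have "\<dots> = emeasure (allsteps n) (?B e)" using B by (rule nn_integral_indicator)
      finally show "(\<integral>\<^sup>+ u. indicator ?A (u(l := (u l)(c l := e))) \<partial>allsteps n) = emeasure (allsteps n) (?B e)" .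
    qed
    also have "\<dots> = (\<integral>\<^sup>+ e. ennreal (surv G (\<lambda>_. 1) ls (x(l := x l + e))) \<partial>measure_pmf step_pmf)"
      using Cons by (simp add: P.emeasure_eq_measure)
    also have "\<dots> = (\<Sum>e\<in>steps. ennreal (surv G (\<lambda>_. 1) ls (x(l := x l + e)))) / card steps"
      unfolding step_pmf_def by (rule nn_integral_pmf_of_set) auto
    also have "(\<Sum>e\<in>steps. ennreal (surv G (\<lambda>_. 1) ls (x(l := x l + e)))) =
        ennreal (\<Sum>e\<in>steps. surv G (\<lambda>_. 1) ls (x(l := x l + e)))"
      by (rule sum_ennreal) (auto intro: surv_nonneg)
    also have "\<dots> / card steps = ennreal (surv G (\<lambda>_. 1) (l # ls) x)"
    proof -
      have c: "(of_nat (card steps) :: ennreal) = ennreal 4" by simp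
      have nn: "0 \<le> (\<Sum>e\<in>steps. surv G (\<lambda>_. 1) ls (x(l := x l + e)))"
        by (intro sum_nonneg surv_nonneg) simp
      show ?thesis unfolding c divide_ennreal[OF nn zero_less_numeral] by (simp only: surv.simps True if_True)
    qed
    finally show ?thesis
      using surv_nonneg[of "\<lambda>_. 1" G "l # ls" x]
      by (simp only: P.emeasure_eq_measure ennreal_inj[OF measure_nonneg] zero_le_one simp_thms)
  qed simp
qed

subsection \<open>Measurability of the collision event\<close>

definition noise :: "nat \<Rightarrow> (nat \<Rightarrow> nat \<Rightarrow> real \<times> (int \<times> int)) measure" where
  "noise n = (\<Pi>\<^sub>M i\<in>{..<n}. walk_noise)"

lemma walks_noise_completion: "walks_noise n = completion (noise n)"
  unfolding walks_noise_def noise_def ..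

lemma prob_noise: "prob_space (noise n)"
  unfolding noise_def by (intro prob_space_PiM prob_space_walk_noise)

definition bad :: "nat \<Rightarrow> (int \<times> int) set set \<Rightarrow> (nat \<Rightarrow> int \<times> int) \<Rightarrow> bool" where
  "bad n S x \<longleftrightarrow> min (points_sep n x) (points_rects_sep d1 n x S) = 1"

lemma walk_measurable: "(\<lambda>\<xi>. walk p \<xi> t) \<in> walk_noise \<rightarrow>\<^sub>M count_space UNIV"
proof -
  have f: "(\<lambda>\<xi>. \<xi> k) \<in> walk_noise \<rightarrow>\<^sub>M expm \<Otimes>\<^sub>M measure_pmf step_pmf" for k
    unfolding walk_noise_alt by measurable
  have f1: "(\<lambda>\<xi>. fst (\<xi> k)) \<in> borel_measurable walk_noise" for k
    using measurable_compose[OF f measurable_fst] by (simp add: measurable_cong_sets[OF refl sets_expm])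
  have f2: "(\<lambda>\<xi>. snd (\<xi> k)) \<in> walk_noise \<rightarrow>\<^sub>M count_space UNIV" for k
    using measurable_compose[OF f measurable_snd] by simp
  have "(\<lambda>\<xi>. jump_time \<xi> k) \<in> borel_measurable walk_noise" for k
    unfolding jump_time_def by (intro borel_measurable_sum f1)
  then have jc: "(\<lambda>\<xi>. jump_count \<xi> t) \<in> walk_noise \<rightarrow>\<^sub>M count_space UNIV"
    unfolding jump_count_def by (intro measurable_card) measurable
  have s: "(\<lambda>\<xi>. p + (\<Sum>k<m. snd (\<xi> k))) \<in> walk_noise \<rightarrow>\<^sub>M count_space UNIV" for m
  proof (induction m)
    case (Suc m)
    have "(\<lambda>\<xi>. e + snd (\<xi> m)) \<in> walk_noise \<rightarrow>\<^sub>M count_space UNIV" for e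
      by (rule measurable_compose[OF f2]) simp
    from measurable_compose_countable[where f="\<lambda>e \<xi>. e + snd (\<xi> m)", OF this Suc.IH]
    show ?case by (simp add: add.assoc)
  qed simp
  show ?thesis unfolding walk_def by (rule measurable_compose_countable[OF s jc])
qed

lemma walks_measurable: "i < n \<Longrightarrow> (\<lambda>\<omega>. walks z \<omega> t i) \<in> noise n \<rightarrow>\<^sub>M count_space UNIV"
  unfolding walks_def noise_def
  by (rule measurable_compose[OF measurable_component_singleton[of i "{..<n}" "\<lambda>_. walk_noise"] walk_measurable]) simp

lemma bad_measurable:
  assumes "finite S"
  shows "{\<omega> \<in> space (noise n). bad n S (walks z \<omega> t)} \<in> sets (noise n)"
proof -
  have c: "(\<lambda>\<omega>. h (walks z \<omega> t i)) \<in> borel_measurable (noise n)" if "i < n" for h :: "int \<times> int \<Rightarrow> ereal" and i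
    by (rule measurable_compose[OF walks_measurable[OF that]]) simp
  have d: "(\<lambda>\<omega>. ereal (d1 (walks z \<omega> t i) (walks z \<omega> t j))) \<in> borel_measurable (noise n)" if "i < n" "j < n" for i j
    by (rule measurable_compose_countable[OF c[OF that(2)] walks_measurable[OF that(1)]])
  have "(\<lambda>\<omega>. min (points_sep n (walks z \<omega> t)) (points_rects_sep d1 n (walks z \<omega> t) S)) \<in> borel_measurable (noise n)"
    unfolding points_sep_def points_rects_sep_def
    by (intro borel_measurable_min borel_measurable_INF c d) (auto simp: countable_finite assms)
  then show ?thesis unfolding bad_def by measurable
qed

text \<open>Survival tested at rational times only, so that it is measurable before completion. The
  rational \<open>q\<close> beyond \<open>T\<close> is needed because the collision time is an
  infimum and has to exceed \<open>T\<close> strictly.\<close>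

definition surv_event :: "nat \<Rightarrow> (int \<times> int) set set \<Rightarrow> (nat \<Rightarrow> int \<times> int) \<Rightarrow> real \<Rightarrow>
    (nat \<Rightarrow> nat \<Rightarrow> real \<times> (int \<times> int)) \<Rightarrow> bool" where
  "surv_event n S z T \<omega> \<longleftrightarrow> (\<exists>q\<in>\<rat>. T < q \<and> (\<forall>t\<in>\<rat>. 0 \<le> t \<longrightarrow> t < q \<longrightarrow> \<not> bad n S (walks z \<omega> t)))"

lemma surv_event_measurable:
  assumes "finite S"
  shows "{\<omega> \<in> space (noise n). surv_event n S z T \<omega>} \<in> sets (noise n)"
proof -
  have b: "{\<omega> \<in> space (noise n). \<not> bad n S (walks z \<omega> t)} \<in> sets (noise n)" for t
    by (rule sets.sets_Collect_neg[OF bad_measurable[OF assms]])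
  show ?thesis unfolding surv_event_def
    by (intro sets.sets_Collect_countable_Ex' sets.sets_Collect_conj sets.sets_Collect_countable_All'
        sets.sets_Collect_imp sets.sets_Collect_const b countable_rat)
qed

lemma AE_noise_regular:
  "AE \<omega> in noise n. \<forall>i<n. (\<forall>k. 0 < fst (\<omega> i k)) \<and> (\<forall>t. \<exists>k. t < (\<Sum>j<k. fst (\<omega> i j)))"
proof -
  interpret S: prob_space stepm by (rule prob_stepm)
  let ?f = "\<lambda>(\<xi> :: nat \<Rightarrow> real \<times> (int \<times> int)) k. fst (\<xi> k)"
  have f: "?f \<in> walk_noise \<rightarrow>\<^sub>M waitm"
  proof -
    have "(\<lambda>\<xi>. \<lambda>k\<in>UNIV. fst (\<xi> k)) \<in> walk_noise \<rightarrow>\<^sub>M waitm"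
      unfolding walk_noise_alt waitm_def by measurable
    then show ?thesis by (simp add: restrict_UNIV)
  qed
  have "distr walk_noise waitm ?f = distr (waitm \<Otimes>\<^sub>M stepm) waitm (?f \<circ> (\<lambda>(w, u) k. (w k, u k)))"
    by (subst walk_noise_zip) (rule distr_distr[OF f measurable_zip1])
  also have "?f \<circ> (\<lambda>(w, u) k. (w k, u k)) = fst" by (auto simp: fun_eq_iff)
  also have "distr (waitm \<Otimes>\<^sub>M stepm) waitm fst = waitm" by (rule S.distr_pair_fst)
  finally have D: "distr walk_noise waitm ?f = waitm" .
  have "AE w in waitm. (\<forall>k. 0 < w k) \<and> (\<forall>t. \<exists>k. t < (\<Sum>j<k. w j))"
    using AE_waitm_pos AE_waitm_unbounded by (rule AE_conjI)
  then have "AE \<xi> in walk_noise. (\<forall>k. 0 < fst (\<xi> k)) \<and> (\<forall>t. \<exists>k. t < (\<Sum>j<k. fst (\<xi> j)))"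
    by (intro AE_distrD[OF f]) (simp only: D)
  then have "AE \<omega> in noise n. (\<forall>k. 0 < fst (\<omega> i k)) \<and> (\<forall>t. \<exists>k. t < (\<Sum>j<k. fst (\<omega> i j)))" if "i < n" for i
    unfolding noise_def using that by (intro AE_PiM_component prob_space_walk_noise) auto
  then have "AE \<omega> in noise n. \<forall>i\<in>{..<n}. (\<forall>k. 0 < fst (\<omega> i k)) \<and> (\<forall>t. \<exists>k. t < (\<Sum>j<k. fst (\<omega> i j)))"
    by (subst AE_ball_countable) auto
  then show ?thesis by (simp add: Ball_def)
qed

lemma jump_time_alt: "jump_time \<xi> k = (\<Sum>j<Suc k. fst (\<xi> j))"
  unfolding jump_time_def by (simp add: lessThan_Suc_atMost)

lemma jump_count_initial:
  assumes pos: "\<And>k. 0 < fst (\<xi> k)" and unb: "\<exists>k. t < (\<Sum>j<k. fst (\<xi> j))"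
  shows "{k. jump_time \<xi> k \<le> t} = {..<jump_count \<xi> t}" "t < jump_time \<xi> (jump_count \<xi> t)"
proof -
  have mono: "strict_mono (jump_time \<xi>)"
    unfolding strict_mono_Suc_iff jump_time_alt using pos by simp
  obtain k0 where "t < (\<Sum>j<k0. fst (\<xi> j))" using unb by auto
  then have "t < jump_time \<xi> k0" unfolding jump_time_alt using pos[of k0] by simp
  then have ex: "\<exists>k. t < jump_time \<xi> k" ..
  define m where "m = (LEAST k. t < jump_time \<xi> k)"
  have m: "t < jump_time \<xi> m" unfolding m_def by (rule LeastI_ex[OF ex])
  have "jump_time \<xi> k \<le> t \<longleftrightarrow> k < m" for k
  proof
    assume "jump_time \<xi> k \<le> t"
    then show "k < m" using m mono by (meson le_less_trans strict_mono_less)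
  next
    assume "k < m"
    then show "jump_time \<xi> k \<le> t" unfolding m_def using not_less_Least by force
  qed
  then have s: "{k. jump_time \<xi> k \<le> t} = {..<m}" by auto
  then have "jump_count \<xi> t = m" unfolding jump_count_def by simp
  then show "{k. jump_time \<xi> k \<le> t} = {..<jump_count \<xi> t}" "t < jump_time \<xi> (jump_count \<xi> t)" using s m by auto
qed

lemma bad_cong: "(\<And>i. i < n \<Longrightarrow> x i = y i) \<Longrightarrow> bad n S x = bad n S y"
proof -
  assume eq: "\<And>i. i < n \<Longrightarrow> x i = y i"
  have "points_sep n x = points_sep n y" "points_rects_sep d1 n x S = points_rects_sep d1 n y S"
    unfolding points_sep_def points_rects_sep_def by (intro INF_cong refl; simp add: eq)+
  then show ?thesis unfolding bad_def by simp
qed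

lemma surv_event_iff:
  assumes reg: "\<forall>i<n. (\<forall>k. 0 < fst (\<omega> i k)) \<and> (\<forall>t. \<exists>k. t < (\<Sum>j<k. fst (\<omega> i j)))" and "0 \<le> T"
  shows "surv_event n S z T \<omega> \<longleftrightarrow> ereal T < collision_time n S (walks z \<omega>)"
proof
  assume "surv_event n S z T \<omega>"
  then obtain q where q: "T < q" "\<And>t. t \<in> \<rat> \<Longrightarrow> 0 \<le> t \<Longrightarrow> t < q \<Longrightarrow> \<not> bad n S (walks z \<omega> t)"
    unfolding surv_event_def by auto
  have nb: "\<not> bad n S (walks z \<omega> t)" if t: "0 \<le> t" "t < q" for t
  proof -
    \<comment> \<open>No walk jumps between \<open>t\<close> and \<open>r\<close>, so a rational
      time in that interval shows the same configuration as \<open>t\<close>.\<close>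
    define r where "r = Min (insert q ((\<lambda>i. jump_time (\<omega> i) (jump_count (\<omega> i) t)) ` {..<n}))"
    have "t < r" unfolding r_def using t jump_count_initial(2)[of "\<omega> _" t] reg by (subst Min_gr_iff) auto
    then obtain t' where t': "t' \<in> \<rat>" "t < t'" "t' < r" using Rats_dense_in_real by blast
    have rq: "r \<le> q" unfolding r_def by simp
    have "walks z \<omega> t i = walks z \<omega> t' i" if i: "i < n" for i
    proof -
      have "r \<le> jump_time (\<omega> i) (jump_count (\<omega> i) t)" unfolding r_def using i by (intro Min_le) auto
      then have lt: "t' < jump_time (\<omega> i) (jump_count (\<omega> i) t)" using t' by simp
      have mono: "strict_mono (jump_time (\<omega> i))"
        unfolding strict_mono_Suc_iff jump_time_alt using reg i by simp
      have "{k. jump_time (\<omega> i) k \<le> t'} = {k. jump_time (\<omega> i) k \<le> t}"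
      proof (intro set_eqI iffI; clarsimp)
        fix k assume "jump_time (\<omega> i) k \<le> t'"
        then have "jump_time (\<omega> i) k < jump_time (\<omega> i) (jump_count (\<omega> i) t)" using lt by simp
        then have "k < jump_count (\<omega> i) t" using mono by (simp add: strict_mono_less)
        then show "jump_time (\<omega> i) k \<le> t" using jump_count_initial(1)[of "\<omega> i" t] reg i by blast
      qed (use t' in linarith)
      then show ?thesis unfolding walks_def walk_def jump_count_def by simp
    qed
    then have "bad n S (walks z \<omega> t) = bad n S (walks z \<omega> t')" by (rule bad_cong)
    then show ?thesis using q(2)[OF t'(1)] t t' rq by simp
  qed
  have "ereal q \<le> collision_time n S (walks z \<omega>)"
    unfolding collision_time_def
  proof (rule INF_greatest)
    fix t assume "t \<in> {t. 0 \<le> t \<and> min (points_sep n (walks z \<omega> t)) (points_rects_sep d1 n (walks z \<omega> t) S) = 1}"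
    then have "0 \<le> t" "bad n S (walks z \<omega> t)" unfolding bad_def by auto
    then show "ereal q \<le> ereal t" using nb[of t] by (cases "t < q") auto
  qed
  then show "ereal T < collision_time n S (walks z \<omega>)" using q(1)
    by (meson less_ereal.simps(1) less_le_trans)
next
  assume "ereal T < collision_time n S (walks z \<omega>)"
  then obtain q' where q': "ereal T < ereal q'" "ereal q' < collision_time n S (walks z \<omega>)"
    using ereal_dense2 by blast
  then obtain q where q: "q \<in> \<rat>" "T < q" "q < q'" using Rats_dense_in_real[of T q'] by auto
  have "\<not> bad n S (walks z \<omega> t)" if "0 \<le> t" "t < q" for t
  proof
    assume "bad n S (walks z \<omega> t)"
    then have "collision_time n S (walks z \<omega>) \<le> ereal t"
      unfolding collision_time_def using that by (intro INF_lower) (auto simp: bad_def)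
    moreover have "ereal t < ereal q'" using that q by simp
    ultimately show False using q'(2) by order
  qed
  then show "surv_event n S z T \<omega>" unfolding surv_event_def using q by blast
qed

text \<open>Outside the null set of irregular trajectories the two events agree; within it, the
  completion makes every subset measurable.\<close>

lemma measure_collision_ge:
  assumes "finite S" "0 \<le> T"
  shows "measure (noise n) {\<omega> \<in> space (noise n). surv_event n S z T \<omega>} \<le>
    measure (walks_noise n) {\<omega> \<in> space (walks_noise n). ereal T < collision_time n S (walks z \<omega>)}"
proof -
  interpret N: prob_space "noise n" by (rule prob_noise)
  interpret C: prob_space "completion (noise n)" by (rule N.prob_space_completion)
  let ?P = "{\<omega> \<in> space (noise n). surv_event n S z T \<omega>}"
  let ?E = "{\<omega> \<in> space (noise n). ereal T < collision_time n S (walks z \<omega>)}"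
  obtain N where N: "N \<in> null_sets (noise n)" and out: "\<And>\<omega>. \<omega> \<in> space (noise n) \<Longrightarrow> \<omega> \<notin> N \<Longrightarrow>
      (\<forall>i<n. (\<forall>k. 0 < fst (\<omega> i k)) \<and> (\<forall>t. \<exists>k. t < (\<Sum>j<k. fst (\<omega> i j))))"
    using AE_noise_regular[of n] by (elim AE_E3) auto
  have P: "?P \<in> sets (noise n)" by (rule surv_event_measurable[OF assms(1)])
  have Ns: "N \<in> sets (noise n)" using N by auto
  have eq: "\<omega> \<in> ?P \<longleftrightarrow> \<omega> \<in> ?E" if "\<omega> \<notin> N" for \<omega>
    using surv_event_iff[OF out[OF _ that] assms(2)] by blast
  have E: "?E = (?P - N) \<union> (?E \<inter> N)" using eq by blast
  have Em: "?E \<in> sets (completion (noise n))"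
    by (subst E, rule sets.Un) (use P Ns N null_sets_completion[OF N, of "?E \<inter> N"] in auto)
  have "measure (noise n) ?P = measure (noise n) (?P - N)"
    using N P by (simp add: measure_Diff_null_set)
  also have "\<dots> = measure (completion (noise n)) (?P - N)" using P Ns by (intro measure_completion[symmetric]) auto
  also have "\<dots> \<le> measure (completion (noise n)) ?E"
    by (rule C.finite_measure_mono[OF _ Em]) (use eq in blast)
  finally show ?thesis unfolding walks_noise_completion by simp
qed

subsection \<open>The order of the jumps\<close>

definition jt :: "(nat \<Rightarrow> nat \<Rightarrow> real) \<Rightarrow> nat \<Rightarrow> nat \<Rightarrow> real" where
  "jt w i k = (\<Sum>j<Suc k. w i j)"

definition jnum :: "(nat \<Rightarrow> nat \<Rightarrow> real) \<Rightarrow> nat \<Rightarrow> real \<Rightarrow> nat" where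
  "jnum w i t = card {k. jt w i k \<le> t}"

definition regular :: "nat \<Rightarrow> (nat \<Rightarrow> nat \<Rightarrow> real) \<Rightarrow> bool" where
  "regular n w \<longleftrightarrow> (\<forall>i<n. (\<forall>k. 0 < w i k) \<and> (\<forall>t. \<exists>k. t < jt w i k))"

lemma regular_mono: "regular n w \<Longrightarrow> i < n \<Longrightarrow> strict_mono (jt w i)"
  unfolding strict_mono_Suc_iff jt_def regular_def by simp

lemma regular_finite:
  assumes "regular n w" "i < n"
  shows "finite {k. jt w i k \<le> t}"
proof -
  obtain k0 where k0: "t < jt w i k0" using assms unfolding regular_def by blast
  have "{k. jt w i k \<le> t} \<subseteq> {..<k0}"
  proof
    fix k assume "k \<in> {k. jt w i k \<le> t}"
    then have "jt w i k < jt w i k0" using k0 by simp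
    then show "k \<in> {..<k0}" using strict_mono_less[OF regular_mono[OF assms]] by simp
  qed
  then show ?thesis by (rule finite_subset) simp
qed

lemma count_list_map_fst:
  "distinct ys \<Longrightarrow> count_list (map fst ys) i = card {k. (i, k) \<in> set ys}"
proof (induction ys)
  case (Cons y ys)
  obtain a b where y: "y = (a, b)" by (cases y)
  have fin: "finite {k. (i, k) \<in> set ys}" 
    by (rule finite_subset[of _ "snd ` set ys"]) force+
  show ?case
  proof (cases "a = i")
    case True
    then have "{k. (i, k) \<in> set (y # ys)} = insert b {k. (i, k) \<in> set ys}" using y by auto
    then show ?thesis using Cons True y fin by simp
  next
    case False
    then have "{k. (i, k) \<in> set (y # ys)} = {k. (i, k) \<in> set ys}" using y by auto
    then show ?thesis using Cons False y by simp
  qed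
qed simp

lemma down_closed_nat:
  assumes "finite K" "\<And>k k' :: nat. k \<in> K \<Longrightarrow> k' < k \<Longrightarrow> k' \<in> K"
  shows "K = {..<card K}"
proof -
  have "\<exists>m. K = {..<m}"
  proof (cases "K = {}")
    case False
    have "K = {..<Suc (Max K)}"
    proof (intro set_eqI iffI)
      fix k assume "k \<in> {..<Suc (Max K)}"
      then have "k \<le> Max K" by simp
      then show "k \<in> K" using assms(2)[OF Max_in[OF assms(1) False], of k] Max_in[OF assms(1) False]
        by (cases "k = Max K") auto
    qed (use assms in \<open>auto simp: less_Suc_eq_le\<close>)
    then show ?thesis ..
  qed (auto intro: exI[of _ 0])
  then show ?thesis by auto
qed

lemma sorted_prefix_le:
  fixes key :: "'a \<Rightarrow> real"
  assumes "sorted (map key L)"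
  shows "\<exists>m\<le>length L. set (take m L) = {a \<in> set L. key a \<le> t}"
  using assms
proof (induction L)
  case (Cons a L)
  then obtain m where m: "m \<le> length L" "set (take m L) = {a \<in> set L. key a \<le> t}" by auto
  show ?case
  proof (cases "key a \<le> t")
    case True
    then show ?thesis using m by (intro exI[of _ "Suc m"]) auto
  next
    case False
    then show ?thesis using Cons.prems by (intro exI[of _ 0]) force
  qed
qed simp

text \<open>The jumps up to time \<open>T\<close> are sorted by their times. Ties may fall in any
  order, since a time \<open>t\<close> selects all jumps that are not later. The comparison with the
  next jump of another walk also holds when that jump lies beyond \<open>T\<close> and is not in the
  list.\<close>

lemma jump_order:
  assumes reg: "regular n w"
  obtains xs where "set xs \<subseteq> {..<n}"
    "\<And>t. t \<le> T \<Longrightarrow> \<exists>m\<le>length xs. \<forall>i<n. count_list (take m xs) i = jnum w i t"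
    "\<And>m i j. i < n \<Longrightarrow> j < n \<Longrightarrow> 0 < count_list (take m xs) i \<Longrightarrow>
      jt w i (count_list (take m xs) i - 1) \<le> jt w j (count_list (take m xs) j)"
    "\<And>i. i < n \<Longrightarrow> count_list xs i = jnum w i T"
proof -
  define J where "J = (SIGMA i:{..<n}. {k. jt w i k \<le> T})"
  define key where "key = (\<lambda>(i, k). jt w i k)"
  have finJ: "finite J" unfolding J_def using regular_finite[OF reg] by auto
  then obtain xs0 where xs0: "set xs0 = J" "distinct xs0" using finite_distinct_list by blast
  define L where "L = sort_key key xs0"
  have L: "set L = J" "distinct L" "sorted (map key L)" unfolding L_def using xs0 by auto
  define xs where "xs = map fst L"
  have cnt: "count_list (take m xs) i = card {k. (i, k) \<in> set (take m L)}" for m i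
    unfolding xs_def take_map using L(2) by (intro count_list_map_fst) simp
  have split: "key a \<le> key b" if "a \<in> set (take m L)" "b \<in> J" "b \<notin> set (take m L)" for a b m
  proof -
    have "b \<in> set (drop m L)" using that L(1) by (metis Un_iff append_take_drop_id set_append)
    moreover have "sorted (map key (take m L) @ map key (drop m L))"
      using L(3) by (simp flip: map_append)
    ultimately show ?thesis using that(1) by (auto simp: sorted_append)
  qed
  \<comment> \<open>The jump times of one walk increase strictly, so a prefix of the sorted list
    contains an initial segment of its jumps.\<close>
  have K: "{k. (i, k) \<in> set (take m L)} = {..<count_list (take m xs) i}" if i: "i < n" for i m
    unfolding cnt
  proof (rule down_closed_nat)
    show "finite {k. (i, k) \<in> set (take m L)}"
      by (rule finite_subset[of _ "snd ` set (take m L)"]) force+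
    fix k k' assume k: "k \<in> {k. (i, k) \<in> set (take m L)}" and lt: "k' < k"
    have less: "jt w i k' < jt w i k" using regular_mono[OF reg i] lt by (simp add: strict_mono_less)
    have "(i, k) \<in> J" using k L(1) set_take_subset[of m L] by auto
    then have "(i, k') \<in> J" using less unfolding J_def by auto
    then show "k' \<in> {k. (i, k) \<in> set (take m L)}"
      using split[of "(i, k)" m "(i, k')"] k less unfolding key_def by force
  qed
  show thesis
  proof (rule that[of xs])
    show "set xs \<subseteq> {..<n}" unfolding xs_def set_map L(1) J_def by (rule image_subsetI) auto
    show "\<exists>m\<le>length xs. \<forall>i<n. count_list (take m xs) i = jnum w i t" if "t \<le> T" for t
    proof -
      obtain m where m: "m \<le> length L" "set (take m L) = {a \<in> set L. key a \<le> t}"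
        using sorted_prefix_le[OF L(3)] by blast
      have "{k. (i, k) \<in> set (take m L)} = {k. jt w i k \<le> t}" if "i < n" for i
        unfolding m(2) L(1) J_def key_def using that \<open>t \<le> T\<close> by auto
      then have "\<forall>i<n. count_list (take m xs) i = jnum w i t" unfolding cnt jnum_def by simp
      then show ?thesis using m(1) unfolding xs_def by (intro exI[of _ m]) simp
    qed
    show "jt w i (count_list (take m xs) i - 1) \<le> jt w j (count_list (take m xs) j)"
      if "i < n" "j < n" "0 < count_list (take m xs) i" for m i j
    proof -
      have a: "(i, count_list (take m xs) i - 1) \<in> set (take m L)"
      proof -
        have "count_list (take m xs) i - 1 \<in> {k. (i, k) \<in> set (take m L)}"
          by (subst K[OF that(1)]) (use that(3) in simp)
        then show ?thesis by (simp only: mem_Collect_eq)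
      qed
      have b: "(j, count_list (take m xs) j) \<notin> set (take m L)"
      proof
        assume "(j, count_list (take m xs) j) \<in> set (take m L)"
        then have "count_list (take m xs) j \<in> {k. (j, k) \<in> set (take m L)}" by (simp only: mem_Collect_eq)
        then show False by (subst (asm) K[OF that(2)]) simp
      qed
      show ?thesis
      proof (cases "(j, count_list (take m xs) j) \<in> J")
        case True
        then show ?thesis using split[OF a True b] by (simp add: key_def)
      next
        case False
        then have "T < jt w j (count_list (take m xs) j)" using that(2) unfolding J_def by auto
        moreover have "(i, count_list (take m xs) i - 1) \<in> J" using a L(1) set_take_subset[of m L] by auto
        ultimately show ?thesis unfolding J_def by auto
      qed
    qed
    show "count_list xs i = jnum w i T" if "i < n" for i
    proof -
      have "{k. (i, k) \<in> set L} = {k. jt w i k \<le> T}" unfolding L(1) J_def using that by auto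
      then show ?thesis using cnt[of "length xs" i] unfolding jnum_def by (simp add: xs_def)
    qed
  qed
qed

lemma walks_zipn:
  "i < n \<Longrightarrow> walks z (zipn n (w, u)) t i = z i + (\<Sum>k<jnum w i t. u i k)"
  unfolding walks_def walk_def jump_count_def jump_time_alt jnum_def jt_def zipn_def by simp

text \<open>The order is taken up to time T + 1 to leave room for the rational \<open>q\<close>
  beyond \<open>T\<close> in \<open>surv_event\<close>.\<close>

lemma avoid_surv_event:
  assumes G: "\<And>x. G x \<Longrightarrow> \<not> bad n S x"
    and xs: "\<And>t. t \<le> T + 1 \<Longrightarrow> \<exists>m\<le>length xs. \<forall>i<n. count_list (take m xs) i = jnum w i t"
    and av: "avoid G xs (\<lambda>_. 0) z u"
  shows "surv_event n S z T (zipn n (w, u))"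
proof -
  obtain q where q: "q \<in> \<rat>" "T < q" "q < T + 1" using Rats_dense_in_real[of T "T + 1"] by auto
  have "\<not> bad n S (walks z (zipn n (w, u)) t)" if t: "t < q" for t
  proof -
    obtain m where m: "m \<le> length xs" "\<forall>i<n. count_list (take m xs) i = jnum w i t"
      using xs[of t] t q by auto
    have "\<not> bad n S (\<lambda>i. z i + (\<Sum>k<count_list (take m xs) i. u i (0 + k)))"
      by (rule G[OF avoid_prefix[OF av m(1)]])
    then show ?thesis using m(2) by (subst bad_cong) (auto simp: walks_zipn)
  qed
  then show ?thesis unfolding surv_event_def using q by blast
qed

subsection \<open>Waiting times that force the first jumps and synchronise the later ones\<close>

definition forced :: "(nat \<Rightarrow> nat) \<Rightarrow> nat list \<Rightarrow> nat list" where
  "forced l ord = concat (map (\<lambda>i. replicate (l i) i) ord)"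

lemma count_forced:
  "distinct ord \<Longrightarrow> count_list (forced l ord) i = (if i \<in> set ord then l i else 0)"
proof (induction ord)
  case (Cons a ord)
  have "count_list (replicate m a) i = (if i = a then m else 0)" for m by (induction m) auto
  then show ?case using Cons by (auto simp: forced_def)
qed (simp add: forced_def)

lemma length_forced: "length (forced l ord) = (\<Sum>i\<leftarrow>ord. l i)"
  unfolding forced_def by (simp add: length_concat comp_def)

lemma forced_nth:
  assumes "distinct ord" "m < length (forced l ord)"
  shows "\<exists>pre i post c. ord = pre @ i # post \<and> forced l ord ! m = i \<and> c < l i \<and>
    (\<forall>j. count_list (take m (forced l ord)) j = (if j \<in> set pre then l j else if j = i then c else 0))"
  using assms
proof (induction ord arbitrary: m)
  case (Cons a ord)
  have f: "forced l (a # ord) = replicate (l a) a @ forced l ord" by (simp add: forced_def)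
  have cr: "count_list (replicate m a) i = (if i = a then m else 0)" for m i by (induction m) auto
  show ?case
  proof (cases "m < l a")
    case True
    then show ?thesis unfolding f
      by (intro exI[of _ "[]"] exI[of _ a] exI[of _ ord] exI[of _ m]) (auto simp: nth_append cr min_def)
  next
    case False
    then have "m - l a < length (forced l ord)" using Cons.prems unfolding f by auto
    then obtain pre i post c where ih: "ord = pre @ i # post" "forced l ord ! (m - l a) = i" "c < l i"
      "\<And>j. count_list (take (m - l a) (forced l ord)) j = (if j \<in> set pre then l j else if j = i then c else 0)"
      using Cons.IH[of "m - l a"] Cons.prems by auto
    have "a \<noteq> i" "a \<notin> set pre" using Cons.prems ih(1) by auto
    then show ?thesis unfolding f using False ih
      by (intro exI[of _ "a # pre"] exI[of _ i] exI[of _ post] exI[of _ c]) (auto simp: nth_append cr)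
  qed
qed (simp add: forced_def)

text \<open>Walk \<open>i\<close> receives the time slot from \<open>pos i\<close> to
  \<open>pos i + 1\<close>: its first jump falls in the first half, and the other forced waits, each
  below 1 / (2 l i), do not leave the slot. The wait with index \<open>l i\<close> exceeds
  \<open>n\<close>, so no unforced jump happens before all slots are over. Testing
  \<open>k = l i\<close> first covers walks without forced jumps.\<close>

definition win :: "nat \<Rightarrow> (nat \<Rightarrow> nat) \<Rightarrow> (nat \<Rightarrow> nat) \<Rightarrow> nat \<Rightarrow> nat \<Rightarrow> real set" where
  "win n l pos i k = (if k = l i then {real n<..<real n + 1}
     else if k = 0 then {real (pos i)<..<real (pos i) + 1 / 2} else {0<..<1 / (2 * real (l i))})"

definition goodw :: "nat \<Rightarrow> (nat \<Rightarrow> nat) \<Rightarrow> (nat \<Rightarrow> nat) \<Rightarrow> real \<Rightarrow> nat \<Rightarrow> nat \<Rightarrow> (nat \<Rightarrow> real) set" where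
  "goodw n l pos \<epsilon> k0 i = {v. (\<forall>k<Suc (l i). v k \<in> win n l pos i k) \<and> (\<lambda>k. v (Suc (l i) + k)) \<in> lln_set \<epsilon> k0}"

context
  fixes n :: nat and l pos :: "nat \<Rightarrow> nat" and \<epsilon> :: real and k0 :: nat and w :: "nat \<Rightarrow> nat \<Rightarrow> real"
  assumes eps: "0 < \<epsilon>" "\<epsilon> < 1" and all_pos: "\<forall>i<n. pos i < n"
    and all_good: "\<forall>i<n. w i \<in> goodw n l pos \<epsilon> k0 i"
begin

lemma pos: "i < n \<Longrightarrow> pos i < n" and good: "i < n \<Longrightarrow> w i \<in> goodw n l pos \<epsilon> k0 i"
  using all_pos all_good by auto

lemma good_tail: "i < n \<Longrightarrow> (\<lambda>k. w i (Suc (l i) + k)) \<in> lln_set \<epsilon> k0"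
  using good unfolding goodw_def by auto

lemma good_win: "i < n \<Longrightarrow> k < Suc (l i) \<Longrightarrow> w i k \<in> win n l pos i k"
  using good unfolding goodw_def by auto

lemma good_pos:
  assumes i: "i < n"
  shows "0 < w i k"
proof (cases "k < Suc (l i)")
  case True
  then show ?thesis using good_win[OF i True] by (auto simp: win_def split: if_splits)
next
  case False
  then have k: "k = Suc (l i) + (k - Suc (l i))" by simp
  have "0 < w i (Suc (l i) + (k - Suc (l i)))" using good_tail[OF i] unfolding lln_set_def by blast
  then show ?thesis using k by simp
qed

lemma good_forced_time:
  assumes i: "i < n" and k: "k < l i"
  shows "real (pos i) < jt w i k" "jt w i k < real (pos i) + 1"
proof -
  have "real (pos i) < jt w i k \<and> jt w i k < real (pos i) + 1 / 2 + k * (1 / (2 * l i))"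
    using k
  proof (induction k)
    case 0
    then show ?case using good_win[OF i, of 0] by (simp add: jt_def win_def)
  next
    case (Suc k)
    have "w i (Suc k) \<in> {0<..<1 / (2 * real (l i))}" using good_win[OF i, of "Suc k"] Suc.prems by (simp add: win_def)
    then show ?case using Suc by (simp add: jt_def add_divide_distrib)
  qed
  moreover have "k * (1 / (2 * real (l i))) \<le> 1 / 2" using k by (simp add: field_simps)
  ultimately show "real (pos i) < jt w i k" "jt w i k < real (pos i) + 1" by linarith+
qed

text \<open>The forced jumps end before pos i + 1 <= n, and the long wait lasts between
  \<open>n\<close> and \<open>n + 1\<close>; so the first unforced jump falls between
  \<open>n\<close> and \<open>2 n + 1\<close>.\<close>

lemma good_later_time:
  assumes i: "i < n"
  shows "real n + (\<Sum>q<r. w i (Suc (l i) + q)) < jt w i (l i + r)"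
    "jt w i (l i + r) < 2 * real n + 1 + (\<Sum>q<r. w i (Suc (l i) + q))"
proof -
  have s: "jt w i (l i + r) = jt w i (l i) + (\<Sum>q<r. w i (Suc (l i) + q))"
    by (induction r) (auto simp: jt_def)
  have "n < jt w i (l i) \<and> jt w i (l i) < 2 * real n + 1"
  proof (cases "l i")
    case 0
    then show ?thesis using good_win[OF i, of 0] by (simp add: jt_def win_def)
  next
    case (Suc k)
    have "w i (l i) \<in> {real n<..<real n + 1}" using good_win[OF i, of "l i"] by (simp add: win_def)
    moreover have "jt w i (l i) = jt w i k + w i (l i)" using Suc by (simp add: jt_def)
    moreover have "real (pos i) + 1 \<le> n" using pos[OF i] by simp
    ultimately show ?thesis using good_forced_time[OF i, of k] Suc by simp
  qed
  then show "real n + (\<Sum>q<r. w i (Suc (l i) + q)) < jt w i (l i + r)"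
    "jt w i (l i + r) < 2 * real n + 1 + (\<Sum>q<r. w i (Suc (l i) + q))" using s by auto
qed

lemma good_lln:
  assumes i: "i < n" and "k0 \<le> r"
  shows "(1 - \<epsilon>) * r < (\<Sum>q<r. w i (Suc (l i) + q))" "(\<Sum>q<r. w i (Suc (l i) + q)) < (1 + \<epsilon>) * r"
  using good_tail[OF i] assms(2) unfolding lln_set_def by auto

lemma good_regular: "regular n w"
  unfolding regular_def
proof (intro allI impI conjI)
  fix i assume i: "i < n"
  show "0 < w i k" for k by (rule good_pos[OF i])
  show "\<exists>k. t < jt w i k" for t
  proof -
    obtain r0 :: nat where r0: "t / (1 - \<epsilon>) < r0" using reals_Archimedean2 by blast
    define r where "r = max r0 k0"
    have "t < (1 - \<epsilon>) * r0" using r0 eps by (simp add: field_simps)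
    also have "\<dots> \<le> (1 - \<epsilon>) * r" unfolding r_def using eps by (intro mult_left_mono) auto
    also have "\<dots> < (\<Sum>q<r. w i (Suc (l i) + q))" by (rule good_lln[OF i]) (simp add: r_def)
    also have "\<dots> \<le> jt w i (l i + r)" using good_later_time(1)[OF i, of r] by simp
    finally show ?thesis ..
  qed
qed

context
  fixes xs ord :: "nat list" and T :: real
  assumes ord: "distinct ord" "set ord = {..<n}"
    and all_pos_ord: "\<forall>pre i post. ord = pre @ i # post \<longrightarrow> (\<forall>j\<in>set post. pos i < pos j)"
    and xs: "set xs \<subseteq> {..<n}"
    and all_order: "\<forall>m. \<forall>i<n. \<forall>j<n. 0 < count_list (take m xs) i \<longrightarrow>
      jt w i (count_list (take m xs) i - 1) \<le> jt w j (count_list (take m xs) j)"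
    and all_final: "\<forall>i<n. count_list xs i = jnum w i T"
    and T: "real n \<le> T"
begin

lemma pos_ord: "ord = pre @ i # post \<Longrightarrow> j \<in> set post \<Longrightarrow> pos i < pos j"
  and order: "i < n \<Longrightarrow> j < n \<Longrightarrow> 0 < count_list (take m xs) i \<Longrightarrow>
      jt w i (count_list (take m xs) i - 1) \<le> jt w j (count_list (take m xs) j)"
  and final: "i < n \<Longrightarrow> count_list xs i = jnum w i T"
  using all_pos_ord all_order all_final by auto

lemma good_count_ge: "i < n \<Longrightarrow> l i \<le> count_list xs i"
proof -
  assume i: "i < n"
  have "{..<l i} \<subseteq> {k. jt w i k \<le> T}"
  proof
    fix k assume "k \<in> {..<l i}"
    then have "jt w i k < real (pos i) + 1" using good_forced_time(2)[OF i, of k] by simp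
    then show "k \<in> {k. jt w i k \<le> T}" using pos[OF i] T by simp
  qed
  then have "card {..<l i} \<le> card {k. jt w i k \<le> T}"
    by (rule card_mono[OF regular_finite[OF good_regular i]])
  then show ?thesis unfolding final[OF i] jnum_def by simp
qed

text \<open>While walk \<open>i\<close> is served, its next jump comes before pos i + 1 <= n. A walk
  served earlier has only unforced jumps left, all later than \<open>n\<close>, and a walk served
  afterwards does not start before its own, larger position. So the next label can only be
  \<open>i\<close>.\<close>

lemma good_forced_prefix: "take (length (forced l ord)) xs = forced l ord"
proof -
  have "take m xs = take m (forced l ord)" if "m \<le> length (forced l ord)" for m
    using that
  proof (induction m)
    case (Suc m)
    then have eq: "take m xs = take m (forced l ord)" by simp
    obtain pre i post c where F: "ord = pre @ i # post" "forced l ord ! m = i" "c < l i"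
      "\<And>j. count_list (take m (forced l ord)) j = (if j \<in> set pre then l j else if j = i then c else 0)"
      using forced_nth[OF ord(1), of m l] Suc.prems by auto
    have i: "i < n" using ord(2) F(1) by auto
    have ci: "count_list (take m xs) i = c" unfolding eq F(4) using ord(1) F(1) by auto
    have "m < length xs"
    proof (rule ccontr)
      assume "\<not> m < length xs"
      then have "take m xs = xs" by simp
      then show False using ci good_count_ge[OF i] F(3) by simp
    qed
    then have tS: "take (Suc m) xs = take m xs @ [xs ! m]" by (rule take_Suc_conv_app_nth)
    define j where "j = xs ! m"
    have j: "j < n" using \<open>m < length xs\<close> xs nth_mem unfolding j_def by blast
    have "j = i"
    proof (rule ccontr)
      assume ne: "j \<noteq> i"
      have "jt w j (count_list (take m xs) j) \<le> jt w i c"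
        using order[OF j i, of "Suc m"] ne ci unfolding tS j_def[symmetric] by simp
      also have "\<dots> < real (pos i) + 1" by (rule good_forced_time(2)[OF i F(3)])
      finally have lt: "jt w j (count_list (take m xs) j) < real (pos i) + 1" .
      have pn: "real (pos i) + 1 \<le> n" using pos[OF i] by simp
      have late: "real n < jt w j (l j)" using good_later_time(1)[OF j, of 0] by simp
      show False
      proof (cases "j \<in> set pre")
        case True
        then have "count_list (take m xs) j = l j" unfolding eq F(4) by simp
        then show False using lt pn late by simp
      next
        case False
        then have c0: "count_list (take m xs) j = 0" unfolding eq F(4) using ne by simp
        have "j \<in> set post" using j ord(2) F(1) False ne by auto
        then have "pos i < pos j" using pos_ord[OF F(1)] by simp
        then show False using lt pn late good_forced_time(1)[OF j, of 0] unfolding c0 by (cases "l j") auto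
      qed
    qed
    then show ?case using tS eq Suc.prems F(2) unfolding j_def
      by (simp add: take_Suc_conv_app_nth)
  qed simp
  from this[of "length (forced l ord)"] show ?thesis by simp
qed

lemma good_split:
  obtains ys where "xs = forced l ord @ ys"
    "\<And>m i. i < n \<Longrightarrow> count_list (take (length (forced l ord) + m) xs) i = l i + count_list (take m ys) i"
proof (rule that[of "drop (length (forced l ord)) xs"])
  show s: "xs = forced l ord @ drop (length (forced l ord)) xs"
    using append_take_drop_id[of "length (forced l ord)" xs] good_forced_prefix by simp
  fix m i assume "i < n"
  then show "count_list (take (length (forced l ord) + m) xs) i = l i + count_list (take m (drop (length (forced l ord)) xs)) i"
    unfolding take_add good_forced_prefix using count_forced[OF ord(1)] ord(2) by simp
qed

text \<open>If the count of \<open>i\<close> were too large, the order of the jumps would put its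
  unforced jump number \<open>r\<close>, later than n + (1 - \<epsilon>) r, before jump number
  \<open>M\<close> of \<open>j\<close>, earlier than 2 n + 1 + (1 + \<epsilon>) M. This bounds the
  ratio of the counts by about 1 + 2 \<epsilon>; the other half of 4 \<epsilon> absorbs the offset,
  which is small compared with \<epsilon> k0.\<close>

lemma good_synced:
  assumes ys: "\<And>m i. i < n \<Longrightarrow> count_list (take (length (forced l ord) + m) xs) i = l i + count_list (take m ys) i"
    "xs = forced l ord @ ys"
    and k0: "2 * (real n + 2) \<le> \<epsilon> * k0" and e4: "\<epsilon> \<le> 1 / 8"
  shows "synced n k0 (4 * \<epsilon>) ys"
  unfolding synced_def
proof (intro conjI allI impI)
  show "set ys \<subseteq> {..<n}" using xs ys(2) by simp
  fix m i j assume i: "i < n" and j: "j < n"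
  define ci cj where "ci = count_list (take m ys) i" and "cj = count_list (take m ys) j"
  define M where "M = max cj k0"
  show "real ci \<le> (1 + 4 * \<epsilon>) * max (real cj) k0"
  proof (rule ccontr)
    assume "\<not> ?thesis"
    then have big: "(1 + 4 * \<epsilon>) * M < ci" unfolding M_def by (simp add: of_nat_max)
    have M0: "real k0 \<le> M" unfolding M_def by simp
    have "1 * real M \<le> (1 + 4 * \<epsilon>) * M" using eps by (intro mult_right_mono) auto
    then have "M < ci" using big by simp
    then obtain r where r: "ci = Suc r" "M \<le> r" by (cases ci) auto
    have "jt w i (l i + r) \<le> jt w j (l j + cj)"
      using order[OF i j, of "length (forced l ord) + m"] unfolding ys(1)[OF i] ys(1)[OF j] ci_def[symmetric] cj_def[symmetric] r(1)
      by simp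
    moreover have "jt w j (l j + cj) \<le> jt w j (l j + M)"
      using regular_mono[OF good_regular j] by (simp add: strict_mono_less_eq M_def)
    moreover have "jt w j (l j + M) < 2 * real n + 1 + (1 + \<epsilon>) * M"
      using good_later_time(2)[OF j, of M] good_lln(2)[OF j, of M] M0 by simp
    moreover have "real n + (1 - \<epsilon>) * r < jt w i (l i + r)"
      using good_later_time(1)[OF i, of r] good_lln(1)[OF i, of r] M0 r(2) by simp
    ultimately have a: "(1 - \<epsilon>) * r < real n + 1 + (1 + \<epsilon>) * M" by linarith
    have "(1 - \<epsilon>) * ((1 + 4 * \<epsilon>) * M) \<le> (1 - \<epsilon>) * ci" using big eps by (intro mult_left_mono) auto
    also have "\<dots> = (1 - \<epsilon>) * r + (1 - \<epsilon>)" unfolding r(1) by (simp add: algebra_simps)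
    also have "\<dots> < real n + 2 + (1 + \<epsilon>) * M" using a eps by simp
    finally have "2 * \<epsilon> * M - 4 * \<epsilon> * \<epsilon> * M < real n + 2" by (simp add: algebra_simps)
    moreover have "4 * \<epsilon> * (\<epsilon> * M) \<le> 1 / 2 * (\<epsilon> * M)" using e4 eps by (intro mult_right_mono) auto
    ultimately have "3 / 2 * (\<epsilon> * M) < real n + 2" by simp
    moreover have "\<epsilon> * k0 \<le> \<epsilon> * M" using M0 eps by (intro mult_left_mono) auto
    ultimately show False using k0 by simp
  qed
qed

text \<open>With \<epsilon> <= 1/2 the mean of the first r >= k0 unforced waits is at least 1/2, so
  no walk makes more than 2 T + k0 + 1 unforced jumps up to time \<open>T\<close>.\<close>

lemma good_length:
  assumes ys: "\<And>m i. i < n \<Longrightarrow> count_list (take (length (forced l ord) + m) xs) i = l i + count_list (take m ys) i"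
    "xs = forced l ord @ ys" and e4: "\<epsilon> \<le> 1 / 2"
  shows "real (length ys) \<le> n * (2 * T + k0 + 1)"
proof -
  have c: "real (count_list ys i) \<le> 2 * T + k0 + 1" if i: "i < n" for i
  proof (cases "count_list ys i \<le> Suc k0")
    case True
    then show ?thesis using T by linarith
  next
    case False
    then obtain r where r: "count_list ys i = Suc r" "k0 \<le> r" by (cases "count_list ys i") auto
    have "l i + r < jnum w i T"
      using ys(1)[OF i, of "length ys"] final[OF i] r(1) ys(2) by simp
    moreover have "{k. jt w i k \<le> T} = {..<jnum w i T}"
      unfolding jnum_def
    proof (rule down_closed_nat[OF regular_finite[OF good_regular i]])
      fix k k' assume "k \<in> {k. jt w i k \<le> T}" "k' < k"
      then show "k' \<in> {k. jt w i k \<le> T}"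
        using strict_mono_less[OF regular_mono[OF good_regular i], of k' k] by simp
    qed
    ultimately have "jt w i (l i + r) \<le> T" by blast
    then have "(1 - \<epsilon>) * r \<le> T"
      using good_later_time(1)[OF i, of r] good_lln(1)[OF i r(2)] by simp
    moreover have "1 / 2 * r \<le> (1 - \<epsilon>) * r" using e4 by (intro mult_right_mono) auto
    ultimately show ?thesis unfolding r(1) by simp
  qed
  have "set ys \<subseteq> {..<n}" using xs ys(2) by simp
  then have "sum (count_list ys) {..<n} = length ys" by (rule sum_count_set) simp
  then have "real (length ys) = (\<Sum>i<n. real (count_list ys i))" by (simp flip: of_nat_sum)
  also have "\<dots> \<le> (\<Sum>i<n. 2 * T + k0 + 1)" by (intro sum_mono c) simp
  finally show ?thesis by simp
qed

end

end

text \<open>The probability is a product of independent factors: exp (- (n + 1)) for the long wait,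
  exp (- n) for the start of the slot, 1 / (4 M) for every forced jump, and 1/2 for the law of large
  numbers afterwards.\<close>

lemma goodw_measurable: "goodw n l pos \<epsilon> k0 i \<in> sets waitm"
  and measure_goodw:
  "0 < \<epsilon> \<Longrightarrow> \<epsilon> \<le> 1 \<Longrightarrow> 32 / \<epsilon>\<^sup>2 \<le> exp (k0 * \<epsilon>\<^sup>2 / 4) \<Longrightarrow> pos i < n \<Longrightarrow> l i \<le> M \<Longrightarrow> 0 < M \<Longrightarrow>
    exp (- (2 * real n + 1)) / 2 * (1 / (4 * real M)) ^ l i \<le> measure waitm (goodw n l pos \<epsilon> k0 i)"
proof -
  have sh: "(\<lambda>v k. v (Suc (l i) + k)) \<in> waitm \<rightarrow>\<^sub>M waitm"
    unfolding waitm_def by (rule measurable_PiM_single') (auto simp: space_PiM)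
  have wm: "win n l pos i k \<in> sets borel" for k unfolding win_def by auto
  have e: "goodw n l pos \<epsilon> k0 i = {v \<in> space waitm. \<forall>k\<in>{..<Suc (l i)}. v k \<in> win n l pos i k} \<inter>
      ((\<lambda>v k. v (Suc (l i) + k)) -` lln_set \<epsilon> k0 \<inter> space waitm)"
    unfolding goodw_def by auto
  have f: "{v \<in> space waitm. \<forall>k\<in>{..<Suc (l i)}. v k \<in> win n l pos i k} \<in> sets waitm"
  proof (rule sets.sets_Collect_countable_All')
    fix k
    show "{v \<in> space waitm. v k \<in> win n l pos i k} \<in> sets waitm"
      using measurable_sets[of "\<lambda>v. v k" waitm borel "win n l pos i k"] wm[of k] by (simp add: vimage_def)
  qed simp
  show "goodw n l pos \<epsilon> k0 i \<in> sets waitm"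
    unfolding e by (rule sets.Int[OF f measurable_sets[OF sh lln_set_measurable]])
  assume eps: "0 < \<epsilon>" "\<epsilon> \<le> 1" "32 / \<epsilon>\<^sup>2 \<le> exp (k0 * \<epsilon>\<^sup>2 / 4)" and pos: "pos i < n" and M: "l i \<le> M" "0 < M"
  have w1: "exp (- (real n + 1)) \<le> measure expm (win n l pos i (l i))"
    using expm_window[of "real n" "real n + 1"] by (simp add: win_def)
  have w2: "exp (- real n) * (1 / (4 * M)) ^ l i \<le> (\<Prod>k<l i. measure expm (win n l pos i k))"
  proof (cases "l i")
    case (Suc l')
    have "exp (- real n) * (1 / (4 * M)) \<le> measure expm (win n l pos i 0)"
    proof -
      have "exp (- real n) * (1 / (4 * M)) \<le> exp (- (pos i + 1 / 2)) * (1 / 2)"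
        using pos M by (intro mult_mono) (auto simp: field_simps)
      also have "\<dots> \<le> measure expm (win n l pos i 0)"
        using expm_window[of "real (pos i)" "real (pos i) + 1 / 2"] Suc by (simp add: win_def)
      finally show ?thesis .
    qed
    moreover have "(1 / (4 * M)) ^ l' \<le> (\<Prod>k<l'. measure expm (win n l pos i (Suc k)))"
    proof -
      have "(\<Prod>k<l'. 1 / (4 * real M)) \<le> (\<Prod>k<l'. measure expm (win n l pos i (Suc k)))"
      proof (intro prod_mono conjI)
        fix k assume k: "k \<in> {..<l'}"
        have half: "1 / 2 \<le> exp (- (1 / (2 * real (l i))))"
        proof -
          have "1 / 2 \<le> 1 + - (1 / (2 * real (l i)))" using Suc by (simp add: field_simps)
          also have "\<dots> \<le> exp (- (1 / (2 * real (l i))))" by (rule exp_ge_add_one_self)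
          finally show ?thesis .
        qed
        have "1 / (4 * real M) \<le> 1 / (2 * real (l i)) * (1 / 2)" using M Suc by (simp add: field_simps)
        also have "\<dots> \<le> 1 / (2 * real (l i)) * exp (- (1 / (2 * real (l i))))"
          by (rule mult_left_mono[OF half]) simp
        also have "\<dots> \<le> measure expm (win n l pos i (Suc k))"
          using expm_window[of 0 "1 / (2 * real (l i))"] k Suc by (simp add: win_def)
        finally show "1 / (4 * real M) \<le> measure expm (win n l pos i (Suc k))" .
      qed simp
      then show ?thesis by simp
    qed
    ultimately have "(exp (- real n) * (1 / (4 * M))) * (1 / (4 * M)) ^ l' \<le>
        measure expm (win n l pos i 0) * (\<Prod>k<l'. measure expm (win n l pos i (Suc k)))"
      by (rule mult_mono) simp_all
    then show ?thesis unfolding Suc by (simp add: prod.lessThan_Suc_shift mult.assoc del: prod.lessThan_Suc)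
  qed simp
  have "exp (- (2 * real n + 1)) / 2 * (1 / (4 * real M)) ^ l i =
      (exp (- real n) * (1 / (4 * M)) ^ l i) * exp (- (real n + 1)) * (1 / 2)"
    by (simp flip: exp_add)
  also have "\<dots> \<le> (\<Prod>k<l i. measure expm (win n l pos i k)) * measure expm (win n l pos i (l i)) * measure waitm (lln_set \<epsilon> k0)"
    by (intro mult_mono w1 w2 measure_lln_set eps) (auto intro!: mult_nonneg_nonneg prod_nonneg)
  also have "\<dots> = (\<Prod>k<Suc (l i). measure expm (win n l pos i k)) * measure waitm (lln_set \<epsilon> k0)" by simp
  also have "\<dots> = measure waitm (goodw n l pos \<epsilon> k0 i)"
    unfolding goodw_def by (rule waitm_prefix[symmetric]) (use wm in auto)
  finally show "exp (- (2 * real n + 1)) / 2 * (1 / (4 * real M)) ^ l i \<le> measure waitm (goodw n l pos \<epsilon> k0 i)" .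
qed

text \<open>The bound \<open>q\<close> is needed only for lists that consist of the forced prefix
  and a synchronised rest, because the favourable waiting times produce no others.\<close>

lemma walks_lower_bound:
  fixes n k0 M :: nat and T q :: real
  assumes S: "finite S" and G: "\<And>x. G x \<Longrightarrow> \<not> bad n S x"
    and n: "0 < n" and T: "real n \<le> T + 1" "0 \<le> T"
    and ord: "distinct ord" "set ord = {..<n}" and M: "0 < M" "(\<Sum>i<n. l i) \<le> M"
    and k0: "32 * real n * (real n + 2) \<le> k0" "8192 * (real n)\<^sup>2 \<le> exp (k0 / (1024 * (real n)\<^sup>2))"
    and "0 \<le> q" and q: "\<And>ys. synced n k0 (1 / (4 * real n)) ys \<Longrightarrow> real (length ys) \<le> n * (2 * (T + 1) + k0 + 1) \<Longrightarrow>
      q \<le> surv G (\<lambda>_. 1) (forced l ord @ ys) z"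
  shows "q * ((exp (- (2 * real n + 1)) / 2) ^ n * (1 / (4 * real M)) ^ M) \<le>
    measure (walks_noise n) {\<omega> \<in> space (walks_noise n). ereal T < collision_time n S (walks z \<omega>)}"
proof -
  define pos where "pos i = length (takeWhile (\<lambda>j. j \<noteq> i) ord)" for i
  \<comment> \<open>With this value 4 \<epsilon> = 1 / (4 n), the accuracy at which the tubes stay
    ordered. The constants in the hypotheses on \<open>k0\<close> are 8192 n^2 = 32 / \<epsilon>^2
    and 1024 n^2 = 4 / \<epsilon>^2.\<close>
  define \<epsilon> where "\<epsilon> = 1 / (16 * real n)"
  have eps: "0 < \<epsilon>" "\<epsilon> < 1" "\<epsilon> \<le> 1 / 16" unfolding \<epsilon>_def using n by (auto simp: field_simps)
  have posp: "pos i = length pre" if "ord = pre @ i # post" for pre i post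
  proof -
    have "takeWhile (\<lambda>j. j \<noteq> i) ord = pre" unfolding that using ord(1)[unfolded that]
      by (subst takeWhile_append2) auto
    then show ?thesis by (simp add: pos_def)
  qed
  have len: "length ord = n" using ord distinct_card[of ord] by simp
  have posn: "pos i < n" if "i < n" for i
  proof -
    have "i \<in> set ord" using that ord(2) by simp
    then obtain pre post where s: "ord = pre @ i # post" by (meson split_list)
    then show ?thesis using posp[OF s] len by (simp add: s)
  qed
  have pos_ord: "pos i < pos j" if s: "ord = pre @ i # post" and j: "j \<in> set post" for pre i post j
  proof -
    obtain p1 p2 where p: "post = p1 @ j # p2" using j by (meson split_list)
    have "ord = (pre @ i # p1) @ j # p2" using s p by simp
    from posp[OF this] posp[OF s] show ?thesis by simp
  qed
  let ?gw = "goodw n l pos \<epsilon> k0"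
  let ?Gd = "{w \<in> space (allwaits n). \<forall>i\<in>{..<n}. w i \<in> ?gw i}"
  interpret P: product_prob_space "\<lambda>_. waitm" "{..<n}" by unfold_locales
  interpret W: prob_space "allwaits n" by (rule prob_allwaits)
  have Gd: "?Gd \<in> sets (allwaits n)"
  proof (rule sets.sets_Collect_countable_All')
    fix i assume "i \<in> {..<n}"
    then have "(\<lambda>w. w i) \<in> allwaits n \<rightarrow>\<^sub>M waitm" unfolding allwaits_def by (rule measurable_component_singleton)
    from measurable_sets[OF this goodw_measurable[of n l pos \<epsilon> k0 i]]
    show "{w \<in> space (allwaits n). w i \<in> ?gw i} \<in> sets (allwaits n)"
      by (simp add: vimage_def Int_def conj_commute)
  qed simp
  have mGd: "(exp (- (2 * real n + 1)) / 2) ^ n * (1 / (4 * real M)) ^ M \<le> measure (allwaits n) ?Gd"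
  proof -
    have "emeasure (allwaits n) ?Gd = (\<Prod>i\<in>{..<n}. emeasure waitm (?gw i))"
      unfolding allwaits_def by (rule P.emeasure_PiM_Collect) (auto simp: goodw_measurable)
    then have m: "measure (allwaits n) ?Gd = (\<Prod>i<n. measure waitm (?gw i))"
      by (simp add: W.emeasure_eq_measure waitm.emeasure_eq_measure prod_ennreal prod_nonneg)
    have "(1 / (4 * real M)) ^ M \<le> (1 / (4 * real M)) ^ (\<Sum>i<n. l i)"
      using M by (intro power_decreasing) auto
    then have "(exp (- (2 * real n + 1)) / 2) ^ n * (1 / (4 * real M)) ^ M \<le>
        (exp (- (2 * real n + 1)) / 2) ^ n * (1 / (4 * real M)) ^ (\<Sum>i<n. l i)"
      by (intro mult_left_mono) auto
    also have "\<dots> = (\<Prod>i<n. exp (- (2 * real n + 1)) / 2 * (1 / (4 * real M)) ^ l i)"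
      by (simp only: prod.distrib power_sum prod_constant card_lessThan)
    also have "\<dots> \<le> (\<Prod>i<n. measure waitm (?gw i))"
    proof (intro prod_mono conjI measure_goodw)
      fix i assume i: "i \<in> {..<n}"
      show "32 / \<epsilon>\<^sup>2 \<le> exp (real k0 * \<epsilon>\<^sup>2 / 4)"
        using k0(2) n unfolding \<epsilon>_def by (simp add: field_simps power2_eq_square)
      show "pos i < n" using posn i by simp
      have "l i \<le> (\<Sum>i<n. l i)" using i by (intro member_le_sum) auto
      then show "l i \<le> M" using M by simp
    qed (use eps M in auto)
    finally show ?thesis unfolding m .
  qed
  have "q * measure (allwaits n) ?Gd \<le> measure (noise n) {\<omega> \<in> space (noise n). surv_event n S z T \<omega>}"
    unfolding noise_def
  proof (rule noise_lower_bound[OF surv_event_measurable[OF S, unfolded noise_def] Gd \<open>0 \<le> q\<close>])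
    fix w assume w: "w \<in> ?Gd"
    interpret St: prob_space "allsteps n" by (rule prob_allsteps)
    have gd: "w i \<in> ?gw i" if "i < n" for i using w that by auto
    have ctx: "0 < \<epsilon>" "\<epsilon> < 1" "\<forall>i<n. pos i < n" "\<forall>i<n. w i \<in> ?gw i"
      using eps posn gd by auto
    have reg: "regular n w" by (rule good_regular[OF ctx])
    obtain xs where xs: "set xs \<subseteq> {..<n}"
      "\<And>t. t \<le> T + 1 \<Longrightarrow> \<exists>m\<le>length xs. \<forall>i<n. count_list (take m xs) i = jnum w i t"
      "\<And>m i j. i < n \<Longrightarrow> j < n \<Longrightarrow> 0 < count_list (take m xs) i \<Longrightarrow>
        jt w i (count_list (take m xs) i - 1) \<le> jt w j (count_list (take m xs) j)"
      "\<And>i. i < n \<Longrightarrow> count_list xs i = jnum w i (T + 1)"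
      using jump_order[OF reg, of "T + 1"] by metis
    have H: "\<forall>pre i post. ord = pre @ i # post \<longrightarrow> (\<forall>j\<in>set post. pos i < pos j)"
      "\<forall>m. \<forall>i<n. \<forall>j<n. 0 < count_list (take m xs) i \<longrightarrow>
        jt w i (count_list (take m xs) i - 1) \<le> jt w j (count_list (take m xs) j)"
      "\<forall>i<n. count_list xs i = jnum w i (T + 1)"
      using pos_ord xs(3,4) by blast+
    note ctx2 = ctx ord H(1) xs(1) H(2,3) T(1)
    obtain ys where ys: "xs = forced l ord @ ys"
      "\<And>m i. i < n \<Longrightarrow> count_list (take (length (forced l ord) + m) xs) i = l i + count_list (take m ys) i"
      using good_split[OF ctx2] by metis
    have "synced n k0 (4 * \<epsilon>) ys"
      by (rule good_synced[OF ctx2 ys(2,1)]) (use k0(1) n eps(3) in \<open>auto simp: \<epsilon>_def field_simps\<close>)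
    moreover have "real (length ys) \<le> n * (2 * (T + 1) + k0 + 1)"
      by (rule good_length[OF ctx2 ys(2,1)]) (use eps(3) in \<open>assumption | linarith\<close>)+
    ultimately have "q \<le> surv G (\<lambda>_. 1) xs z" using q[of ys] unfolding ys(1)[symmetric] by (simp add: \<epsilon>_def)
    also have "\<dots> = measure (allsteps n) {u \<in> space (allsteps n). avoid G xs (\<lambda>_. 0) z u}"
      by (rule measure_avoid[OF xs(1), symmetric])
    also have "\<dots> \<le> measure (allsteps n) {u \<in> space (allsteps n). surv_event n S z T (zipn n (w, u))}"
    proof (rule St.finite_measure_mono)
      show "{u \<in> space (allsteps n). avoid G xs (\<lambda>_. 0) z u} \<subseteq> {u \<in> space (allsteps n). surv_event n S z T (zipn n (w, u))}"
        using avoid_surv_event[OF G xs(2)] by blast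
      have "(\<lambda>u. zipn n (w, u)) \<in> allsteps n \<rightarrow>\<^sub>M noise n"
        unfolding noise_def by (rule measurable_compose[OF measurable_Pair1' measurable_zipn]) (use w in simp)
      from measurable_sets[OF this surv_event_measurable[OF S, of n z T]]
      show "{u \<in> space (allsteps n). surv_event n S z T (zipn n (w, u))} \<in> sets (allsteps n)"
        using measurable_space[OF \<open>(\<lambda>u. zipn n (w, u)) \<in> allsteps n \<rightarrow>\<^sub>M noise n\<close>]
        by (auto simp: vimage_def Int_def conj_commute elim!: back_subst[of "\<lambda>A. A \<in> sets (allsteps n)"])
    qed
    finally show "q \<le> measure (allsteps n) {u \<in> space (allsteps n). surv_event n S z T (zipn n (w, u))}" .
  qed
  moreover have "q * ((exp (- (2 * real n + 1)) / 2) ^ n * (1 / (4 * real M)) ^ M) \<le> q * measure (allwaits n) ?Gd"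
    by (rule mult_left_mono[OF mGd \<open>0 \<le> q\<close>])
  ultimately show ?thesis using measure_collision_ge[OF S T(2), of n z] by linarith
qed

subsection \<open>Staying in a moving window\<close>

text \<open>The eigenfunction is cut off at the first zeros of the cosine, so that a positive value
  certifies that the walk is inside the window.\<close>

definition wf :: "real \<Rightarrow> real \<Rightarrow> real \<Rightarrow> real" where
  "wf \<theta> l \<eta> = (if \<bar>\<theta> * \<eta>\<bar> < pi / 2 then exp (l * \<eta>) * cos (\<theta> * \<eta>) else 0)"

text \<open>The inverse hyperbolic tangent of tan (\<theta> \<beta>) / tan \<theta>.\<close>

definition lam :: "real \<Rightarrow> real \<Rightarrow> real" where
  "lam \<theta> \<beta> = ln ((1 + tan (\<theta> * \<beta>) / tan \<theta>) / (1 - tan (\<theta> * \<beta>) / tan \<theta>)) / 2"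

lemma wf_nonneg: "0 \<le> wf \<theta> l \<eta>"
  unfolding wf_def by (auto intro!: mult_nonneg_nonneg cos_ge_zero simp: abs_if split: if_splits)

lemma wf_le: "wf \<theta> l \<eta> \<le> exp (\<bar>l\<bar> * \<bar>\<eta>\<bar>)"
proof -
  have "exp (l * \<eta>) * cos (\<theta> * \<eta>) \<le> exp (l * \<eta>) * 1" by (intro mult_left_mono) auto
  also have "\<dots> \<le> exp (\<bar>l\<bar> * \<bar>\<eta>\<bar>)" by (simp flip: abs_mult)
  finally show ?thesis unfolding wf_def by auto
qed

text \<open>Between pi/2 and 3 pi/2 the cosine is not positive, so the cut-off only increases the
  function there; one jump from inside the window cannot pass 3 pi/2.\<close>

lemma wf_ge:
  assumes "\<bar>\<theta> * y\<bar> \<le> 3 * pi / 2"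
  shows "exp (l * y) * cos (\<theta> * y) \<le> wf \<theta> l y"
proof (cases "\<bar>\<theta> * y\<bar> < pi / 2")
  case False
  define a where "a = \<bar>\<theta> * y\<bar> - pi"
  have "cos (\<theta> * y) = cos \<bar>\<theta> * y\<bar>" by simp
  also have "\<dots> = - cos a" unfolding a_def by (simp add: cos_diff)
  also have "\<dots> \<le> 0"
  proof -
    have "0 \<le> cos a" using False assms unfolding a_def by (intro cos_ge_zero) auto
    then show ?thesis by simp
  qed
  finally have "exp (l * y) * cos (\<theta> * y) \<le> 0" by (simp add: mult_le_0_iff)
  then show ?thesis using False by (simp add: wf_def)
qed (simp add: wf_def)

lemma le_tan:
  assumes "0 \<le> x" "x < pi / 2"
  shows "x \<le> tan x"
proof (cases "x = 0")
  case False
  have d: "((\<lambda>y. tan y - y) has_real_derivative (inverse ((cos y)\<^sup>2) - 1)) (at y)" if "0 \<le> y" "y \<le> x" for y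
  proof -
    have "cos y \<noteq> 0" using cos_gt_zero_pi[of y] that assms by simp
    then show ?thesis by (auto intro!: derivative_eq_intros)
  qed
  have "tan 0 - 0 \<le> tan x - x"
  proof (rule DERIV_nonneg_imp_nondecreasing[of 0 x])
    fix y assume y: "0 \<le> y" "y \<le> x"
    have c: "0 < cos y" using cos_gt_zero_pi[of y] y assms by simp
    have "(cos y)\<^sup>2 \<le> 1" by (simp add: abs_square_le_1)
    then have "1 \<le> inverse ((cos y)\<^sup>2)" using c by (simp add: one_le_inverse_iff)
    then show "\<exists>z. ((\<lambda>y. tan y - y) has_real_derivative z) (at y) \<and> 0 \<le> z"
      using d[OF y] by (intro exI[of _ "inverse ((cos y)\<^sup>2) - 1"]) simp
  qed (use assms in simp)
  then show ?thesis by simp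
qed simp

lemma one_minus_le_cos: "1 - x\<^sup>2 / 2 \<le> cos (x :: real)"
proof -
  have "(sin (x / 2))\<^sup>2 \<le> (x / 2)\<^sup>2"
    using abs_sin_x_le_abs_x[of "x / 2"] by (simp only: abs_le_square_iff)
  moreover have "cos x = 1 - 2 * (sin (x / 2))\<^sup>2" using cos_double_sin[of "x / 2"] by simp
  ultimately show ?thesis by (simp add: power_divide)
qed

lemma exp_le_cos:
  assumes "\<bar>x\<bar> \<le> (1::real)"
  shows "exp (- x\<^sup>2) \<le> cos x"
proof -
  define t where "t = x\<^sup>2"
  have t: "0 \<le> t" "t \<le> 1" unfolding t_def using assms by (simp_all add: abs_square_le_1)
  have "1 \<le> (1 - t / 2) * (1 + t)"
  proof -
    have "t * t \<le> 1 * t" using t by (intro mult_right_mono) auto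
    then show ?thesis by (simp add: field_simps)
  qed
  also have "\<dots> \<le> (1 - t / 2) * exp t" using t by (intro mult_left_mono) auto
  finally have "exp (- t) \<le> 1 - t / 2" by (simp add: exp_minus field_simps)
  then show ?thesis using one_minus_le_cos[of x] unfolding t_def by simp
qed

text \<open>The first identity is tanh (lam \<theta> \<beta>) tan \<theta> = tan (\<theta> \<beta>)
  cleared of denominators. For the bound, tan \<theta> >= \<theta> and cos d >= 7/8 give |x| <= 8/7
  |\<beta>|, and the inverse hyperbolic tangent of x is at most 2 |x| in modulus when |x| <=
  4/7.\<close>

lemma lam_props:
  assumes th: "0 < \<theta>" "\<theta> \<le> 1" and be: "\<bar>\<beta>\<bar> \<le> 1 / 2"
  shows "sinh (lam \<theta> \<beta>) * sin \<theta> * cos (\<theta> * \<beta>) = cosh (lam \<theta> \<beta>) * cos \<theta> * sin (\<theta> * \<beta>)"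
    "\<bar>lam \<theta> \<beta>\<bar> \<le> 3 * \<bar>\<beta>\<bar>"
proof -
  define d where "d = \<theta> * \<beta>"
  define x where "x = tan d / tan \<theta>"
  have pi2: "1 < pi / 2" using pi_gt3 by simp
  have ad: "\<bar>d\<bar> \<le> 1 / 2" unfolding d_def abs_mult using th be mult_mono[of \<theta> 1 "\<bar>\<beta>\<bar>" "1/2"] by simp
  have cd: "7 / 8 \<le> cos d"
  proof -
    have "d\<^sup>2 \<le> (1/2)\<^sup>2" using ad by (intro iffD1[OF abs_le_square_iff]) simp
    then show ?thesis using one_minus_le_cos[of d] by (simp add: power_divide)
  qed
  have ct: "0 < cos \<theta>" "0 < sin \<theta>" using th pi2 by (auto intro: cos_gt_zero_pi sin_gt_zero2)
  have tt: "\<theta> \<le> tan \<theta>" using th pi2 by (intro le_tan) auto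
  have "\<bar>tan d\<bar> = \<bar>sin d\<bar> / cos d" using cd by (simp add: tan_def abs_divide)
  also have "\<dots> \<le> \<bar>d\<bar> / (7 / 8)" using cd abs_sin_x_le_abs_x[of d] by (intro frac_le) auto
  finally have td: "\<bar>tan d\<bar> \<le> 8 / 7 * (\<theta> * \<bar>\<beta>\<bar>)" using th unfolding d_def by (simp add: abs_mult)
  have "\<bar>x\<bar> = \<bar>tan d\<bar> / tan \<theta>" unfolding x_def using tt th by (simp add: abs_divide)
  also have "\<dots> \<le> 8 / 7 * (\<theta> * \<bar>\<beta>\<bar>) / \<theta>" using td tt th by (intro frac_le) auto
  finally have ax: "\<bar>x\<bar> \<le> 8 / 7 * \<bar>\<beta>\<bar>" using th by simp
  then have x1: "\<bar>x\<bar> \<le> 4 / 7" using be by simp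
  then have xx: "-1 < x" "x < 1" by auto
  define L where "L = lam \<theta> \<beta>"
  have L: "L = ln ((1 + x) / (1 - x)) / 2" unfolding L_def lam_def x_def d_def ..
  have eL: "exp (2 * L) = (1 + x) / (1 - x)" unfolding L using xx by simp
  have up: "(1 + t) / (1 - t) \<le> exp (4 * t)" if t: "0 \<le> t" "t \<le> 4 / 7" for t :: real
  proof -
    have "t * t \<le> 4 / 7 * t" "t * (t * t) \<le> 4 / 7 * (t * t)" using t by (intro mult_right_mono; simp)+
    moreover have "(1 - t) * (1 + 4 * t + (4 * t)\<^sup>2 / 2) = 1 + 3 * t + 4 * (t * t) - 8 * (t * (t * t))"
      by (simp add: power2_eq_square algebra_simps)
    ultimately have "1 + t \<le> (1 - t) * (1 + 4 * t + (4 * t)\<^sup>2 / 2)" using t by linarith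
    also have "\<dots> \<le> (1 - t) * exp (4 * t)" using t by (intro mult_left_mono exp_lower_Taylor_quadratic) auto
    finally show ?thesis using t by (simp add: field_simps)
  qed
  have "\<bar>L\<bar> \<le> 2 * \<bar>x\<bar>"
  proof (cases "0 \<le> x")
    case True
    have "exp (2 * L) \<le> exp (4 * x)" unfolding eL using True x1 by (intro up) auto
    moreover have "exp 0 \<le> exp (2 * L)" unfolding eL using True xx by simp
    ultimately show ?thesis using True by simp
  next
    case False
    have "exp (- (2 * L)) = (1 + (- x)) / (1 - (- x))" unfolding exp_minus eL using xx by (simp add: field_simps)
    also have "\<dots> \<le> exp (4 * (- x))" using False x1 by (intro up) auto
    finally have "- (2 * L) \<le> 4 * (- x)" by simp
    moreover have "exp (2 * L) \<le> exp 0" unfolding eL using False xx by (simp add: field_simps)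
    ultimately show ?thesis using False by simp
  qed
  then show "\<bar>lam \<theta> \<beta>\<bar> \<le> 3 * \<bar>\<beta>\<bar>" using ax unfolding L_def by linarith
  have "sinh L = x * cosh L"
  proof -
    have "exp L * exp L = (1 + x) / (1 - x)" using eL by (simp flip: exp_add)
    then have "exp L * exp L * (1 - x) = 1 + x" using xx by (simp add: field_simps)
    then have "(exp L - inverse (exp L)) = x * (exp L + inverse (exp L))"
      by (simp add: field_simps)
    then show ?thesis by (simp add: sinh_def cosh_def exp_minus)
  qed
  moreover have "x * sin \<theta> * cos d = cos \<theta> * sin d" unfolding x_def tan_def using ct cd by (simp add: field_simps)
  ultimately show "sinh (lam \<theta> \<beta>) * sin \<theta> * cos (\<theta> * \<beta>) = cosh (lam \<theta> \<beta>) * cos \<theta> * sin (\<theta> * \<beta>)"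
    unfolding L_def[symmetric] d_def[symmetric] by (simp add: mult.assoc mult.left_commute)
qed

text \<open>In the moving frame the function \<open>exp (l \<eta>) cos (\<theta> \<eta>)\<close> is an exact eigenfunction of the
  simple random walk with drift \<open>- \<beta>\<close> as soon as \<open>tanh l * tan \<theta> = tan (\<theta> \<beta>)\<close>.\<close>

lemma wf_step:
  assumes th: "0 < \<theta>" "\<theta> \<le> 1" and be: "\<bar>\<beta>\<bar> \<le> 1 / 2"
  shows "2 * exp (- (3 * \<beta>\<^sup>2 + \<theta>\<^sup>2)) * wf \<theta> (lam \<theta> \<beta>) \<eta> \<le>
    wf \<theta> (lam \<theta> \<beta>) (\<eta> + 1 - \<beta>) + wf \<theta> (lam \<theta> \<beta>) (\<eta> - 1 - \<beta>)"
proof (cases "\<bar>\<theta> * \<eta>\<bar> < pi / 2")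
  case False
  then have "wf \<theta> (lam \<theta> \<beta>) \<eta> = 0" by (simp add: wf_def)
  then show ?thesis by (simp add: wf_nonneg add_nonneg_nonneg)
next
  case True
  define L A d where "L = lam \<theta> \<beta>" and "A = \<theta> * \<eta>" and "d = \<theta> * \<beta>"
  note lp = lam_props[OF th be, folded L_def d_def]
  have pi2: "1 < pi / 2" using pi_gt3 by simp
  have ad: "\<bar>d\<bar> \<le> 1 / 2" unfolding d_def abs_mult using th be mult_mono[of \<theta> 1 "\<bar>\<beta>\<bar>" "1/2"] by simp
  have cd: "0 < cos d" using ad pi2 by (intro cos_gt_zero_pi) auto
  have ct: "0 < cos \<theta>" using th pi2 by (intro cos_gt_zero_pi) auto
  have cA: "0 < cos A" using True unfolding A_def by (intro cos_gt_zero_pi) (auto simp: abs_if split: if_splits)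
  \<comment> \<open>The choice of \<open>lam\<close> makes the vector (cosh L cos \<theta>, sinh L
    sin \<theta>) equal to R (cos d, sin d). The addition theorem then turns the two neighbours back
    into a multiple of cos A, with eigenvalue exp (- L \<beta>) R.\<close>
  define R where "R = cosh L * cos \<theta> / cos d"
  have R1: "R * cos d = cosh L * cos \<theta>" unfolding R_def using cd by simp
  have R2: "R * sin d = sinh L * sin \<theta>" using lp(1) cd unfolding R_def by (simp add: field_simps)
  have near: "\<bar>\<theta> * (\<eta> + 1 - \<beta>)\<bar> \<le> 3 * pi / 2" "\<bar>\<theta> * (\<eta> - 1 - \<beta>)\<bar> \<le> 3 * pi / 2"
    using True ad th pi2 unfolding d_def by (auto simp: algebra_simps abs_if split: if_splits)
  have "exp (L * (\<eta> + 1 - \<beta>)) * cos (\<theta> * (\<eta> + 1 - \<beta>)) + exp (L * (\<eta> - 1 - \<beta>)) * cos (\<theta> * (\<eta> - 1 - \<beta>))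
      = exp (L * \<eta>) * exp (- (L * \<beta>)) * (exp L * cos ((A - d) + \<theta>) + exp (- L) * cos ((A - d) - \<theta>))"
    unfolding A_def d_def by (simp add: algebra_simps exp_add exp_diff exp_minus divide_inverse)
  also have "exp L * cos ((A - d) + \<theta>) + exp (- L) * cos ((A - d) - \<theta>)
      = 2 * (cosh L * cos \<theta>) * cos (A - d) - 2 * (sinh L * sin \<theta>) * sin (A - d)"
  proof -
    have "exp L * cos (y + \<theta>) + exp (- L) * cos (y - \<theta>) =
        2 * (cosh L * cos \<theta>) * cos y - 2 * (sinh L * sin \<theta>) * sin y" for y
      by (simp add: cos_add cos_diff sinh_def cosh_def algebra_simps)
    then show ?thesis .
  qed
  also have "\<dots> = 2 * R * (cos (A - d) * cos d - sin (A - d) * sin d)"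
    unfolding R1[symmetric] R2[symmetric] by (simp add: algebra_simps)
  also have "cos (A - d) * cos d - sin (A - d) * sin d = cos A" using cos_add[of "A - d" d] by simp
  finally have id: "exp (L * (\<eta> + 1 - \<beta>)) * cos (\<theta> * (\<eta> + 1 - \<beta>)) + exp (L * (\<eta> - 1 - \<beta>)) * cos (\<theta> * (\<eta> - 1 - \<beta>))
      = 2 * (exp (- (L * \<beta>)) * R) * (exp (L * \<eta>) * cos A)" by simp
  have "exp (- (3 * \<beta>\<^sup>2 + \<theta>\<^sup>2)) \<le> exp (- (L * \<beta>)) * R"
  proof -
    have "L * \<beta> \<le> \<bar>L\<bar> * \<bar>\<beta>\<bar>" by (simp flip: abs_mult)
    also have "\<dots> \<le> (3 * \<bar>\<beta>\<bar>) * \<bar>\<beta>\<bar>" using lp(2) by (intro mult_right_mono) auto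
    finally have "L * \<beta> \<le> 3 * \<beta>\<^sup>2" by (simp add: power2_eq_square)
    moreover have "exp (- \<theta>\<^sup>2) \<le> R"
    proof -
      have "exp (- \<theta>\<^sup>2) \<le> cos \<theta>" using th by (intro exp_le_cos) auto
      also have "\<dots> = 1 * cos \<theta> / 1" by simp
      also have "\<dots> \<le> R" unfolding R_def using ct cd by (intro frac_le mult_right_mono cosh_real_ge_1) auto
      finally show ?thesis .
    qed
    ultimately have "exp (- (3 * \<beta>\<^sup>2)) * exp (- \<theta>\<^sup>2) \<le> exp (- (L * \<beta>)) * R" by (intro mult_mono) auto
    then show ?thesis by (simp flip: exp_add)
  qed
  then have "2 * exp (- (3 * \<beta>\<^sup>2 + \<theta>\<^sup>2)) * (exp (L * \<eta>) * cos A) \<le> 2 * (exp (- (L * \<beta>)) * R) * (exp (L * \<eta>) * cos A)"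
    using cA by (intro mult_right_mono mult_left_mono) auto
  also have "\<dots> \<le> wf \<theta> L (\<eta> + 1 - \<beta>) + wf \<theta> L (\<eta> - 1 - \<beta>)"
    unfolding id[symmetric] by (intro add_mono wf_ge near)
  finally show ?thesis unfolding L_def[symmetric] using True by (simp add: wf_def A_def)
qed

text \<open>Together with \<open>uu\<close> this rotates the lattice: a planar step changes the two
  coordinates by independent signs, so the planar walk is a pair of independent one-dimensional
  walks.\<close>

definition vv :: "int \<times> int \<Rightarrow> int" where "vv D = fst D - snd D"

text \<open>A walk that has made \<open>m\<close> jumps is kept within distance of order \<open>sc m\<close> of a centre that
  moves linearly with \<open>sc m\<close>. The scale \<open>sc\<close> is constant up to \<open>A 0\<close> jumps and doubles, linearly in the
  number of jumps, between \<open>A j\<close> and \<open>A (Suc j)\<close>.\<close>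

locale sched =
  fixes P s0 :: nat
  assumes P: "1 \<le> P" and s0: "48 \<le> s0"
begin

text \<open>At \<open>A j\<close> jumps the scale is \<open>sj j\<close>, so the number of jumps is
  \<open>P\<close> times the squared scale. The tube axes follow a vector of length of order
  \<open>P\<close>; the factor \<open>P\<close> here keeps their speed per jump of order 1 / sj j,
  at which the drift costs no more than confinement to a window of width of order
  \<open>sj j\<close>.\<close>

definition A :: "nat \<Rightarrow> nat" where "A j = P * s0\<^sup>2 * 4 ^ j"
definition sj :: "nat \<Rightarrow> real" where "sj j = s0 * 2 ^ j"
definition slope :: "nat \<Rightarrow> real" where "slope j = (if j = 0 then 0 else 2 / (3 * P * sj j))"
definition SS :: "nat \<Rightarrow> nat \<Rightarrow> real" where
  "SS j m = (if j = 0 then s0 else sj j / 2 + (m - P * (sj j)\<^sup>2 / 4) * slope j)"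
definition stg :: "nat \<Rightarrow> nat" where "stg m = (LEAST j. m \<le> A j)"
definition sc :: "nat \<Rightarrow> real" where "sc m = SS (stg m) m"

lemma sj_ge: "48 \<le> sj j" and sj_ge_s0: "s0 \<le> sj j" and sj_0: "sj 0 = s0" and sj_Suc: "sj (Suc j) = 2 * sj j"
  and sj_pos: "0 < sj j"
proof -
  have "real s0 * 1 \<le> real s0 * 2 ^ j" by (intro mult_left_mono) auto
  then show "s0 \<le> sj j" unfolding sj_def by simp
  then show "48 \<le> sj j" using s0 by linarith
  then show "0 < sj j" by simp
qed (simp_all add: sj_def)

lemma A_real: "real (A j) = P * (sj j)\<^sup>2"
  unfolding A_def sj_def by (simp add: power_mult_distrib flip: power_mult) (simp add: power_mult mult.commute[of j 2])

lemma A_Suc: "A (Suc j) = 4 * A j" and A_pos: "0 < A j"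
  using P s0 unfolding A_def by auto

lemma A_mono: "i \<le> j \<Longrightarrow> A i \<le> A j"
  unfolding A_def by (intro mult_left_mono power_increasing) auto

lemma stg_le: "m \<le> A (stg m)"
  unfolding stg_def
proof (rule LeastI_ex)
  have "A j \<ge> j" for j
  proof (induction j)
    case (Suc j)
    then show ?case using A_pos[of j] A_Suc[of j] by simp
  qed simp
  then show "\<exists>j. m \<le> A j" by blast
qed

lemma stg_least: "m \<le> A j \<Longrightarrow> stg m \<le> j"
  unfolding stg_def by (rule Least_le)

lemma stg_gt: "0 < stg m \<Longrightarrow> A (stg m) < 4 * m"
proof -
  assume "0 < stg m"
  then obtain j where j: "stg m = Suc j" by (cases "stg m") auto
  have "\<not> m \<le> A j" using stg_least[of m j] j by auto
  then show ?thesis unfolding j A_Suc by simp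
qed

lemma stg_Suc: "stg (Suc m) = stg m \<or> m = A (stg m) \<and> stg (Suc m) = Suc (stg m)"
proof (cases "Suc m \<le> A (stg m)")
  case True
  then have "stg (Suc m) \<le> stg m" by (rule stg_least)
  moreover have "stg m \<le> stg (Suc m)" using stg_le[of "Suc m"] by (intro stg_least) simp
  ultimately show ?thesis by simp
next
  case False
  then have m: "m = A (stg m)" using stg_le[of m] by simp
  have "Suc m \<le> A (Suc (stg m))" unfolding A_Suc using m A_pos[of "stg m"] by simp
  then have "stg (Suc m) \<le> Suc (stg m)" by (rule stg_least)
  moreover have "\<not> stg (Suc m) \<le> stg m" using A_mono[of "stg (Suc m)" "stg m"] stg_le[of "Suc m"] m by auto
  ultimately show ?thesis using m by simp
qed

lemma stg_0: "stg 0 = 0"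
  using stg_least[of 0 0] by simp

lemma SS_Suc: "SS j (Suc m) = SS j m + slope j"
  unfolding SS_def slope_def by (simp add: algebra_simps add_divide_distrib)

lemma SS_end: "SS j (A j) = sj j"
proof (cases "j = 0")
  case False
  have "3 / 4 * (P * (sj j)\<^sup>2) * (2 / (3 * P * sj j)) = sj j / 2"
    using P sj_pos[of j] by (simp add: power2_eq_square field_simps)
  moreover have "real (A j) - P * (sj j)\<^sup>2 / 4 = 3 / 4 * (P * (sj j)\<^sup>2)" unfolding A_real by simp
  ultimately show ?thesis using False unfolding SS_def slope_def by simp
qed (simp add: SS_def sj_0)

lemma SS_start: "SS (Suc j) (A j) = sj j"
  unfolding SS_def A_real sj_Suc by (simp add: power2_eq_square)

lemma SS_glue: "SS (stg (Suc m)) m = sc m"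
  using stg_Suc[of m] SS_end[of "stg m"] SS_start[of "stg m"] unfolding sc_def by auto

lemma sc_Suc: "sc (Suc m) = sc m + slope (stg (Suc m))"
proof -
  have "sc (Suc m) = SS (stg (Suc m)) m + slope (stg (Suc m))" by (simp add: sc_def SS_Suc)
  then show ?thesis unfolding SS_glue .
qed

lemma slope_nonneg: "0 \<le> slope j"
  unfolding slope_def using less_imp_le[OF sj_pos] by simp

lemma sc_mono: "m \<le> m' \<Longrightarrow> sc m \<le> sc m'"
  by (rule lift_Suc_mono_le[of sc]) (use sc_Suc slope_nonneg in \<open>simp_all add: add_increasing2\<close>)

lemma sc_0: "sc 0 = s0"
  unfolding sc_def stg_0 SS_def by simp

lemma sc_ge_s0: "s0 \<le> sc m"
  using sc_mono[of 0 m] sc_0 by simp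

lemma sc_bounds: "sj (stg m) / 2 \<le> sc m" "sc m \<le> sj (stg m)"
proof -
  show "sj (stg m) / 2 \<le> sc m"
  proof (cases "stg m = 0")
    case False
    have "real (A (stg m)) < 4 * m" using stg_gt[of m] False by linarith
    then have "0 \<le> (m - P * (sj (stg m))\<^sup>2 / 4) * slope (stg m)"
      unfolding A_real by (intro mult_nonneg_nonneg slope_nonneg) simp
    then show ?thesis unfolding sc_def SS_def using False by simp
  qed (use sj_0 s0 in \<open>simp add: sc_def SS_def\<close>)
  have "sc m \<le> SS (stg m) (A (stg m))"
    unfolding sc_def SS_def using stg_le[of m] slope_nonneg by (auto intro!: mult_right_mono)
  then show "sc m \<le> sj (stg m)" unfolding SS_end .
qed

lemma sc_const: "m \<le> A 0 \<Longrightarrow> sc m = s0"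
  using stg_least[of m 0] unfolding sc_def SS_def by simp

lemma slope_le: "slope (stg (Suc m)) * m \<le> sc m"
proof (cases "stg (Suc m) = 0")
  case False
  define j where "j = stg (Suc m)"
  have "P * (sj j)\<^sup>2 / 4 * slope j = sj j / 6"
    using False P sj_pos[of j] unfolding slope_def j_def by (simp add: power2_eq_square field_simps)
  then have "sc m = sj j / 3 + m * slope j"
    unfolding SS_glue[symmetric] SS_def j_def[symmetric] using False unfolding j_def[symmetric] by (simp add: algebra_simps)
  then show ?thesis using sj_pos[of j] unfolding j_def by (simp add: mult.commute)
qed (use sc_ge_s0[of m] in \<open>simp add: slope_def\<close>)

text \<open>By \<open>slope_le\<close> each increment of \<open>sc\<close> is at most sc m / m, so
  this quotient decreases; the product form avoids dividing by 0.\<close>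

lemma sc_ratio: "m \<le> m' \<Longrightarrow> sc m' * m \<le> sc m * m'"
proof (induction m' rule: dec_induct)
  case (step m')
  show ?case
  proof (cases "m' = 0")
    case True
    then show ?thesis using step sc_ge_s0[of m] by simp
  next
    case False
    have "(sc (Suc m') * m) * m' = (sc m' * m) * m' + (slope (stg (Suc m')) * m') * m"
      by (simp add: sc_Suc algebra_simps)
    also have "\<dots> \<le> (sc m' * m) * m' + sc m' * m" using slope_le[of m'] by (intro add_left_mono mult_right_mono) auto
    also have "\<dots> = (sc m' * m) * Suc m'" by (simp add: algebra_simps)
    also have "\<dots> \<le> (sc m * m') * Suc m'" using step by (intro mult_right_mono) auto
    finally have "(sc (Suc m') * m) * m' \<le> (sc m * Suc m') * m'" by (simp add: algebra_simps)
    then show ?thesis using False by (simp add: mult_le_cancel_right)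
  qed
qed simp

text \<open>Since sc m / m decreases, a bound on the ratio of the counts also bounds the ratio of
  the scales. The scale is constant up to \<open>A 0\<close>, so taking the maximum with
  \<open>A 0\<close> does not change it.\<close>

lemma sc_sync:
  assumes c: "real c \<le> (1 + \<epsilon>) * max (real c') (A 0)" and "0 \<le> \<epsilon>"
  shows "sc c \<le> (1 + \<epsilon>) * sc c'"
proof -
  define M where "M = max c' (A 0)"
  have M0: "0 < M" unfolding M_def using A_pos[of 0] by simp
  have eq: "sc M = sc c'" unfolding M_def using sc_const[of "c'"] sc_const[of "A 0"] by (auto simp: max_def)
  have cM: "real c \<le> (1 + \<epsilon>) * M" using c unfolding M_def by (simp add: of_nat_max)
  have s: "0 \<le> sc M" using sc_ge_s0[of M] by simp
  show ?thesis
  proof (cases "c \<le> M")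
    case True
    have "sc c \<le> 1 * sc M" using sc_mono[OF True] by simp
    also have "\<dots> \<le> (1 + \<epsilon>) * sc M" using s assms(2) by (intro mult_right_mono) auto
    finally show ?thesis unfolding eq .
  next
    case False
    then have "sc c * M \<le> sc M * c" by (intro sc_ratio) simp
    also have "\<dots> \<le> sc M * ((1 + \<epsilon>) * M)" using cM s by (intro mult_left_mono)
    finally have "sc c * M \<le> ((1 + \<epsilon>) * sc M) * M" by (simp add: algebra_simps)
    then show ?thesis unfolding eq using M0 by (simp add: mult_le_cancel_right)
  qed
qed

text \<open>Chosen so that the first zeros of the cosine lie at distance sj j / 24 from the
  centre.\<close>

definition th :: "nat \<Rightarrow> real" where "th j = 12 * pi / sj j"

lemma th_props: "0 < th j" "th j \<le> 1" "(th j)\<^sup>2 \<le> 2304 / (sj j)\<^sup>2" "th (Suc j) = th j / 2" "th j * (sj j / 24) = pi / 2"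
proof -
  have "12 * pi \<le> 48" using pi_less_4 by simp
  then show "0 < th j" "th j \<le> 1" unfolding th_def using sj_pos[of j] sj_ge[of j] by (auto simp: field_simps)
  have "(12 * pi)\<^sup>2 \<le> 48\<^sup>2" using pi_less_4 by (intro power_mono) auto
  then show "(th j)\<^sup>2 \<le> 2304 / (sj j)\<^sup>2" unfolding th_def power_divide by (intro divide_right_mono) auto
  show "th (Suc j) = th j / 2" unfolding th_def sj_Suc by simp
  show "th j * (sj j / 24) = pi / 2" unfolding th_def using sj_pos[of j] by simp
qed

lemma drift_le:
  fixes a :: real
  assumes "\<bar>a\<bar> \<le> 4 * P"
  shows "\<bar>slope j * a\<bar> \<le> 8 / (3 * sj j)" "\<bar>slope j * a\<bar> \<le> 1 / 2"
proof -
  show *: "\<bar>slope j * a\<bar> \<le> 8 / (3 * sj j)"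
  proof (cases "j = 0")
    case False
    have "\<bar>slope j * a\<bar> = 2 / (3 * P * sj j) * \<bar>a\<bar>"
      using False sj_pos[of j] unfolding slope_def by (simp add: abs_mult)
    also have "\<dots> \<le> 2 / (3 * P * sj j) * (4 * P)" using assms sj_pos[of j] by (intro mult_left_mono) auto
    also have "\<dots> = 8 / (3 * sj j)" using P by simp
    finally show ?thesis .
  qed (use sj_pos[of j] in \<open>simp add: slope_def\<close>)
  also have "8 / (3 * sj j) \<le> 8 / (3 * 48)" using sj_ge[of j] by (intro divide_left_mono mult_left_mono) auto
  finally show "\<bar>slope j * a\<bar> \<le> 1 / 2" by simp
qed

definition fw :: "nat \<Rightarrow> nat \<Rightarrow> real \<Rightarrow> int \<Rightarrow> int \<Rightarrow> real" where
  "fw j m a x0 y = wf (th j) (lam (th j) (slope j * a)) (y - (x0 + (SS j m - s0) * a))"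

lemma fw_nonneg: "0 \<le> fw j m a x0 y"
  unfolding fw_def by (rule wf_nonneg)

lemma fw_support:
  assumes "0 < fw j m a x0 y"
  shows "\<bar>y - (x0 + (SS j m - s0) * a)\<bar> < sj j / 24"
proof -
  define \<eta> where "\<eta> = y - (x0 + (SS j m - s0) * a)"
  have "\<bar>th j * \<eta>\<bar> < pi / 2" using assms unfolding fw_def wf_def \<eta>_def by (auto split: if_splits)
  then have "th j * \<bar>\<eta>\<bar> < pi / 2" using th_props(1)[of j] by (simp add: abs_mult)
  then have "th j * \<bar>\<eta>\<bar> < th j * (sj j / 24)" by (simp only: th_props(5))
  then show ?thesis using th_props(1)[of j] unfolding \<eta>_def by simp
qed

lemma lam_le: "\<bar>a :: real\<bar> \<le> 4 * P \<Longrightarrow> \<bar>lam (th j) (slope j * a)\<bar> \<le> 8 / sj j"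
  using lam_props(2)[OF th_props(1,2) drift_le(2), of a j j] drift_le(1)[of a j] by simp

lemma fw_le:
  fixes a :: real
  assumes "\<bar>a\<bar> \<le> 4 * P"
  shows "fw j m a x0 y \<le> exp (1 / 3)"
proof (cases "0 < fw j m a x0 y")
  case True
  define \<eta> where "\<eta> = y - (x0 + (SS j m - s0) * a)"
  have "\<bar>lam (th j) (slope j * a)\<bar> * \<bar>\<eta>\<bar> \<le> 8 / sj j * (sj j / 24)"
    using lam_le[OF assms] fw_support[OF True] sj_pos[of j] unfolding \<eta>_def by (intro mult_mono) auto
  also have "\<dots> = 1 / 3" using sj_pos[of j] by simp
  finally have "exp (\<bar>lam (th j) (slope j * a)\<bar> * \<bar>\<eta>\<bar>) \<le> exp (1 / 3)" by simp
  then show ?thesis using wf_le[of "th j" "lam (th j) (slope j * a)" \<eta>] unfolding fw_def \<eta>_def by linarith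
next
  case False
  then show ?thesis using exp_ge_zero[of "1 / 3 :: real"] by linarith
qed

text \<open>When the stage changes, the window doubles. On the old window the new angle is below
  pi/4, so the new function is at least 7/10 exp (-1/6) there, while the old one is at most exp
  (1/3); the ratio is below e.\<close>

lemma fw_glue:
  fixes a :: real
  assumes a: "\<bar>a\<bar> \<le> 4 * P"
  shows "fw j (A j) a x0 y \<le> exp 1 * fw (Suc j) (A j) a x0 y"
proof (cases "0 < fw j (A j) a x0 y")
  case True
  define \<eta> where "\<eta> = y - (x0 + (sj j - s0) * a)"
  have eta: "\<bar>\<eta>\<bar> < sj j / 24" using fw_support[OF True] unfolding \<eta>_def SS_end .
  define l where "l = lam (th (Suc j)) (slope (Suc j) * a)"
  have "th j * \<bar>\<eta>\<bar> < th j * (sj j / 24)" using eta th_props(1)[of j] by simp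
  then have "th j * \<bar>\<eta>\<bar> < pi / 2" by (simp only: th_props(5))
  moreover have "\<bar>th (Suc j) * \<eta>\<bar> = th j * \<bar>\<eta>\<bar> / 2"
    using th_props(1)[of j] by (simp add: th_props(4) abs_mult)
  ultimately have t4: "\<bar>th (Suc j) * \<eta>\<bar> < pi / 4" by simp
  have "\<bar>l\<bar> * \<bar>\<eta>\<bar> \<le> 8 / sj (Suc j) * (sj j / 24)"
    using lam_le[OF a, of "Suc j"] eta sj_pos[of "Suc j"] unfolding l_def by (intro mult_mono) auto
  also have "\<dots> = 1 / 6" using sj_pos[of j] unfolding sj_Suc by simp
  finally have "- (1 / 6) \<le> l * \<eta>" by (simp add: abs_le_iff flip: abs_mult)
  then have e: "exp (- (1 / 6)) \<le> exp (l * \<eta>)" by simp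
  have "cos (pi / 4) \<le> cos \<bar>th (Suc j) * \<eta>\<bar>" using t4 by (subst cos_mono_le_eq) auto
  moreover have "7 / 10 \<le> cos (pi / 4)"
  proof -
    have "7 / 5 \<le> sqrt 2" by (rule real_le_rsqrt) (simp add: power_divide)
    then show ?thesis unfolding cos_45 by simp
  qed
  ultimately have c: "7 / 10 \<le> cos (th (Suc j) * \<eta>)" by simp
  have fS: "fw (Suc j) (A j) a x0 y = exp (l * \<eta>) * cos (th (Suc j) * \<eta>)"
    using t4 unfolding fw_def wf_def SS_start l_def \<eta>_def by auto
  have "1 + 1 / 2 \<le> exp (1 / 2 :: real)" by (rule exp_ge_add_one_self)
  then have "1 * exp (1 / 3) \<le> (exp (1 / 2) * (7 / 10)) * exp (1 / 3 :: real)" by (intro mult_right_mono) auto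
  also have "\<dots> = exp 1 * (exp (- (1 / 6)) * (7 / 10))"
    by (simp add: exp_add[symmetric] mult.assoc[symmetric])
  also have "\<dots> \<le> exp 1 * (exp (l * \<eta>) * cos (th (Suc j) * \<eta>))"
    using e c by (intro mult_left_mono mult_mono) auto
  finally show ?thesis using fw_le[OF a, of j "A j" x0 y] unfolding fS by simp
next
  case False
  then have "fw j (A j) a x0 y = 0" using fw_nonneg[of j "A j" a x0 y] by linarith
  then show ?thesis using fw_nonneg[of "Suc j" "A j" a x0 y] by simp
qed

text \<open>The drift contributes 3 \<beta>^2 <= 64/3 / (sj j)^2 to the exponent of
  \<open>wf_step\<close>, and the confinement contributes (th j)^2 <= 2304 / (sj j)^2; together they
  stay below 2400 / (sj j)^2.\<close>

lemma fw_step: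
  fixes a :: real
  assumes a: "\<bar>a\<bar> \<le> 4 * P"
  shows "2 * exp (- (2400 / (sj j)\<^sup>2)) * fw j m a x0 y \<le> fw j (Suc m) a x0 (y + 1) + fw j (Suc m) a x0 (y - 1)"
proof -
  define \<beta> where "\<beta> = slope j * a"
  define \<eta> where "\<eta> = y - (x0 + (SS j m - s0) * a)"
  have "3 * \<beta>\<^sup>2 + (th j)\<^sup>2 \<le> 2400 / (sj j)\<^sup>2"
  proof -
    have "\<bar>\<beta>\<bar>\<^sup>2 \<le> (8 / (3 * sj j))\<^sup>2" using drift_le(1)[OF a] unfolding \<beta>_def by (intro power_mono) auto
    then have "3 * \<beta>\<^sup>2 \<le> 64 / 3 / (sj j)\<^sup>2" by (simp add: power_divide power_mult_distrib)
    moreover have "2304 / (sj j)\<^sup>2 + 64 / 3 / (sj j)\<^sup>2 \<le> 2400 / (sj j)\<^sup>2"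
      unfolding add_divide_distrib[symmetric] by (intro divide_right_mono) auto
    ultimately show ?thesis using th_props(3)[of j] by linarith
  qed
  then have "2 * exp (- (2400 / (sj j)\<^sup>2)) * fw j m a x0 y \<le> 2 * exp (- (3 * \<beta>\<^sup>2 + (th j)\<^sup>2)) * fw j m a x0 y"
    using fw_nonneg by (intro mult_right_mono mult_left_mono) auto
  also have "\<dots> \<le> wf (th j) (lam (th j) \<beta>) (\<eta> + 1 - \<beta>) + wf (th j) (lam (th j) \<beta>) (\<eta> - 1 - \<beta>)"
    unfolding fw_def \<beta>_def[symmetric] \<eta>_def[symmetric]
    by (rule wf_step) (use th_props(1,2)[of j] drift_le(2)[OF a] in \<open>auto simp: \<beta>_def\<close>)
  also have "\<eta> + 1 - \<beta> = real_of_int (y + 1) - (x0 + (SS j (Suc m) - s0) * a)"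
    unfolding \<eta>_def \<beta>_def SS_Suc by (simp add: algebra_simps)
  also have "\<eta> - 1 - \<beta> = real_of_int (y - 1) - (x0 + (SS j (Suc m) - s0) * a)"
    unfolding \<eta>_def \<beta>_def SS_Suc by (simp add: algebra_simps)
  finally show ?thesis unfolding fw_def \<beta>_def .
qed

text \<open>The prefactor turns the decaying product of two eigenfunctions into a submartingale.
  Each coordinate loses at most a factor exp (-2400 / (sj j)^2) per jump, whence 4800; this adds up
  to 4800 P by the end of a stage, and the extra 2 per stage pays for gluing both
  coordinates.\<close>

definition psi :: "int \<times> int \<Rightarrow> real \<Rightarrow> real \<Rightarrow> nat \<Rightarrow> int \<times> int \<Rightarrow> real" where
  "psi X a b m y = exp ((4800 * P + 2) * stg m + 4800 * m / (sj (stg m))\<^sup>2) *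
     (fw (stg m) m a (uu X) (uu y) * fw (stg m) m b (vv X) (vv y))"

lemma psi_nonneg: "0 \<le> psi X a b m y"
  unfolding psi_def by (intro mult_nonneg_nonneg fw_nonneg) auto

lemma psi_0: "psi X a b 0 X = 1"
  unfolding psi_def stg_0 fw_def SS_def wf_def by simp

lemma psi_le:
  fixes a b :: real
  assumes "\<bar>a\<bar> \<le> 4 * P" "\<bar>b\<bar> \<le> 4 * P"
  shows "psi X a b m y \<le> exp ((4800 * P + 3) * (stg m + 1))"
proof -
  have "4800 * m / (sj (stg m))\<^sup>2 \<le> 4800 * A (stg m) / (sj (stg m))\<^sup>2"
    using stg_le[of m] by (intro divide_right_mono mult_left_mono) auto
  also have "\<dots> = 4800 * P" using sj_pos[of "stg m"] by (simp add: A_real)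
  finally have e: "4800 * m / (sj (stg m))\<^sup>2 \<le> 4800 * P" .
  have "psi X a b m y \<le> exp ((4800 * P + 2) * stg m + 4800 * P) * (exp (1 / 3) * exp (1 / 3))"
    unfolding psi_def using e by (intro mult_mono fw_le assms fw_nonneg) (auto intro!: mult_nonneg_nonneg fw_nonneg)
  also have "\<dots> = exp ((4800 * P + 2) * stg m + 4800 * P + 2 / 3)" by (simp flip: exp_add)
  also have "\<dots> \<le> exp ((4800 * P + 3) * (stg m + 1))" by (simp add: algebra_simps)
  finally show ?thesis .
qed

lemma psi_support:
  assumes "0 < psi X a b m y"
  shows "\<bar>uu y - (uu X + (sc m - s0) * a)\<bar> < sc m / 12" "\<bar>vv y - (vv X + (sc m - s0) * b)\<bar> < sc m / 12"
proof -
  have "0 < fw (stg m) m a (uu X) (uu y) \<and> 0 < fw (stg m) m b (vv X) (vv y)"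
    using assms fw_nonneg[of "stg m" m a "uu X" "uu y"] fw_nonneg[of "stg m" m b "vv X" "vv y"]
    unfolding psi_def by (auto simp: zero_less_mult_iff)
  then show "\<bar>uu y - (uu X + (sc m - s0) * a)\<bar> < sc m / 12" "\<bar>vv y - (vv X + (sc m - s0) * b)\<bar> < sc m / 12"
    using fw_support[of "stg m" m a "uu X" "uu y"] fw_support[of "stg m" m b "vv X" "vv y"] sc_bounds(1)[of m]
    unfolding sc_def[symmetric] by linarith+
qed

text \<open>If the stage changes with this jump, \<open>fw_glue\<close> first replaces the old
  factors by those of the new stage, at a loss of e^2 that the prefactor covers. Then each
  coordinate makes one \<open>fw_step\<close>.\<close>

lemma psi_step:
  fixes a b :: real
  assumes a: "\<bar>a\<bar> \<le> 4 * P" and b: "\<bar>b\<bar> \<le> 4 * P"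
  shows "4 * psi X a b m y \<le> (\<Sum>e\<in>steps. psi X a b (Suc m) (y + e))"
proof -
  define J where "J = stg (Suc m)"
  define E where "E = (4800 * P + 2) * J + 4800 * m / (sj J)\<^sup>2"
  let ?u = "\<lambda>m y. fw J m a (uu X) y" and ?v = "\<lambda>m y. fw J m b (vv X) y"
  define g where "g = 2400 / (sj J)\<^sup>2"
  have le: "psi X a b m y \<le> exp E * (?u m (uu y) * ?v m (vv y))"
  proof (cases "stg (Suc m) = stg m")
    case True
    then show ?thesis unfolding psi_def E_def J_def by simp
  next
    case False
    then have m: "m = A (stg m)" and J: "J = Suc (stg m)" using stg_Suc[of m] unfolding J_def by auto
    have "4800 * real m / (sj (stg m))\<^sup>2 = 4800 * P"
      by (subst m, unfold A_real) (use sj_pos[of "stg m"] in simp)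
    then have "(4800 * P + 2) * stg m + 4800 * m / (sj (stg m))\<^sup>2 + 2 \<le> E"
      unfolding E_def J by (simp add: algebra_simps)
    then have ee: "exp ((4800 * P + 2) * stg m + 4800 * m / (sj (stg m))\<^sup>2) * (exp 1 * exp 1) \<le> exp E"
      by (simp flip: exp_add)
    have g1: "fw (stg m) m a (uu X) (uu y) \<le> exp 1 * ?u m (uu y)" "fw (stg m) m b (vv X) (vv y) \<le> exp 1 * ?v m (vv y)"
      unfolding J using fw_glue[OF a, of "stg m"] fw_glue[OF b, of "stg m"] m by metis+
    have "psi X a b m y \<le> exp ((4800 * P + 2) * stg m + 4800 * m / (sj (stg m))\<^sup>2) *
        ((exp 1 * ?u m (uu y)) * (exp 1 * ?v m (vv y)))"
      unfolding psi_def by (intro mult_left_mono mult_mono g1) (auto intro!: mult_nonneg_nonneg fw_nonneg)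
    also have "\<dots> = (exp ((4800 * P + 2) * stg m + 4800 * m / (sj (stg m))\<^sup>2) * (exp 1 * exp 1)) * (?u m (uu y) * ?v m (vv y))"
      by simp
    also have "\<dots> \<le> exp E * (?u m (uu y) * ?v m (vv y))"
      by (rule mult_right_mono[OF ee]) (intro mult_nonneg_nonneg fw_nonneg)
    finally show ?thesis .
  qed
  have E': "real ((4800 * P + 2) * J) + 4800 * real (Suc m) / (sj J)\<^sup>2 = E + 2 * g"
    unfolding E_def g_def by (simp add: add_divide_distrib algebra_simps)
  have "4 * psi X a b m y \<le> 4 * (exp E * (?u m (uu y) * ?v m (vv y)))" using le by simp
  also have "\<dots> = exp (E + 2 * g) * ((2 * exp (- g) * ?u m (uu y)) * (2 * exp (- g) * ?v m (vv y)))"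
  proof -
    have x: "exp (E + 2 * g) = exp E * (exp g * exp g)" by (simp flip: exp_add)
    show ?thesis unfolding x by (simp add: exp_minus field_simps)
  qed
  also have "\<dots> \<le> exp (E + 2 * g) * ((?u (Suc m) (uu y + 1) + ?u (Suc m) (uu y - 1)) * (?v (Suc m) (vv y + 1) + ?v (Suc m) (vv y - 1)))"
    unfolding g_def by (intro mult_left_mono mult_mono fw_step a b) (auto intro!: mult_nonneg_nonneg add_nonneg_nonneg fw_nonneg)
  \<comment> \<open>The four steps realise all four sign pairs in the coordinates \<open>uu\<close>
    and \<open>vv\<close>, so the product of the two sums is the sum over the steps.\<close>
  also have "\<dots> = (\<Sum>e\<in>steps. exp (E + 2 * g) * (?u (Suc m) (uu (y + e)) * ?v (Suc m) (vv (y + e))))"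
    unfolding sum_steps by (simp add: uu_def vv_def algebra_simps)
  also have "\<dots> = (\<Sum>e\<in>steps. psi X a b (Suc m) (y + e))"
    unfolding psi_def J_def[symmetric] E' ..
  finally show ?thesis .
qed

end

text \<open>Optional stopping for a submartingale in which every jump advances one factor. While all
  factors are positive, \<open>G\<close> holds; once a factor vanishes, the product is 0 and nothing
  is left to prove. So the product at the start is at most the killed expectation of any final
  function that dominates it.\<close>

lemma surv_product:
  fixes \<psi> :: "nat \<Rightarrow> nat \<Rightarrow> int \<times> int \<Rightarrow> real"
  assumes nn: "\<And>i c y. i < n \<Longrightarrow> 0 \<le> \<psi> i c y"
    and step: "\<And>i c y. i < n \<Longrightarrow> 4 * \<psi> i c y \<le> (\<Sum>e\<in>steps. \<psi> i (Suc c) (y + e))"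
    and ys: "set ys \<subseteq> {..<n}"
    and G: "\<And>m x. m \<le> length ys \<Longrightarrow> (\<And>i. i < n \<Longrightarrow> 0 < \<psi> i (c i + count_list (take m ys) i) (x i)) \<Longrightarrow> G x"
    and g: "\<And>x. 0 \<le> g x" "\<And>x. (\<And>i. i < n \<Longrightarrow> 0 < \<psi> i (c i + count_list ys i) (x i)) \<Longrightarrow>
      (\<Prod>i<n. \<psi> i (c i + count_list ys i) (x i)) \<le> g x"
  shows "(\<Prod>i<n. \<psi> i (c i) (x i)) \<le> surv G g ys x"
  using ys G g(2)
proof (induction ys arbitrary: c x)
  case Nil
  show ?case
  proof (cases "\<forall>i<n. 0 < \<psi> i (c i) (x i)")
    case True
    then show ?thesis using Nil(2)[of 0 x] Nil(3)[of x] by simp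
  next
    case False
    then obtain i where "i < n" "\<psi> i (c i) (x i) = 0" using nn by (metis order_le_less)
    then have "(\<Prod>i<n. \<psi> i (c i) (x i)) = 0" by (intro prod_zero) auto
    moreover have "0 \<le> surv G g [] x" by (rule surv_nonneg) (rule g(1))
    ultimately show ?thesis by linarith
  qed
next
  case (Cons l ys)
  have l: "l < n" using Cons.prems by simp
  show ?case
  proof (cases "\<forall>i<n. 0 < \<psi> i (c i) (x i)")
    case True
    then have Gx: "G x" using Cons.prems(2)[of 0 x] by simp
    let ?c = "c(l := Suc (c l))"
    have cc: "?c i + count_list zs i = c i + count_list (l # zs) i" for i zs by simp
    have IH: "(\<Prod>i<n. \<psi> i (?c i) (y i)) \<le> surv G g ys y" for y
    proof (rule Cons.IH)
      show "G x" if "m \<le> length ys" "\<And>i. i < n \<Longrightarrow> 0 < \<psi> i (?c i + count_list (take m ys) i) (x i)" for m x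
        using Cons.prems(2)[of "Suc m" x] that unfolding cc by simp
      show "(\<Prod>i<n. \<psi> i (?c i + count_list ys i) (x i)) \<le> g x"
        if "\<And>i. i < n \<Longrightarrow> 0 < \<psi> i (?c i + count_list ys i) (x i)" for x
        using Cons.prems(3)[of x] that unfolding cc by simp
    qed (use Cons.prems in auto)
    have split: "(\<Prod>i<n. \<psi> i (c' i) (y i)) = \<psi> l (c' l) (y l) * (\<Prod>i\<in>{..<n} - {l}. \<psi> i (c' i) (y i))" for c' y
      using l by (intro prod.remove) auto
    let ?R = "\<Prod>i\<in>{..<n} - {l}. \<psi> i (c i) (x i)"
    have e: "(\<Prod>i<n. \<psi> i (?c i) ((x(l := x l + e)) i)) = \<psi> l (Suc (c l)) (x l + e) * ?R" for e
    proof -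
      have "(\<Prod>i\<in>{..<n} - {l}. \<psi> i (?c i) ((x(l := x l + e)) i)) = ?R" by (intro prod.cong) auto
      then show ?thesis unfolding split by simp
    qed
    have "4 * (\<Prod>i<n. \<psi> i (c i) (x i)) = (4 * \<psi> l (c l) (x l)) * ?R" unfolding split by simp
    also have "\<dots> \<le> (\<Sum>e\<in>steps. \<psi> l (Suc (c l)) (x l + e)) * ?R"
      by (intro mult_right_mono step l prod_nonneg) (use nn in auto)
    also have "\<dots> = (\<Sum>e\<in>steps. \<Prod>i<n. \<psi> i (?c i) ((x(l := x l + e)) i))"
      unfolding e sum_distrib_right ..
    also have "\<dots> \<le> (\<Sum>e\<in>steps. surv G g ys (x(l := x l + e)))" by (intro sum_mono IH)
    finally show ?thesis using Gx by (simp del: sum.insert)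
  next
    case False
    then obtain i where "i < n" "\<psi> i (c i) (x i) = 0" using nn by (metis order_le_less)
    then have "(\<Prod>i<n. \<psi> i (c i) (x i)) = 0" by (intro prod_zero) auto
    moreover have "0 \<le> surv G g (l # ys) x" by (rule surv_nonneg) (rule g(1))
    ultimately show ?thesis by linarith
  qed
qed

subsection \<open>Tubes are disjoint\<close>

lemma abs_sum_le:
  fixes a b w :: real
  assumes "\<bar>a + b\<bar> < w" "\<bar>a - b\<bar> < w"
  shows "\<bar>a\<bar> + \<bar>b\<bar> < w"
  using assms by linarith

text \<open>Suppose the obstacle is close to the tube, y = \<tau> (P, k) + g with g below s / 8. The
  cross product with (P, k) ignores the part along the axis and is at most P s / 8, so
  \<open>det\<close> bounds y by P s / 2. By \<open>far\<close> this forces s >= 40 s0, hence \<tau>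
  >= 39/40 s. But then y1, which differs from \<tau> P by less than s / 8, exceeds P s / 2.\<close>

lemma obstacle_far_from_tube:
  fixes P k s s0 \<tau> y1 y2 e1 e2 :: real
  assumes P: "1 \<le> P" and k: "0 \<le> k" "k \<le> P" and s0: "0 < s0" "s0 \<le> s" and tau: "s - s0 \<le> \<tau>"
    and e: "\<bar>e1\<bar> + \<bar>e2\<bar> < s / 12"
    and det: "max \<bar>y1\<bar> \<bar>y2\<bar> \<le> 4 * \<bar>P * y2 - k * y1\<bar>" and far: "20 * s0 * P \<le> max \<bar>y1\<bar> \<bar>y2\<bar>"
  shows "s / 24 < \<bar>\<tau> * P + e1 - y1\<bar> + \<bar>\<tau> * k + e2 - y2\<bar>"
proof (rule ccontr)
  assume neg: "\<not> ?thesis"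
  define g1 g2 where "g1 = y1 - \<tau> * P" and "g2 = y2 - \<tau> * k"
  have g: "\<bar>g1\<bar> + \<bar>g2\<bar> < s / 8" using neg e unfolding g1_def g2_def by (simp add: abs_if split: if_splits)
  have "P * y2 - k * y1 = P * g2 - k * g1" unfolding g1_def g2_def by (simp add: algebra_simps)
  also have "\<bar>\<dots>\<bar> \<le> P * \<bar>g2\<bar> + k * \<bar>g1\<bar>" using P k by (intro order_trans[OF abs_triangle_ineq4]) (simp add: abs_mult)
  also have "\<dots> \<le> P * \<bar>g2\<bar> + P * \<bar>g1\<bar>" using k by (intro add_left_mono mult_right_mono) auto
  also have "\<dots> = P * (\<bar>g1\<bar> + \<bar>g2\<bar>)" by (simp add: algebra_simps)
  also have "\<dots> \<le> P * (s / 8)" using g P by (intro mult_left_mono) auto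
  finally have "4 * \<bar>P * y2 - k * y1\<bar> \<le> P * s / 2" by simp
  then have M: "max \<bar>y1\<bar> \<bar>y2\<bar> \<le> P * s / 2" by (rule order_trans[OF det])
  then have "P * (40 * s0) \<le> P * s" using far by (simp add: algebra_simps)
  then have s40: "40 * s0 \<le> s" using P by simp
  have "\<bar>y1\<bar> \<le> P * s / 2" using M by simp
  moreover have "P * (39 / 40 * s) \<le> \<tau> * P"
  proof -
    have "39 / 40 * s \<le> \<tau>" using s40 tau by simp
    then show ?thesis using P by (simp add: mult.commute mult_right_mono)
  qed
  moreover have "1 * s \<le> P * s" using P s0 by (intro mult_right_mono) auto
  moreover have "y1 = \<tau> * P + g1" unfolding g1_def by simp
  moreover have "\<bar>g1\<bar> < s / 8" using g by linarith
  moreover have "0 < P * s" using P s0 by simp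
  ultimately show False by (simp add: abs_if split: if_splits)
qed

text \<open>As long as sj <= 4 s0, the relative shift is at most 7 s0 P in each coordinate, too
  little to close the initial gap of 20 s0 P. Later the shift \<kappa> along (P, k) dominates: it
  points away because the faster walk started in front, and \<kappa> P >= sj / 2 contradicts a
  remaining distance below sj / 4.\<close>

lemma tubes_far_apart:
  fixes P k si sj s0 vi vj D1 D2 e1 e2 e1' e2' n :: real
  assumes n: "2 \<le> n" and P: "2 * n \<le> P" and k: "0 \<le> k" "k \<le> P"
    and s0: "0 < s0" "s0 \<le> si" "s0 \<le> sj"
    and sync: "si \<le> (1 + 1 / (4 * n)) * sj" "sj \<le> (1 + 1 / (4 * n)) * si"
    and v: "1 \<le> vj" "vj + 1 / n \<le> vi" "vi \<le> 2" and D: "0 \<le> P * D1 + k * D2"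
    and far: "20 * s0 * P \<le> max \<bar>D1\<bar> \<bar>D2\<bar>"
    and e: "\<bar>e1\<bar> + \<bar>e2\<bar> < si / 12" and e': "\<bar>e1'\<bar> + \<bar>e2'\<bar> < sj / 12"
  shows "max si sj / 24 < \<bar>D1 + (si - s0) * vi * P + e1 - ((sj - s0) * vj * P + e1')\<bar> +
    \<bar>D2 + (si - s0) * vi * k + e2 - ((sj - s0) * vj * k + e2')\<bar>"
proof (rule ccontr)
  assume neg: "\<not> ?thesis"
  define \<kappa> where "\<kappa> = (si - s0) * vi - (sj - s0) * vj"
  define g1 g2 where "g1 = D1 + \<kappa> * P" and "g2 = D2 + \<kappa> * k"
  have en: "0 < 1 / (4 * n)" "1 / (4 * n) \<le> 1 / 8" using n by (auto simp: field_simps)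
  have P4: "4 \<le> P" using n P by simp
  have "(1 + 1 / (4 * n)) * sj \<le> (9 / 8) * sj" using en s0 by (intro mult_right_mono) auto
  then have s98: "si \<le> 9 / 8 * sj" using sync by linarith
  have f: "\<bar>g1 + e1 - e1'\<bar> + \<bar>g2 + e2 - e2'\<bar> \<le> max si sj / 24"
  proof -
    have "D1 + (si - s0) * vi * P + e1 - ((sj - s0) * vj * P + e1') = g1 + e1 - e1'"
      "D2 + (si - s0) * vi * k + e2 - ((sj - s0) * vj * k + e2') = g2 + e2 - e2'"
      unfolding g1_def g2_def \<kappa>_def by (simp_all add: algebra_simps)
    then show ?thesis using neg by (simp only: not_less)
  qed
  have tri: "\<bar>a\<bar> \<le> \<bar>a + b - c\<bar> + \<bar>b\<bar> + \<bar>c\<bar>" for a b c :: real by linarith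
  have lin: "x + y < t / 4" if "x \<le> a1 + b1 + c1" "y \<le> a2 + b2 + c2" "a1 + a2 \<le> m / 24"
    "b1 + b2 < s / 12" "c1 + c2 < t / 12" "m \<le> 9 / 8 * t" "s \<le> 9 / 8 * t" "0 < t"
    for x y a1 a2 b1 b2 c1 c2 m s t :: real
    using that by linarith
  have "max si sj \<le> 9 / 8 * sj" using s98 s0 by simp
  then have g: "\<bar>g1\<bar> + \<bar>g2\<bar> < sj / 4" by (rule lin[OF tri tri f e e' _ s98]) (use s0 in simp)
  show False
  proof (cases "sj \<le> 4 * s0")
    case True
    have b: "0 \<le> (s - s0) * v \<and> (s - s0) * v \<le> 7 * s0" if "s0 \<le> s" "s \<le> 9/2 * s0" "0 \<le> v" "v \<le> 2" for s v
    proof -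
      have "(s - s0) * v \<le> (7 / 2 * s0) * 2" using that s0 by (intro mult_mono) auto
      then show ?thesis using that by simp
    qed
    have "0 \<le> vi" "0 \<le> vj" "vj \<le> 2" using v n by (auto intro: order_trans[of _ "vj + 1 / n"])
    then have "\<bar>\<kappa>\<bar> \<le> 7 * s0" using b[of si vi] b[of sj vj] s0 s98 True v unfolding \<kappa>_def by linarith
    then have k1: "\<bar>\<kappa> * P\<bar> \<le> 7 * s0 * P" "\<bar>\<kappa> * k\<bar> \<le> 7 * s0 * P"
      unfolding abs_mult using P4 k s0 by (auto intro!: mult_mono)
    have "s0 * 1 \<le> s0 * P" using s0 P4 by (intro mult_left_mono) auto
    then have "\<bar>D1\<bar> < 20 * s0 * P" "\<bar>D2\<bar> < 20 * s0 * P"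
      using k1 g True s0 unfolding g1_def g2_def by linarith+
    then show False using far by simp
  next
    case False
    define \<delta> where "\<delta> = vi - vj"
    have n1: "0 < 1 / n" using n by simp
    have d: "1 / n \<le> \<delta>" "0 < \<delta>" using v n1 unfolding \<delta>_def by linarith+
    have "sj * (1 - 1 / (4 * n)) \<le> si"
    proof -
      have "sj * (1 - 1 / (4 * n)) \<le> (1 + 1 / (4 * n)) * si * (1 - 1 / (4 * n))"
        using sync(2) en by (intro mult_right_mono) auto
      also have "\<dots> = si - si * (1 / (4 * n))\<^sup>2" by (simp add: power2_eq_square algebra_simps)
      also have "\<dots> \<le> si" using s0 by simp
      finally show ?thesis .
    qed
    then have "(sj * (1 - 1 / (4 * n)) - s0) * vi \<le> (si - s0) * vi" using v n
      by (intro mult_right_mono) (auto intro: order_trans[of _ "vj + 1 / n"])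
    then have "sj * \<delta> - sj * (vi * (1 / (4 * n))) - s0 * \<delta> \<le> \<kappa>"
      unfolding \<kappa>_def \<delta>_def by (simp add: algebra_simps)
    \<comment> \<open>The mismatch 1 / (4 n) of the scales, at speed at most 2, costs at most half
      of the speed difference \<delta>, which is at least 1 / n.\<close>
    moreover have "sj * (vi * (1 / (4 * n))) \<le> sj * (\<delta> / 2)"
    proof -
      have "vi * (1 / (4 * n)) \<le> 2 * (1 / (4 * n))" using v en by (intro mult_right_mono) auto
      also have "\<dots> = (1 / n) / 2" by simp
      also have "\<dots> \<le> \<delta> / 2" using d by simp
      finally show ?thesis using s0 by (intro mult_left_mono) auto
    qed
    moreover have "s0 * \<delta> \<le> sj / 4 * \<delta>" using False d by (intro mult_right_mono) auto
    ultimately have kap: "sj * \<delta> / 4 \<le> \<kappa>" by simp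
    have sd: "sj * (1 / n) \<le> sj * \<delta>" using d s0 by (intro mult_left_mono) auto
    have sn: "0 < sj * (1 / n)" using s0 n by simp
    have k0: "0 < \<kappa>" using kap sd sn by linarith
    have "\<kappa> * (P * P) \<le> \<kappa> * (P * P + k * k)" using k0 by (intro mult_left_mono) auto
    also have "\<dots> \<le> P * g1 + k * g2" unfolding g1_def g2_def using D by (simp add: algebra_simps)
    also have "\<dots> \<le> P * \<bar>g1\<bar> + P * \<bar>g2\<bar>"
      using P4 k by (intro add_mono mult_left_mono order_trans[OF mult_left_mono mult_right_mono]) auto
    also have "\<dots> = P * (\<bar>g1\<bar> + \<bar>g2\<bar>)" by (simp add: algebra_simps)
    also have "\<dots> < P * (sj / 4)" using g P4 by (intro mult_strict_left_mono) auto
    finally have "P * (\<kappa> * P) < P * (sj / 4)" by (simp add: algebra_simps)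
    then have lt: "\<kappa> * P < sj / 4" using P4 by (simp add: mult_less_cancel_left)
    have "sj / 2 = (sj * (1 / n) / 4) * (2 * n)" using n by simp
    also have "\<dots> \<le> \<kappa> * P" using kap sd sn P n by (intro mult_mono) auto
    finally show False using lt s0 by simp
  qed
qed

text \<open>By \<open>ahead\<close>, the faster of two walks also starts in front along (P, k), so
  the two drift apart. By \<open>det\<close>, every obstacle stays outside a cone around each axis,
  expressed by the cross product with (P, k).\<close>

locale tubes = sched +
  fixes n k :: nat and B :: "(int \<times> int) set" and X :: "nat \<Rightarrow> int \<times> int" and v :: "nat \<Rightarrow> real"
  assumes n: "2 \<le> n" and Pn: "2 * n \<le> P" and kP: "k \<le> P" and finB: "finite B"
    and v: "i < n \<Longrightarrow> 1 \<le> v i \<and> v i \<le> 2"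
    and ahead: "i < n \<Longrightarrow> j < n \<Longrightarrow> i \<noteq> j \<Longrightarrow>
      v j + 1 / n \<le> v i \<and> 0 \<le> real P * real_of_int (fst (X i - X j)) + real k * real_of_int (snd (X i - X j)) \<or>
      v i + 1 / n \<le> v j \<and> 0 \<le> real P * real_of_int (fst (X j - X i)) + real k * real_of_int (snd (X j - X i))"
    and far: "i < n \<Longrightarrow> j < n \<Longrightarrow> i \<noteq> j \<Longrightarrow>
      20 * real s0 * real P \<le> max \<bar>real_of_int (fst (X i - X j))\<bar> \<bar>real_of_int (snd (X i - X j))\<bar>"
    and det: "i < n \<Longrightarrow> b \<in> B \<Longrightarrow> max \<bar>real_of_int (fst (b - X i))\<bar> \<bar>real_of_int (snd (b - X i))\<bar> \<le>
      4 * \<bar>real P * real_of_int (snd (b - X i)) - real k * real_of_int (fst (b - X i))\<bar>"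
    and farB: "i < n \<Longrightarrow> b \<in> B \<Longrightarrow>
      20 * real s0 * real P \<le> max \<bar>real_of_int (fst (b - X i))\<bar> \<bar>real_of_int (snd (b - X i))\<bar>"
begin

definition tpsi :: "nat \<Rightarrow> nat \<Rightarrow> int \<times> int \<Rightarrow> real" where
  "tpsi i = psi (X i) (v i * (P + k)) (v i * (real P - k))"

lemma drifts: "i < n \<Longrightarrow> \<bar>v i * (P + k)\<bar> \<le> 4 * P" "i < n \<Longrightarrow> \<bar>v i * (real P - k)\<bar> \<le> 4 * P"
proof -
  assume i: "i < n"
  have "v i * (P + k) \<le> 2 * (P + P)" "v i * (real P - k) \<le> 2 * (P + P)" "0 \<le> v i * (real P - k)"
  proof -
    have "0 \<le> real P - k" "real P - k \<le> P + P" "real (P + k) \<le> P + P" using kP by simp_all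
    then show "v i * (P + k) \<le> 2 * (P + P)" "v i * (real P - k) \<le> 2 * (P + P)" "0 \<le> v i * (real P - k)"
      using v[OF i] kP mult_mono[of "v i" 2 "real P + real k" "real P + P"]
        mult_mono[of "v i" 2 "real P - k" "real P + P"] by auto
  qed
  then show "\<bar>v i * (P + k)\<bar> \<le> 4 * P" "\<bar>v i * (real P - k)\<bar> \<le> 4 * P" using v[OF i] by auto
qed

lemma tube_offset:
  assumes i: "i < n" and pos: "0 < tpsi i m y"
  obtains e1 e2 where "real_of_int (fst y) = real_of_int (fst (X i)) + (sc m - s0) * v i * P + e1" "real_of_int (snd y) = real_of_int (snd (X i)) + (sc m - s0) * v i * k + e2"
    "\<bar>e1\<bar> + \<bar>e2\<bar> < sc m / 12"
proof -
  define e1 e2 where "e1 = real_of_int (fst y) - (fst (X i) + (sc m - s0) * v i * P)" and "e2 = real_of_int (snd y) - (snd (X i) + (sc m - s0) * v i * k)"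
  have "\<bar>e1 + e2\<bar> < sc m / 12" "\<bar>e1 - e2\<bar> < sc m / 12"
    using psi_support[OF pos[unfolded tpsi_def]] unfolding e1_def e2_def uu_def vv_def by (simp_all add: algebra_simps)
  then have "\<bar>e1\<bar> + \<bar>e2\<bar> < sc m / 12" by (rule abs_sum_le)
  then show ?thesis by (intro that[of e1 e2]) (simp_all add: e1_def e2_def)
qed

lemma tubes_sep:
  assumes pos: "\<And>i. i < n \<Longrightarrow> 0 < tpsi i (c i) (x i)"
    and sync: "\<And>i j. i < n \<Longrightarrow> j < n \<Longrightarrow> real (c i) \<le> (1 + 1 / (4 * n)) * max (real (c j)) (A 0)"
    and q: "q \<in> prs n B"
  shows "sc (c (fst q)) / 24 < d1z (pdiff x q)"
proof -
  have s0': "0 < real s0" using s0 by simp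
  have k: "0 \<le> real k" "real k \<le> P" using kP by auto
  consider i j where "q = (i, Inl j)" "i < n" "j < n" "i \<noteq> j" | i b where "q = (i, Inr b)" "i < n" "b \<in> B"
    using q unfolding prs_def by blast
  then show ?thesis
  proof cases
    case 2
    obtain e1 e2 where e: "real_of_int (fst (x i)) = real_of_int (fst (X i)) + (sc (c i) - s0) * v i * P + e1"
      "real_of_int (snd (x i)) = real_of_int (snd (X i)) + (sc (c i) - s0) * v i * k + e2" "\<bar>e1\<bar> + \<bar>e2\<bar> < sc (c i) / 12"
      using tube_offset[OF 2(2) pos[OF 2(2)]] .
    have "(sc (c i) - s0) * 1 \<le> (sc (c i) - s0) * v i"
      using sc_ge_s0[of "c i"] v[OF 2(2)] by (intro mult_left_mono) auto
    then have tau: "sc (c i) - s0 \<le> (sc (c i) - s0) * v i" by simp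
    have eq: "\<bar>real_of_int (fst (pdiff x q))\<bar> = \<bar>(sc (c i) - s0) * v i * P + e1 - real_of_int (fst (b - X i))\<bar>"
      "\<bar>real_of_int (snd (pdiff x q))\<bar> = \<bar>(sc (c i) - s0) * v i * k + e2 - real_of_int (snd (b - X i))\<bar>"
      unfolding 2(1) using e(1,2) by (simp_all add: algebra_simps)
    have "1 \<le> real P" using P by simp
    then show ?thesis unfolding d1z_def eq
      using obstacle_far_from_tube[OF _ k s0' sc_ge_s0 tau e(3) det[OF 2(2,3)] farB[OF 2(2,3)]] by (simp add: 2(1))
  next
    case 1
    obtain e1 e2 where e: "real_of_int (fst (x i)) = real_of_int (fst (X i)) + (sc (c i) - s0) * v i * P + e1"
      "real_of_int (snd (x i)) = real_of_int (snd (X i)) + (sc (c i) - s0) * v i * k + e2" "\<bar>e1\<bar> + \<bar>e2\<bar> < sc (c i) / 12"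
      using tube_offset[OF 1(2) pos[OF 1(2)]] .
    obtain e1' e2' where e': "real_of_int (fst (x j)) = real_of_int (fst (X j)) + (sc (c j) - s0) * v j * P + e1'"
      "real_of_int (snd (x j)) = real_of_int (snd (X j)) + (sc (c j) - s0) * v j * k + e2'" "\<bar>e1'\<bar> + \<bar>e2'\<bar> < sc (c j) / 12"
      using tube_offset[OF 1(3) pos[OF 1(3)]] .
    have sy: "sc (c i) \<le> (1 + 1 / (4 * real n)) * sc (c j)" "sc (c j) \<le> (1 + 1 / (4 * real n)) * sc (c i)"
      using sync[OF 1(2,3)] sync[OF 1(3,2)] by (auto intro!: sc_sync)
    have n': "2 \<le> real n" "2 * real n \<le> P" using n Pn by linarith+
    have "max (sc (c i)) (sc (c j)) / 24 < d1z (x i - x j)"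
      using ahead[OF 1(2,3,4)]
    proof
      assume a: "v j + 1 / n \<le> v i \<and> 0 \<le> real P * real_of_int (fst (X i - X j)) + real k * real_of_int (snd (X i - X j))"
      have eq: "real_of_int (fst (x i - x j)) = real_of_int (fst (X i - X j)) + (sc (c i) - s0) * v i * P + e1 - ((sc (c j) - s0) * v j * P + e1')"
        "real_of_int (snd (x i - x j)) = real_of_int (snd (X i - X j)) + (sc (c i) - s0) * v i * k + e2 - ((sc (c j) - s0) * v j * k + e2')"
        using e(1,2) e'(1,2) by simp_all
      show ?thesis unfolding d1z_def eq
        by (rule tubes_far_apart[OF n' k s0' sc_ge_s0 sc_ge_s0 sy _ _ _ _ far[OF 1(2,3,4)] e(3) e'(3)])
           (use a v[OF 1(2)] v[OF 1(3)] in auto)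
    next
      assume a: "v i + 1 / n \<le> v j \<and> 0 \<le> real P * real_of_int (fst (X j - X i)) + real k * real_of_int (snd (X j - X i))"
      have eq: "real_of_int (fst (x j - x i)) = real_of_int (fst (X j - X i)) + (sc (c j) - s0) * v j * P + e1' - ((sc (c i) - s0) * v i * P + e1)"
        "real_of_int (snd (x j - x i)) = real_of_int (snd (X j - X i)) + (sc (c j) - s0) * v j * k + e2' - ((sc (c i) - s0) * v i * k + e2)"
        using e(1,2) e'(1,2) by simp_all
      have "max (sc (c j)) (sc (c i)) / 24 < d1z (x j - x i)" unfolding d1z_def eq
        by (rule tubes_far_apart[OF n' k s0' sc_ge_s0 sc_ge_s0 sy(2,1) _ _ _ _ far[OF 1(3,2) 1(4)[symmetric]] e'(3) e(3)])
           (use a v[OF 1(2)] v[OF 1(3)] in auto)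
      moreover have "d1z (x j - x i) = d1z (x i - x j)" by (simp add: d1z_def abs_minus_commute)
      ultimately show ?thesis by (simp add: max.commute)
    qed
    then show ?thesis unfolding 1(1) by simp
  qed
qed

text \<open>The list is cut after n A J labels: before the cut the walks stay in their tubes,
  afterwards \<open>surv_super_phase\<close> applies and gives at least \<open>q\<close>. The
  product of the \<open>tpsi\<close> is 1 at the start and at most \<open>K\<close> at the cut, so
  \<open>surv_product\<close> yields the bound q / K.\<close>

lemma surv_mid_super:
  fixes N :: real and J b :: nat
  assumes N: "card (prs n B) \<le> N" "real n \<le> N" "real P \<le> 2 * N" "1 \<le> N"
    and ys: "synced n (A 0) (1 / (4 * n)) ys"
    and J: "1 \<le> J" "exp (8 * N * (6 + 2 * ln N)) \<le> sj J / 48"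
    and len: "length ys \<le> exp (ln (sj J / 48) * (1 + 1 / (8 * N)) ^ b)"
  shows "exp (- (real n * ((4800 * real P + 3) * (real J + 2)))) * (1/2) ^ (b + 1) \<le> surv (sepc n B 2) (\<lambda>_. 1) ys X"
proof -
  define cut where "cut = n * A J"
  define zs1 where "zs1 = take cut ys"
  define zs2 where "zs2 = drop cut ys"
  have ys12: "ys = zs1 @ zs2" unfolding zs1_def zs2_def by simp
  define L where "L = sj J / 48"
  have L0: "0 < L" unfolding L_def using sj_pos by simp
  have lnL: "8 * N * (6 + 2 * ln N) \<le> ln L" using J(2) L0 unfolding L_def[symmetric] by (simp add: ln_ge_iff)
  have n0: "0 < n" using n by simp
  have n4: "1 / (4 * real n) \<le> 1 / 4" "0 \<le> 1 / (4 * real n)" using n by (auto simp: field_simps)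
  have A0: "0 < real (A 0)" using A_pos[of 0] by simp
  have sub: "set ys \<subseteq> {..<n}" using ys unfolding synced_def by simp
  have sync: "real (count_list (take m ys) i) \<le> (1 + 1 / (4 * real n)) * max (real (count_list (take m ys) j)) (A 0)"
    if "i < n" "j < n" for m i j
    using conjunct2[OF ys[unfolded synced_def], rule_format, OF that, of m] by simp
  have ys4: "synced n (A 0) (1 / 4) ys"
    unfolding synced_def
  proof (intro conjI allI impI sub)
    fix m i j assume "i < n" "j < n"
    have "(1 + 1 / (4 * real n)) * max (real (count_list (take m ys) j)) (A 0) \<le> (1 + 1 / 4) * max (real (count_list (take m ys) j)) (A 0)"
      using n4 A0 by (intro mult_right_mono) auto
    then show "real (count_list (take m ys) i) \<le> (1 + 1 / 4) * max (real (count_list (take m ys) j)) (A 0)"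
      using sync[OF \<open>i < n\<close> \<open>j < n\<close>, of m] by linarith
  qed
  define K where "K = exp (real n * ((4800 * real P + 3) * (real J + 2)))"
  \<comment> \<open>Some walk has made at most the mean number \<open>A J\<close> of jumps. By
    synchronisation every other count is at most 4 A J = A (Suc J).\<close>
  have stgle: "stg (count_list zs1 i) \<le> Suc J" if i: "i < n" for i
  proof -
    have "set zs1 \<subseteq> {..<n}" using sub unfolding zs1_def by (meson set_take_subset order_trans)
    then have "sum (count_list zs1) {..<n} = length zs1" by (rule sum_count_set) simp
    then have sum: "(\<Sum>j<n. count_list zs1 j) \<le> n * A J" unfolding zs1_def cut_def by simp
    have "\<exists>j<n. count_list zs1 j \<le> A J"
    proof (rule ccontr)
      assume "\<not> ?thesis"
      then have "(\<Sum>j<n. A J) < (\<Sum>j<n. count_list zs1 j)" using n0 by (intro sum_strict_mono) (auto simp: not_le)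
      then show False using sum by simp
    qed
    then obtain j where j: "j < n" "count_list zs1 j \<le> A J" by blast
    have "max (real (count_list zs1 j)) (A 0) \<le> A J" using j(2) A_mono[of 0 J] by simp
    then have "(1 + 1 / (4 * real n)) * max (real (count_list zs1 j)) (A 0) \<le> 4 * real (A J)"
      using n4 by (intro mult_mono) auto
    then have "real (count_list zs1 i) \<le> 4 * real (A J)" using sync[OF i j(1), of cut] unfolding zs1_def by linarith
    then have "count_list zs1 i \<le> A (Suc J)" unfolding A_Suc by linarith
    then show ?thesis by (rule stg_least)
  qed
  have Kbound: "(\<Prod>i<n. tpsi i (count_list zs1 i) (x i)) \<le> K" for x
  proof -
    have "(\<Prod>i<n. tpsi i (count_list zs1 i) (x i)) \<le> (\<Prod>i<n. exp ((4800 * real P + 3) * (real J + 2)))"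
    proof (intro prod_mono conjI)
      fix i assume i: "i \<in> {..<n}"
      show "0 \<le> tpsi i (count_list zs1 i) (x i)" unfolding tpsi_def by (rule psi_nonneg)
      have "tpsi i (count_list zs1 i) (x i) \<le> exp (real ((4800 * P + 3) * (stg (count_list zs1 i) + 1)))"
        unfolding tpsi_def using drifts[of i] i by (intro psi_le) auto
      also have "\<dots> \<le> exp ((4800 * real P + 3) * (real J + 2))"
      proof -
        have "real (stg (count_list zs1 i) + 1) \<le> real J + 2" using stgle[of i] i by simp
        then have "(4800 * real P + 3) * real (stg (count_list zs1 i) + 1) \<le> (4800 * real P + 3) * (real J + 2)"
          by (intro mult_left_mono) auto
        moreover have "real ((4800 * P + 3) * (stg (count_list zs1 i) + 1)) =
            (4800 * real P + 3) * real (stg (count_list zs1 i) + 1)"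
          by (simp only: of_nat_mult of_nat_add of_nat_numeral)
        ultimately show ?thesis by (simp only: exp_le_cancel_iff)
      qed
      finally show "tpsi i (count_list zs1 i) (x i) \<le> exp ((4800 * real P + 3) * (real J + 2))" .
    qed
    also have "\<dots> = K" unfolding K_def by (simp flip: exp_of_nat_mult)
    finally show ?thesis .
  qed
  define q where "q = (1/2 :: real) ^ (b + 1)"
  have q0: "0 < q" unfolding q_def by simp
  \<comment> \<open>Scaled so that \<open>g\<close> is at least \<open>K\<close> at configurations
    inside the tubes, where the later survival probability is at least \<open>q\<close>.\<close>
  define g where "g = (\<lambda>x. K / q * surv (sepc n B 2) (\<lambda>_. 1) zs2 x)"
  have K0: "0 < K" unfolding K_def by simp
  have "(\<Prod>i<n. tpsi i ((\<lambda>_. 0) i) (X i)) \<le> surv (sepc n B 2) g zs1 X"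
  proof (rule surv_product)
    show "0 \<le> tpsi i c y" if "i < n" for i c y unfolding tpsi_def by (rule psi_nonneg)
    show "4 * tpsi i c y \<le> (\<Sum>e\<in>steps. tpsi i (Suc c) (y + e))" if "i < n" for i c y
      unfolding tpsi_def using drifts[OF that] by (rule psi_step)
    show "set zs1 \<subseteq> {..<n}" using sub unfolding zs1_def by (meson set_take_subset order_trans)
    show "sepc n B 2 x" if m: "m \<le> length zs1" and p: "\<And>i. i < n \<Longrightarrow> 0 < tpsi i (0 + count_list (take m zs1) i) (x i)" for m x
      unfolding sepc_def
    proof
      fix q assume q: "q \<in> prs n B"
      have t: "take m zs1 = take (min m cut) ys" unfolding zs1_def by (simp add: min.commute)
      have "sc (count_list (take m zs1) (fst q)) / 24 < d1z (pdiff x q)"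
        by (rule tubes_sep[OF _ _ q]) (use p sync in \<open>auto simp: t\<close>)
      then show "2 \<le> d1z (pdiff x q)" using sc_ge_s0[of "count_list (take m zs1) (fst q)"] s0 by simp
    qed
    show "0 \<le> g x" for x unfolding g_def using K0 q0 by (intro mult_nonneg_nonneg surv_nonneg) auto
    show "(\<Prod>i<n. tpsi i (0 + count_list zs1 i) (x i)) \<le> g x"
      if p: "\<And>i. i < n \<Longrightarrow> 0 < tpsi i (0 + count_list zs1 i) (x i)" for x
    proof -
      have sep: "sc (count_list zs1 (fst q)) / 24 < d1z (pdiff x q)" if "q \<in> prs n B" for q
        by (rule tubes_sep[OF _ _ that]) (use p sync[of _ _ cut] in \<open>auto simp: zs1_def\<close>)
      have "q \<le> surv (sepc n B 2) (\<lambda>_. 1) zs2 x"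
      proof (cases "zs2 = []")
        case True
        have "sepc n B 2 x" unfolding sepc_def
        proof
          fix q assume q: "q \<in> prs n B"
          show "2 \<le> d1z (pdiff x q)" using sep[OF q] sc_ge_s0[of "count_list zs1 (fst q)"] s0 by simp
        qed
        moreover have "q \<le> 1" unfolding q_def by (intro power_le_one) auto
        ultimately show ?thesis using True by simp
      next
        case False
        then have lz: "cut < length ys" unfolding zs2_def by simp
        then have l1: "length zs1 = cut" unfolding zs1_def by simp
        have A2: "2 * A 0 \<le> A J" using A_mono[OF J(1)] A_Suc[of 0] by simp
        have cutr: "real cut = n * real (A J)" unfolding cut_def by simp
        have c2: "2 * n * real (A 0) \<le> cut"
        proof -
          have "real n * (2 * real (A 0)) \<le> real n * real (A J)" using A2 by (intro mult_left_mono) linarith+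
          then show ?thesis unfolding cutr by simp
        qed
        \<comment> \<open>Every walk has made at least 4/5 A J jumps, more than A (J - 1), so its
          scale is at least sj J / 2. The tubes are 1/24 of the scale apart; this gives the 48 in
          \<open>L\<close>.\<close>
        have sepL: "sepc n B L x" unfolding sepc_def
        proof
          fix q assume q: "q \<in> prs n B"
          then have i: "fst q < n" by (auto simp: prs_def)
          have "4/5 * cut / n \<le> count_list (take cut ys) (fst q)"
            by (rule synced_counts(1)[OF ys4 n0 _ c2 A0 i]) (use lz in simp)
          then have "4/5 * real (A J) \<le> count_list zs1 (fst q)" unfolding cutr zs1_def using n0 by simp
          moreover obtain j where j: "J = Suc j" using J(1) by (cases J) auto
          ultimately have "A j < count_list zs1 (fst q)" using A_Suc[of j] A_pos[of j] by simp
          then have "\<not> stg (count_list zs1 (fst q)) \<le> j"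
            using stg_le[of "count_list zs1 (fst q)"] A_mono[of "stg (count_list zs1 (fst q))" j] by auto
          then have "J \<le> stg (count_list zs1 (fst q))" unfolding j by simp
          then have "sj J \<le> sj (stg (count_list zs1 (fst q)))" unfolding sj_def by (intro of_nat_mono mult_left_mono power_increasing) auto
          then show "L \<le> d1z (pdiff x q)"
            using sep[OF q] sc_bounds(1)[of "count_list zs1 (fst q)"] unfolding L_def by linarith
        qed
        \<comment> \<open>The two phases are matched here: the cut n P (sj J)^2 has to be at most a
          fifth of the first block, which uses that \<open>P\<close> is at most 2 N.\<close>
        have cL: "5 * real cut \<le> 1152 * real n * N\<^sup>2 * (L powr (1 + 1 / (8 * N)))\<^sup>2"
        proof -
          define E where "E = (L powr (1 / (8 * N)))\<^sup>2"
          have "0 \<le> ln N" using N(4) by simp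
          then have "8 * N * 6 \<le> 8 * N * (6 + 2 * ln N)" using N(4) by (intro mult_left_mono) auto
          then have "6 * (8 * N) \<le> ln L" using lnL by simp
          then have "6 \<le> ln L / (8 * N)" using N(4) by (simp add: le_divide_eq)
          then have "1 + 6 \<le> exp (ln L / (8 * N))" using exp_ge_add_one_self[of "ln L / (8 * N)"] by linarith
          also have "\<dots> = L powr (1 / (8 * N))" using L0 by (simp add: powr_def)
          finally have "7 * 7 \<le> L powr (1 / (8 * N)) * L powr (1 / (8 * N))" by (intro mult_mono) auto
          then have E20: "20 \<le> E" unfolding E_def by (simp add: power2_eq_square)
          have e: "(L powr (1 + 1 / (8 * N)))\<^sup>2 = (sj J)\<^sup>2 / 2304 * E"
            using L0 unfolding E_def by (simp add: powr_add power_mult_distrib) (simp add: L_def power_divide)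
          have "10 * P \<le> 20 * (1 * N)" using N(3) by simp
          also have "\<dots> \<le> 20 * (N * N)" using N(4) by (intro mult_left_mono mult_right_mono) auto
          also have "\<dots> \<le> E * (N * N)" using E20 by (intro mult_right_mono) auto
          finally have "real n * (sj J)\<^sup>2 / 2 * (10 * P) \<le> real n * (sj J)\<^sup>2 / 2 * (E * (N * N))"
            by (intro mult_left_mono) auto
          then show ?thesis unfolding e cutr A_real by (simp add: power2_eq_square algebra_simps)
        qed
        show ?thesis unfolding q_def
        proof (rule surv_super_phase[OF finB N(1) n0 N(2,4) _ A0 L0 lnL _ _ _ sepL])
          show "synced n (A 0) (1/4) (zs1 @ zs2)" using ys4 ys12 by simp
          show "real (2 * n) * real (A 0) \<le> real (length zs1)" using c2 l1 by simp
          show "5 * real (length zs1) \<le> 1152 * real n * N\<^sup>2 * (L powr (1 + 1 / (8 * N)))\<^sup>2" using cL l1 by simp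
          show "length (zs1 @ zs2) \<le> exp (ln L * (1 + 1 / (8 * N)) ^ b)" using len unfolding ys12[symmetric] L_def .
        qed
      qed
      then have "K * 1 \<le> K * (surv (sepc n B 2) (\<lambda>_. 1) zs2 x / q)" using K0 q0 by (intro mult_left_mono) auto
      then show ?thesis using Kbound[of x] unfolding g_def by simp
    qed
  qed
  moreover have "(\<Prod>i<n. tpsi i ((\<lambda>_. 0) i) (X i)) = 1" unfolding tpsi_def by (simp add: psi_0)
  moreover have "surv (sepc n B 2) g zs1 X = K / q * surv (sepc n B 2) (\<lambda>_. 1) ys X"
    unfolding g_def surv_scale ys12 surv_append ..
  ultimately have "1 \<le> K / q * surv (sepc n B 2) (\<lambda>_. 1) ys X" by simp
  then have "q / K \<le> surv (sepc n B 2) (\<lambda>_. 1) ys X" using K0 q0 by (simp add: field_simps)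
  moreover have "exp (- (real n * ((4800 * real P + 3) * (real J + 2)))) = 1 / K"
    unfolding K_def exp_minus by (rule inverse_eq_divide)
  ultimately show ?thesis by (simp add: q_def)
qed

end

subsection \<open>Leaving the obstacles by prescribed steps\<close>

fun walkok :: "(int \<times> int \<Rightarrow> bool) \<Rightarrow> int \<times> int \<Rightarrow> (int \<times> int) list \<Rightarrow> bool" where
  "walkok ok p [] \<longleftrightarrow> ok p"
| "walkok ok p (e # es) \<longleftrightarrow> ok p \<and> e \<in> steps \<and> walkok ok (p + e) es"

lemma walkok_append: "walkok ok p (es @ fs) \<longleftrightarrow> walkok ok p es \<and> walkok ok (p + sum_list es) fs"
proof (induction es arbitrary: p)
  case Nil
  then show ?case by (cases fs) auto
qed (auto simp: add.assoc)

lemma walkok_mono: "walkok ok p es \<Longrightarrow> (\<And>q. ok q \<Longrightarrow> ok' q) \<Longrightarrow> walkok ok' p es"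
  by (induction es arbitrary: p) auto

lemma surv_walkok:
  assumes "walkok (\<lambda>p. G (x(i := p))) (x i) es" "\<And>y. 0 \<le> g y"
  shows "(1/4) ^ length es * surv G g ls (x(i := x i + sum_list es)) \<le> surv G g (replicate (length es) i @ ls) x"
  using assms(1)
proof (induction es arbitrary: x)
  case (Cons e es)
  let ?x = "x(i := x i + e)"
  have "G (x(i := x i)) \<and> e \<in> steps \<and> walkok (\<lambda>p. G (x(i := p))) (x i + e) es"
    using Cons.prems by (simp only: walkok.simps)
  then have w: "walkok (\<lambda>p. G (?x(i := p))) (?x i) es" and G: "G x" and e: "e \<in> steps"
    by (simp_all only: fun_upd_upd fun_upd_same fun_upd_triv)
  have "(1/4) ^ length (e # es) * surv G g ls (x(i := x i + sum_list (e # es))) =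
      (1/4) ^ length es * surv G g ls (?x(i := ?x i + sum_list es)) / 4" by (simp add: add.assoc)
  also have "\<dots> \<le> surv G g (replicate (length es) i @ ls) ?x / 4"
    by (intro divide_right_mono Cons.IH[OF w]) simp
  also have "\<dots> \<le> surv G g (i # replicate (length es) i @ ls) x"
    by (rule surv_forced[where G = G and x = x and e = e and g = g and l = i, OF G e assms(2)])
  finally show ?case by (simp only: length_Cons replicate_Suc append_Cons)
qed simp

section \<open>Boxes and paths around them\<close>

type_synonym box = "int \<times> int \<times> int \<times> int"

text \<open>\<open>enl k (a, b, c, d)\<close> is the rectangle \<open>[a, b] \<times> [c, d]\<close> enlarged by \<open>k\<close> in all directions.\<close>

fun enl :: "int \<Rightarrow> box \<Rightarrow> int \<times> int \<Rightarrow> bool" where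
  "enl k (a, b, c, d) (x, y) \<longleftrightarrow> a - k \<le> x \<and> x \<le> b + k \<and> c - k \<le> y \<and> y \<le> d + k"

fun wid :: "box \<Rightarrow> nat" where "wid (a, b, c, d) = nat (b - a + 3)"
fun low :: "box \<Rightarrow> int" where "low (a, b, c, d) = c"

lemma walk_right:
  assumes "\<And>x'. x \<le> x' \<Longrightarrow> x' \<le> x + int r \<Longrightarrow> ok (x', y)"
  shows "walkok ok (x, y) (replicate r (1 :: int, 0 :: int)) \<and> sum_list (replicate r (1 :: int, 0 :: int)) = (int r, 0)"
  using assms
proof (induction r arbitrary: x)
  case (Suc r)
  have "walkok ok (x + 1, y) (replicate r (1 :: int, 0 :: int)) \<and> sum_list (replicate r (1 :: int, 0 :: int)) = (int r, 0)"
    by (rule Suc.IH) (use Suc.prems in auto)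
  then show ?case using Suc.prems[of x] by simp
qed (simp add: zero_prod_def)

text \<open>Go straight up until the next row would touch a box, then right below that box to the
  first column past it, and up again. The detour stays inside the enlargement by 2, where
  \<open>sep\<close> excludes all other boxes. A box blocks only from the row two below its lower
  side, so it causes at most one detour, of length at most \<open>wid\<close>.\<close>

lemma climb:
  fixes Q :: "box set" and x y Y :: int
  assumes Q: "finite Q" and wf: "\<And>a b c d. (a, b, c, d) \<in> Q \<Longrightarrow> a \<le> b \<and> c \<le> d"
    and sep: "\<And>q q' p. q \<in> Q \<Longrightarrow> q' \<in> Q \<Longrightarrow> q \<noteq> q' \<Longrightarrow> enl 2 q p \<Longrightarrow> \<not> enl 1 q' p"
    and start: "\<And>q. q \<in> Q \<Longrightarrow> \<not> enl 1 q (x, y)" and "y \<le> Y"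
  shows "\<exists>es. walkok (\<lambda>p. (\<forall>q\<in>Q. \<not> enl 1 q p) \<and> y \<le> snd p) (x, y) es \<and>
    snd ((x, y) + sum_list es) = Y \<and> int (length es) \<le> Y - y + (\<Sum>q | q \<in> Q \<and> y \<le> low q - 2. int (wid q))"
  using start \<open>y \<le> Y\<close>
proof (induction "nat (Y - y)" arbitrary: x y)
  case 0
  then show ?case by (intro exI[of _ "[]"]) (auto intro: sum_nonneg)
next
  case (Suc n)
  then have lt: "y < Y" by simp
  let ?W = "\<lambda>y. \<Sum>q | q \<in> Q \<and> y \<le> low q - 2. int (wid q)"
  show ?case
  proof (cases "\<forall>q\<in>Q. \<not> enl 1 q (x, y + 1)")
    case True
    have "\<exists>es. walkok (\<lambda>p. (\<forall>q\<in>Q. \<not> enl 1 q p) \<and> y + 1 \<le> snd p) (x, y + 1) es \<and>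
      snd ((x, y + 1) + sum_list es) = Y \<and> int (length es) \<le> Y - (y + 1) + ?W (y + 1)"
      by (rule Suc.hyps(1)) (use Suc.hyps(2) True lt in auto)
    then obtain es where es: "walkok (\<lambda>p. (\<forall>q\<in>Q. \<not> enl 1 q p) \<and> y + 1 \<le> snd p) (x, y + 1) es"
      "snd ((x, y + 1) + sum_list es) = Y" "int (length es) \<le> Y - (y + 1) + ?W (y + 1)" by blast
    have "walkok (\<lambda>p. (\<forall>q\<in>Q. \<not> enl 1 q p) \<and> y \<le> snd p) (x, y + 1) es"
      by (rule walkok_mono[OF es(1)]) auto
    moreover have "?W (y + 1) \<le> ?W y" using Q by (intro sum_mono2) auto
    ultimately show ?thesis using Suc.prems(1) es(2,3)
      by (intro exI[of _ "(0, 1) # es"]) (auto simp: ac_simps)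
  next
    case False
    then obtain q where q: "q \<in> Q" "enl 1 q (x, y + 1)" by blast
    obtain a b c d where abcd: "q = (a, b, c, d)" by (cases q)
    have ab: "a \<le> b" "c \<le> d" using wf q(1) abcd by auto
    have nq: "\<not> enl 1 q (x, y)" using Suc.prems(1) q(1) by simp
    then have c: "c = y + 2" and x: "a - 1 \<le> x" "x \<le> b + 1" using q(2) ab unfolding abcd by auto
    define r where "r = nat (b + 2 - x)"
    have r: "int r = b + 2 - x" using x unfolding r_def by simp
    let ?ok = "\<lambda>p. (\<forall>q\<in>Q. \<not> enl 1 q p) \<and> y \<le> snd p"
    have near: "?ok p" if "enl 2 q p" "\<not> enl 1 q p" "y \<le> snd p" for p
      using sep[OF q(1) _ _ that(1)] that(2,3) by metis
    have wr: "walkok ?ok (x, y) (replicate r (1 :: int, 0 :: int)) \<and> sum_list (replicate r (1 :: int, 0 :: int)) = (int r, 0)"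
      by (rule walk_right, rule near) (use x c ab r in \<open>auto simp: abcd\<close>)
    have ok2: "?ok (b + 2, y + 1)" by (rule near) (use x c ab in \<open>auto simp: abcd\<close>)
    have "\<exists>es. walkok (\<lambda>p. (\<forall>q\<in>Q. \<not> enl 1 q p) \<and> y + 1 \<le> snd p) (b + 2, y + 1) es \<and>
      snd ((b + 2, y + 1) + sum_list es) = Y \<and> int (length es) \<le> Y - (y + 1) + ?W (y + 1)"
      by (rule Suc.hyps(1)) (use Suc.hyps(2) ok2 lt in auto)
    then obtain es where es: "walkok (\<lambda>p. (\<forall>q\<in>Q. \<not> enl 1 q p) \<and> y + 1 \<le> snd p) (b + 2, y + 1) es"
      "snd ((b + 2, y + 1) + sum_list es) = Y" "int (length es) \<le> Y - (y + 1) + ?W (y + 1)" by blast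
    have w1: "walkok ?ok (b + 2, y + 1) es" by (rule walkok_mono[OF es(1)]) auto
    have pos: "(x, y) + (int r, 0) = (b + 2, y)" using r by simp
    have full: "walkok ?ok (x, y) (replicate r (1 :: int, 0 :: int) @ (0, 1) # es)"
      unfolding walkok_append using wr w1 near[of "(b + 2, y)"] pos x c ab by (auto simp: abcd)
    have fin: "(x, y) + sum_list (replicate r (1 :: int, 0 :: int) @ (0, 1) # es) = (b + 2, y + 1) + sum_list es"
      using wr r by (auto simp: prod_eq_iff)
    have "int (wid q) + ?W (y + 1) = (\<Sum>q \<in> insert q {q. q \<in> Q \<and> y + 1 \<le> low q - 2}. int (wid q))"
      using Q c by (subst sum.insert) (auto simp: abcd)
    also have "\<dots> \<le> ?W y" using Q q(1) c by (intro sum_mono2) (auto simp: abcd)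
    finally have W: "int (wid q) + ?W (y + 1) \<le> ?W y" .
    have "int r \<le> int (wid q)" using r x ab by (simp add: abcd)
    then have "int (length (replicate r (1 :: int, 0 :: int) @ (0, 1) # es)) \<le> Y - y + ?W y" using es(3) W by simp
    then show ?thesis using full es(2) unfolding fin[symmetric] by blast
  qed
qed

lemma rectangle_box:
  assumes "rectangle R"
  obtains a b c d :: int where "a \<le> b" "c \<le> d" "R = {a..b} \<times> {c..d}"
proof -
  obtain a' b' c' d' :: real where R: "R \<noteq> {}" "R = {(x, y). a' \<le> real_of_int x \<and> real_of_int x \<le> b' \<and>
      c' \<le> real_of_int y \<and> real_of_int y \<le> d'}" using assms unfolding rectangle_def by blast
  have e: "R = {\<lceil>a'\<rceil>..\<lfloor>b'\<rfloor>} \<times> {\<lceil>c'\<rceil>..\<lfloor>d'\<rfloor>}" unfolding R(2) by (auto simp: ceiling_le_iff le_floor_iff)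
  have "\<lceil>a'\<rceil> \<le> \<lfloor>b'\<rfloor>" "\<lceil>c'\<rceil> \<le> \<lfloor>d'\<rfloor>" using R(1) unfolding e by auto
  then show thesis using that e by blast
qed

lemma d1_eq_one_cases:
  assumes "d1 (x, y) (x', y') = 1"
  shows "x = x' \<and> \<bar>y - y'\<bar> = 1 \<or> y = y' \<and> \<bar>x - x'\<bar> = 1"
proof -
  have "real_of_int (\<bar>x - x'\<bar> + \<bar>y - y'\<bar>) = 1" using assms unfolding d1_def by simp
  then have "\<bar>x - x'\<bar> + \<bar>y - y'\<bar> = 1" by linarith
  then show ?thesis by linarith
qed

lemma border_box:
  fixes a b c d :: int
  assumes "a \<le> b" "c \<le> d"
  defines "R \<equiv> {a..b} \<times> {c..d}"
  shows "p \<in> ext_border R \<Longrightarrow> enl 1 (a, b, c, d) p" "finite (ext_border R)"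
    "b - a + (d - c) + 2 \<le> int (card (ext_border R))"
proof -
  show en: "enl 1 (a, b, c, d) p" if pb: "p \<in> ext_border R" for p
  proof -
    obtain x y where p: "p = (x, y)" by (cases p)
    obtain x' y' where w: "(x', y') \<in> R" "d1 (x, y) (x', y') = 1" using pb unfolding ext_border_def p by auto
    show ?thesis using d1_eq_one_cases[OF w(2)] w(1) unfolding p R_def by auto
  qed
  have "ext_border R \<subseteq> {a - 1..b + 1} \<times> {c - 1..d + 1}" using en by (auto simp: subset_iff)
  then show fin: "finite (ext_border R)" by (rule finite_subset) simp
  \<comment> \<open>One horizontal and one vertical side of the border suffice: they have (b - a +
    1) + (d - c + 1) sites.\<close>
  have sub: "{a..b} \<times> {c - 1} \<union> {a - 1} \<times> {c..d} \<subseteq> ext_border R"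
  proof
    fix p assume p: "p \<in> {a..b} \<times> {c - 1} \<union> {a - 1} \<times> {c..d}"
    show "p \<in> ext_border R"
    proof (cases "p \<in> {a..b} \<times> {c - 1}")
      case True
      then obtain x where x: "p = (x, c - 1)" "a \<le> x" "x \<le> b" by auto
      have "\<exists>z'\<in>R. d1 p z' = 1"
        by (rule bexI[of _ "(x, c)"]) (use x assms(2) in \<open>auto simp: d1_def R_def\<close>)
      then show ?thesis using x unfolding ext_border_def R_def by auto
    next
      case False
      then obtain y where y: "p = (a - 1, y)" "c \<le> y" "y \<le> d" using p by auto
      have "\<exists>z'\<in>R. d1 p z' = 1"
        by (rule bexI[of _ "(a, y)"]) (use y assms(1) in \<open>auto simp: d1_def R_def\<close>)
      then show ?thesis using y unfolding ext_border_def R_def by auto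
    qed
  qed
  have "card ({a..b} \<times> {c - 1} \<union> {a - 1} \<times> {c..d}) = card ({a..b} \<times> {c - 1}) + card ({a - 1} \<times> {c..d})"
    by (rule card_Un_disjoint) auto
  also have "\<dots> = nat (b - a + 1) + nat (d - c + 1)" by (simp add: card_cartesian_product)
  finally have "nat (b - a + 1) + nat (d - c + 1) \<le> card (ext_border R)"
    using card_mono[OF fin sub] by simp
  then show "b - a + (d - c) + 2 \<le> int (card (ext_border R))" using assms(1,2) by linarith
qed

lemma free_int:
  assumes "finite (F :: int set)"
  shows "\<exists>Y\<ge>y. Y \<le> y + int (card F) \<and> Y \<notin> F"
proof (rule ccontr)
  assume "\<not> ?thesis"
  then have "{y..y + int (card F)} \<subseteq> F" by auto
  then have "card {y..y + int (card F)} \<le> card F" by (rule card_mono[OF assms])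
  then show False by simp
qed

definition goodc :: "nat \<Rightarrow> (int \<times> int) set \<Rightarrow> (nat \<Rightarrow> int \<times> int) \<Rightarrow> bool" where
  "goodc n B x \<longleftrightarrow> (\<forall>i<n. x i \<notin> B) \<and> (\<forall>i<n. \<forall>j<n. i \<noteq> j \<longrightarrow> 2 \<le> d1 (x i) (x j))"

lemma goodc_update:
  assumes "goodc n B x" "i < n" "p \<notin> B" "\<And>j. j < n \<Longrightarrow> j \<noteq> i \<Longrightarrow> 2 \<le> d1 p (x j)"
  shows "goodc n B (x(i := p))"
proof -
  have "d1 q r = d1 r q" for q r by (simp add: d1_def abs_minus_commute)
  then show ?thesis using assms unfolding goodc_def by (auto simp: fun_upd_def)
qed

lemma d1_ge_two:
  assumes "2 \<le> \<bar>fst p - fst q\<bar> \<or> 2 \<le> \<bar>snd p - snd q\<bar>"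
  shows "2 \<le> d1 p q"
proof -
  have "2 \<le> \<bar>fst p - fst q\<bar> + \<bar>snd p - snd q\<bar>" using assms by linarith
  then have "2 \<le> real_of_int (\<bar>fst p - fst q\<bar> + \<bar>snd p - snd q\<bar>)" by linarith
  then show ?thesis unfolding d1_def by simp
qed

context
  fixes n p :: nat and L1 :: int and Q :: "box set" and B :: "(int \<times> int) set" and z :: "nat \<Rightarrow> int \<times> int"
  assumes L1: "4 \<le> L1" and p2: "2 \<le> p" and finQ: "finite Q" and wfQ: "\<And>a b c d. (a, b, c, d) \<in> Q \<Longrightarrow> a \<le> b \<and> c \<le> d"
    and sepQ: "\<And>q q' p. q \<in> Q \<Longrightarrow> q' \<in> Q \<Longrightarrow> q \<noteq> q' \<Longrightarrow> enl 2 q p \<Longrightarrow> \<not> enl 1 q' p"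
    and size: "(\<Sum>(a, b, c, d)\<in>Q. b - a + (d - c) + 2) \<le> int p"
    and BQ: "\<And>b. b \<in> B \<Longrightarrow> \<exists>q\<in>Q. enl 1 q b"
    and z: "goodc n B z" and zQ: "\<And>i q. i < n \<Longrightarrow> q \<in> Q \<Longrightarrow> \<not> enl 3 q (z i)"
begin

definition hlen :: int where "hlen = (2 * L1 + 4) * (int n + int p)"

definition rowfree :: "int \<Rightarrow> bool" where
  "rowfree Y \<longleftrightarrow> (\<forall>(a, b, c, d)\<in>Q. \<not> (c - L1 \<le> Y \<and> Y \<le> d + L1))"

lemma card_Q: "int (card Q) \<le> int p"
proof -
  have "(\<Sum>q\<in>Q. 1) \<le> (\<Sum>(a, b, c, d)\<in>Q. b - a + (d - c) + 2)"
    using wfQ by (intro sum_mono) fastforce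
  then show ?thesis using size by simp
qed

text \<open>Walk \<open>i\<close> is a highest one among those not yet moved, so the others of this
  kind lie in its row or below. Its distance above 3 from the rectangles allows two steps straight
  up, after which it is two rows above them; from there \<open>climb\<close> leads to a free
  row.\<close>

lemma one_move:
  assumes x: "goodc n B x" and i: "i < n" "i \<notin> Mv" and Mv: "Mv \<subseteq> {..<n}"
    and rows: "\<And>j. j \<in> Mv \<Longrightarrow> rowfree (snd (x j))" 
    and apart: "\<And>j j'. j \<in> Mv \<Longrightarrow> j' < n \<Longrightarrow> j' \<noteq> j \<Longrightarrow> L1 \<le> \<bar>snd (x j) - snd (x j')\<bar>"
    and unmoved: "\<And>j. j < n \<Longrightarrow> j \<notin> Mv \<Longrightarrow> x j = z j"
    and top: "\<And>j. j < n \<Longrightarrow> j \<notin> Mv \<Longrightarrow> snd (x j) \<le> snd (x i)"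
  shows "\<exists>es. walkok (\<lambda>q. goodc n B (x(i := q))) (x i) es \<and> int (length es) \<le> hlen \<and>
    rowfree (snd (x i + sum_list es)) \<and> (\<forall>j<n. j \<noteq> i \<longrightarrow> L1 \<le> \<bar>snd (x i + sum_list es) - snd (x j)\<bar>)"
proof -
  obtain zx zy where xi: "x i = (zx, zy)" by (cases "x i")
  \<comment> \<open>The rows excluded as targets; their number bounds the height of the
    climb.\<close>
  define F where "F = (\<Union>(a, b, c, d)\<in>Q. {c - L1..d + L1}) \<union> (\<Union>j\<in>{..<n} - {i}. {snd (x j) - L1..snd (x j) + L1})"
  have finF: "finite F" unfolding F_def using finQ by auto
  have cF: "int (card F) \<le> (\<Sum>(a, b, c, d)\<in>Q. d - c + 2 * L1 + 1) + int n * (2 * L1 + 1)"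
  proof -
    have "card F \<le> card (\<Union>(a, b, c, d)\<in>Q. {c - L1..d + L1}) + card (\<Union>j\<in>{..<n} - {i}. {snd (x j) - L1..snd (x j) + L1})"
      unfolding F_def by (rule card_Un_le)
    also have "\<dots> \<le> (\<Sum>(a, b, c, d)\<in>Q. card {c - L1..d + L1}) + (\<Sum>j\<in>{..<n} - {i}. card {snd (x j) - L1..snd (x j) + L1})"
      using finQ by (intro add_mono card_UN_le[THEN order_trans]) (auto simp: case_prod_beta')
    finally have "int (card F) \<le> int ((\<Sum>(a, b, c, d)\<in>Q. card {c - L1..d + L1}) + (\<Sum>j\<in>{..<n} - {i}. card {snd (x j) - L1..snd (x j) + L1}))"
      by (rule of_nat_mono)
    also have "\<dots> = (\<Sum>(a, b, c, d)\<in>Q. int (card {c - L1..d + L1})) + (\<Sum>j\<in>{..<n} - {i}. int (card {snd (x j) - L1..snd (x j) + L1}))"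
    proof -
      have "int (case q of (a, b, c, d) \<Rightarrow> card {c - L1..d + L1}) = (case q of (a, b, c, d) \<Rightarrow> int (card {c - L1..d + L1}))" for q :: box
        by (cases q) simp
      then show ?thesis by (simp only: of_nat_add of_nat_sum)
    qed
    finally have "int (card F) \<le> (\<Sum>(a, b, c, d)\<in>Q. int (card {c - L1..d + L1})) + (\<Sum>j\<in>{..<n} - {i}. int (card {snd (x j) - L1..snd (x j) + L1}))" .
    also have "(\<Sum>(a, b, c, d)\<in>Q. int (card {c - L1..d + L1})) = (\<Sum>(a, b, c, d)\<in>Q. d - c + 2 * L1 + 1)"
      using wfQ L1 by (intro sum.cong refl) fastforce
    also have "(\<Sum>j\<in>{..<n} - {i}. int (card {snd (x j) - L1..snd (x j) + L1})) \<le> int n * (2 * L1 + 1)"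
    proof -
      have "(\<Sum>j\<in>{..<n} - {i}. int (card {snd (x j) - L1..snd (x j) + L1})) = (\<Sum>j\<in>{..<n} - {i}. 2 * L1 + 1)"
        using L1 by (intro sum.cong) auto
      also have "\<dots> \<le> (\<Sum>j\<in>{..<n}. 2 * L1 + 1)" using L1 by (intro sum_mono2) auto
      finally show ?thesis by simp
    qed
    finally show ?thesis by simp
  qed
  obtain Y where Y: "zy + 2 \<le> Y" "Y \<le> zy + 2 + int (card F)" "Y \<notin> F" using free_int[OF finF] by blast
  have Yfree: "rowfree Y" using Y(3) unfolding rowfree_def F_def by force
  have Yapart: "L1 \<le> \<bar>Y - snd (x j)\<bar>" if "j < n" "j \<noteq> i" for j
  proof -
    have "Y \<notin> {snd (x j) - L1..snd (x j) + L1}" using Y(3) that unfolding F_def by auto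
    then show ?thesis by auto
  qed
  \<comment> \<open>Walks already moved become one-point boxes, which \<open>climb\<close> avoids
    like rectangles. Their rows are at distance at least \<open>L1\<close>, hence at least 4, from
    each other and from all rectangles, so the separation of the boxes persists.\<close>
  define sg where "sg = (\<lambda>j. (fst (x j), fst (x j), snd (x j), snd (x j)))"
  define Q' where "Q' = Q \<union> sg ` Mv"
  have finMv: "finite Mv" using Mv finite_subset by blast
  have finQ': "finite Q'" unfolding Q'_def using finQ finMv by simp
  have row1: "\<not> (enl 2 q r \<and> enl 2 (sg j) r)" if q: "q \<in> Q" and j: "j \<in> Mv" for q j r
  proof
    assume a: "enl 2 q r \<and> enl 2 (sg j) r"
    obtain a b c d where abcd: "q = (a, b, c, d)" by (cases q)
    have "\<not> (c - L1 \<le> snd (x j) \<and> snd (x j) \<le> d + L1)"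
      using rows[OF j] q unfolding rowfree_def abcd by fastforce
    then show False using a L1 unfolding abcd sg_def by (cases r) auto
  qed
  have e12: "enl 1 q r \<Longrightarrow> enl 2 q r" for q r by (cases q; cases r) auto
  have sepQ': "\<not> enl 1 q' r" if "q \<in> Q'" "q' \<in> Q'" "q \<noteq> q'" "enl 2 q r" for q q' r
  proof
    assume en: "enl 1 q' r"
    consider "q \<in> Q" "q' \<in> Q" | j where "q \<in> Q" "q' = sg j" "j \<in> Mv" | j where "q = sg j" "j \<in> Mv" "q' \<in> Q"
      | j j' where "q = sg j" "j \<in> Mv" "q' = sg j'" "j' \<in> Mv"
      using \<open>q \<in> Q'\<close> \<open>q' \<in> Q'\<close> unfolding Q'_def by blast
    then show False
    proof cases
      case 1
      then show False using sepQ[OF 1 \<open>q \<noteq> q'\<close> \<open>enl 2 q r\<close>] en by simp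
    next
      case 2
      then show False using row1[of q j r] e12[OF en] \<open>enl 2 q r\<close> by simp
    next
      case 3
      then show False using row1[of q' j r] e12[OF en] \<open>enl 2 q r\<close> by simp
    next
      case 4
      then have "j \<noteq> j'" using \<open>q \<noteq> q'\<close> by auto
      then have "L1 \<le> \<bar>snd (x j) - snd (x j')\<bar>" using apart[of j j'] 4 Mv by auto
      then show False using L1 en \<open>enl 2 q r\<close> unfolding 4(1,3) sg_def by (cases r) auto
    qed
  qed
  have zi: "x i = z i" using unmoved i by simp
  have startQ: "\<not> enl 1 q (zx, zy + t)" if "q \<in> Q" "0 \<le> t" "t \<le> 2" for q t
  proof -
    have zz: "z i = (zx, zy)" using zi xi by simp
    show ?thesis using zQ[OF i(1) that(1)] that(2,3) unfolding zz by (cases q) auto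
  qed
  have startM: "\<not> enl 1 (sg j) (zx, zy + t)" if "j \<in> Mv" "0 \<le> t" "t \<le> 2" for j t
  proof -
    have "L1 \<le> \<bar>snd (x j) - zy\<bar>" using apart[OF that(1) i(1)] i(2) that(1) xi by auto
    then show ?thesis using L1 that unfolding sg_def by auto
  qed
  have start: "\<not> enl 1 q (zx, zy + 2)" if qQ: "q \<in> Q'" for q
  proof (cases "q \<in> Q")
    case True
    then show ?thesis by (intro startQ) auto
  next
    case False
    then obtain j where "j \<in> Mv" "q = sg j" using qQ unfolding Q'_def by blast
    then show ?thesis using startM[of j 2] by simp
  qed
  have wfQ': "a \<le> b \<and> c \<le> d" if "(a, b, c, d) \<in> Q'" for a b c d
    using that wfQ unfolding Q'_def sg_def by auto
  have "\<exists>es. walkok (\<lambda>p. (\<forall>q\<in>Q'. \<not> enl 1 q p) \<and> zy + 2 \<le> snd p) (zx, zy + 2) es \<and>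
    snd ((zx, zy + 2) + sum_list es) = Y \<and>
    int (length es) \<le> Y - (zy + 2) + (\<Sum>q | q \<in> Q' \<and> zy + 2 \<le> low q - 2. int (wid q))"
  proof (rule climb)
    show "a \<le> b \<and> c \<le> d" if "(a, b, c, d) \<in> Q'" for a b c d by (rule wfQ'[OF that])
    show "\<not> enl 1 q' p" if "q \<in> Q'" "q' \<in> Q'" "q \<noteq> q'" "enl 2 q p" for q q' p by (rule sepQ'[OF that])
    show "\<not> enl 1 q (zx, zy + 2)" if "q \<in> Q'" for q by (rule start[OF that])
  qed (fact finQ' Y(1))+
  then obtain es where es: "walkok (\<lambda>p. (\<forall>q\<in>Q'. \<not> enl 1 q p) \<and> zy + 2 \<le> snd p) (zx, zy + 2) es"
    "snd ((zx, zy + 2) + sum_list es) = Y"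
    "int (length es) \<le> Y - (zy + 2) + (\<Sum>q | q \<in> Q' \<and> zy + 2 \<le> low q - 2. int (wid q))"
    by blast
  have notB: "q \<notin> B" if "\<And>r. r \<in> Q \<Longrightarrow> \<not> enl 1 r q" for q using BQ that by blast
  have upok: "goodc n B (x(i := (zx, zy + t)))" if t: "0 \<le> t" "t \<le> 2" for t
  proof (rule goodc_update[OF x i(1)])
    show "(zx, zy + t) \<notin> B" using startQ t by (intro notB) auto
    fix j assume j: "j < n" "j \<noteq> i"
    show "2 \<le> d1 (zx, zy + t) (x j)"
    proof (cases "j \<in> Mv")
      case True
      have "L1 \<le> \<bar>snd (x j) - zy\<bar>" using apart[OF True i(1)] j(2) xi by auto
      then show ?thesis using L1 t by (intro d1_ge_two) auto
    next
      case False
      have "2 \<le> d1 (x i) (x j)" using x i(1) j unfolding goodc_def by auto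
      moreover have "snd (x j) \<le> zy" using top[OF j(1) False] xi by simp
      ultimately show ?thesis using t unfolding xi d1_def by simp
    qed
  qed
  have later: "goodc n B (x(i := q))" if ok: "\<forall>r\<in>Q'. \<not> enl 1 r q" and row: "zy + 2 \<le> snd q" for q
  proof (rule goodc_update[OF x i(1)])
    show "q \<notin> B" using ok unfolding Q'_def by (intro notB) auto
    fix j assume j: "j < n" "j \<noteq> i"
    show "2 \<le> d1 q (x j)"
    proof (cases "j \<in> Mv")
      case True
      then have "\<not> enl 1 (sg j) q" using ok unfolding Q'_def by auto
      then show ?thesis unfolding sg_def by (intro d1_ge_two) (cases q, auto)
    next
      case False
      have "snd (x j) \<le> zy" using top[OF j(1) False] xi by simp
      then show ?thesis using row by (intro d1_ge_two) auto
    qed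
  qed
  let ?es = "(0, 1) # (0, 1) # es"
  have "walkok (\<lambda>q. goodc n B (x(i := q))) (zx, zy + 2) es"
    by (rule walkok_mono[OF es(1)]) (use later in auto)
  then have w: "walkok (\<lambda>q. goodc n B (x(i := q))) (x i) ?es"
    using upok[of 0] upok[of 1] unfolding xi by (simp add: add.assoc)
  have "x i + sum_list ?es = (zx, zy + 2) + sum_list es" unfolding xi by (auto simp: prod_eq_iff)
  then have fin: "snd (x i + sum_list ?es) = Y" using es(2) by (simp only:)
  have len: "int (length ?es) \<le> hlen"
  proof -
    have "(\<Sum>q | q \<in> Q' \<and> zy + 2 \<le> low q - 2. int (wid q)) \<le> (\<Sum>q\<in>Q'. int (wid q))"
      using finQ' by (intro sum_mono2) auto
    also have "\<dots> \<le> (\<Sum>q\<in>Q. int (wid q)) + (\<Sum>q\<in>sg ` Mv. int (wid q))"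
      unfolding Q'_def using finQ finMv by (subst sum.union_inter[symmetric]) (auto intro!: sum_nonneg)
    also have "(\<Sum>q\<in>sg ` Mv. int (wid q)) \<le> (\<Sum>q\<in>sg ` Mv. 3)" by (intro sum_mono) (auto simp: sg_def)
    also have "\<dots> \<le> 3 * int n"
    proof -
      have "card (sg ` Mv) \<le> card Mv" by (rule card_image_le[OF finMv])
      also have "\<dots> \<le> n" using card_mono[OF _ Mv] by simp
      finally show ?thesis by simp
    qed
    also have "(\<Sum>q\<in>Q. int (wid q)) = (\<Sum>(a, b, c, d)\<in>Q. b - a + 3)"
      using wfQ by (intro sum.cong refl) fastforce
    finally have len1: "int (length ?es) \<le> 2 + (\<Sum>(a, b, c, d)\<in>Q. d - c + 2 * L1 + 1) + int n * (2 * L1 + 1) + (\<Sum>(a, b, c, d)\<in>Q. b - a + 3) + 3 * int n"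
      using es(3) Y(2) cF by simp
    have "(\<Sum>(a, b, c, d)\<in>Q. d - c + 2 * L1 + 1) + (\<Sum>(a, b, c, d)\<in>Q. b - a + 3) =
        (\<Sum>q\<in>Q. (\<lambda>(a, b, c, d). b - a + (d - c) + 2) q + (2 * L1 + 2))"
      unfolding sum.distrib[symmetric] by (intro sum.cong) auto
    also have "\<dots> = (\<Sum>(a, b, c, d)\<in>Q. b - a + (d - c) + 2) + int (card Q) * (2 * L1 + 2)" by (simp add: sum.distrib)
    finally have "int (length ?es) \<le> 2 + int p + int (card Q) * (2 * L1 + 2) + int n * (2 * L1 + 1) + 3 * int n"
      using size len1 by linarith
    also have "int (card Q) * (2 * L1 + 2) \<le> int p * (2 * L1 + 2)" using card_Q L1 by (intro mult_right_mono) auto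
    finally have "int (length ?es) \<le> 2 + int p * (2 * L1 + 3) + int n * (2 * L1 + 4)" by (simp add: algebra_simps)
    moreover have "int p * (2 * L1 + 3) + 2 \<le> int p * (2 * L1 + 4)" using p2 by (simp add: algebra_simps)
    ultimately show ?thesis unfolding hlen_def by (simp add: algebra_simps)
  qed
  show ?thesis using w len Yfree Yapart fin by (intro exI[of _ ?es]) auto
qed

lemma all_moves:
  assumes "k \<le> n"
  shows "\<exists>ord l x. distinct ord \<and> set ord \<subseteq> {..<n} \<and> length ord = k \<and> goodc n B x \<and>
    (\<forall>j\<in>set ord. rowfree (snd (x j))) \<and>
    (\<forall>j\<in>set ord. \<forall>j'<n. j' \<noteq> j \<longrightarrow> L1 \<le> \<bar>snd (x j) - snd (x j')\<bar>) \<and>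
    (\<forall>j<n. j \<notin> set ord \<longrightarrow> x j = z j) \<and> int (length (forced l ord)) \<le> int k * hlen \<and>
    (\<forall>g ls. (\<forall>y. 0 \<le> g y) \<longrightarrow> (1/4) ^ length (forced l ord) * surv (goodc n B) g ls x
       \<le> surv (goodc n B) g (forced l ord @ ls) z)"
  using assms
proof (induction k)
  case 0
  show ?case using z by (intro exI[of _ "[]"] exI[of _ "\<lambda>_. 0"] exI[of _ z]) (auto simp: forced_def)
next
  case (Suc k)
  then obtain ord l x where ih: "distinct ord" "set ord \<subseteq> {..<n}" "length ord = k" "goodc n B x"
    "\<forall>j\<in>set ord. rowfree (snd (x j))"
    "\<forall>j\<in>set ord. \<forall>j'<n. j' \<noteq> j \<longrightarrow> L1 \<le> \<bar>snd (x j) - snd (x j')\<bar>"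
    "\<forall>j<n. j \<notin> set ord \<longrightarrow> x j = z j" "int (length (forced l ord)) \<le> int k * hlen"
    "\<forall>g ls. (\<forall>y. 0 \<le> g y) \<longrightarrow> (1/4) ^ length (forced l ord) * surv (goodc n B) g ls x
       \<le> surv (goodc n B) g (forced l ord @ ls) z" by auto
  let ?U = "{..<n} - set ord"
  have "card (set ord) < n" using ih(1,3) Suc.prems by (simp add: distinct_card)
  then have "?U \<noteq> {}" using card_mono[of "set ord" "{..<n}"] by auto
  \<comment> \<open>A highest remaining walk is chosen so that its way up meets no unmoved
    walk.\<close>
  then obtain i where i: "i \<in> ?U" "\<And>j. j \<in> ?U \<Longrightarrow> snd (x j) \<le> snd (x i)"
  proof -
    have fin: "finite ((\<lambda>j. snd (x j)) ` ?U)" by simp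
    have "Max ((\<lambda>j. snd (x j)) ` ?U) \<in> (\<lambda>j. snd (x j)) ` ?U"
      using \<open>?U \<noteq> {}\<close> by (intro Max_in) auto
    then obtain i where "i \<in> ?U" "snd (x i) = Max ((\<lambda>j. snd (x j)) ` ?U)" by auto
    then show thesis using Max_ge[OF fin] by (intro that[of i]) auto
  qed
  obtain es where es: "walkok (\<lambda>q. goodc n B (x(i := q))) (x i) es" "int (length es) \<le> hlen"
    "rowfree (snd (x i + sum_list es))" "\<forall>j<n. j \<noteq> i \<longrightarrow> L1 \<le> \<bar>snd (x i + sum_list es) - snd (x j)\<bar>"
    using one_move[OF ih(4), of i "set ord"] i ih by auto
  let ?x = "x(i := x i + sum_list es)" and ?l = "l(i := length es)"
  have f: "forced ?l (ord @ [i]) = forced l ord @ replicate (length es) i"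
  proof -
    have m: "concat (map (\<lambda>j. replicate (?l j) j) ord) = forced l ord"
      unfolding forced_def using i(1) by (intro arg_cong[of _ _ concat] map_cong) auto
    have "forced ?l (ord @ [i]) = concat (map (\<lambda>j. replicate (?l j) j) ord) @ replicate (?l i) i"
      by (simp only: forced_def map_append concat_append list.map concat.simps append_Nil2)
    then show ?thesis unfolding m by simp
  qed
  have gx: "goodc n B ?x"
  proof -
    have "walkok ok p es \<Longrightarrow> ok (p + sum_list es)" for ok p
    proof (induction es arbitrary: p)
      case (Cons e es)
      then have "walkok ok (p + e) es" by (simp only: walkok.simps)
      from Cons.IH[OF this] show ?case by (simp add: add.assoc)
    qed simp
    from this[OF es(1)] show ?thesis .
  qed
  have sv: "(1/4) ^ length (forced ?l (ord @ [i])) * surv (goodc n B) g ls ?x \<le> surv (goodc n B) g (forced ?l (ord @ [i]) @ ls) z"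
    if g: "\<forall>y. 0 \<le> g y" for g ls
  proof -
    have "(1/4) ^ length (forced ?l (ord @ [i])) * surv (goodc n B) g ls ?x =
        (1/4) ^ length (forced l ord) * ((1/4) ^ length es * surv (goodc n B) g ls ?x)"
      unfolding f by (simp add: power_add)
    also have "\<dots> \<le> (1/4) ^ length (forced l ord) * surv (goodc n B) g (replicate (length es) i @ ls) x"
      by (intro mult_left_mono surv_walkok es(1)) (use g in auto)
    also have "\<dots> \<le> surv (goodc n B) g (forced l ord @ (replicate (length es) i @ ls)) z" using ih(9) g by blast
    finally show ?thesis unfolding f by simp
  qed
  show ?case
  proof (intro exI[of _ "ord @ [i]"] exI[of _ ?l] exI[of _ ?x] conjI)
    show "int (length (forced ?l (ord @ [i]))) \<le> int (Suc k) * hlen"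
      unfolding f using ih(8) es(2) by (simp add: algebra_simps)
    show "\<forall>j\<in>set (ord @ [i]). rowfree (snd (?x j))" using ih(5) es(3) by auto
    show "\<forall>j\<in>set (ord @ [i]). \<forall>j'<n. j' \<noteq> j \<longrightarrow> L1 \<le> \<bar>snd (?x j) - snd (?x j')\<bar>"
    proof (intro ballI allI impI)
      fix j j' assume j: "j \<in> set (ord @ [i])" "j' < n" "j' \<noteq> j"
      show "L1 \<le> \<bar>snd (?x j) - snd (?x j')\<bar>"
      proof (cases "j = i")
        case True
        then show ?thesis using es(4) j by auto
      next
        case False
        then have jo: "j \<in> set ord" using j by auto
        then have jn: "j < n" using ih(2) by auto
        show ?thesis
        proof (cases "j' = i")
          case True
          then show ?thesis using es(4) jn False by (auto simp: abs_minus_commute)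
        next
          case False
          then show ?thesis using ih(6) jo j \<open>j \<noteq> i\<close> by auto
        qed
      qed
    qed
    show "\<forall>g ls. (\<forall>y. 0 \<le> g y) \<longrightarrow> (1/4) ^ length (forced ?l (ord @ [i])) * surv (goodc n B) g ls ?x
       \<le> surv (goodc n B) g (forced ?l (ord @ [i]) @ ls) z" using sv by blast
    show "goodc n B ?x" by (rule gx)
    show "\<forall>j<n. j \<notin> set (ord @ [i]) \<longrightarrow> ?x j = z j" using ih(7) by auto
  qed (use ih i in auto)
qed

lemma forced_phase:
  obtains ord l X where "distinct ord" "set ord = {..<n}" "int (\<Sum>i<n. l i) \<le> int n * hlen"
    "\<And>g ls. (\<And>y. 0 \<le> g y) \<Longrightarrow> (1/4) ^ (\<Sum>i<n. l i) * surv (goodc n B) g ls X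
       \<le> surv (goodc n B) g (forced l ord @ ls) z"
    "\<And>i j. i < n \<Longrightarrow> j < n \<Longrightarrow> i \<noteq> j \<Longrightarrow> L1 \<le> \<bar>snd (X i) - snd (X j)\<bar>"
    "\<And>i b. i < n \<Longrightarrow> b \<in> B \<Longrightarrow> L1 \<le> \<bar>snd b - snd (X i)\<bar>"
proof -
  obtain ord l x where m: "distinct ord" "set ord \<subseteq> {..<n}" "length ord = n" "goodc n B x"
    "\<forall>j\<in>set ord. rowfree (snd (x j))"
    "\<forall>j\<in>set ord. \<forall>j'<n. j' \<noteq> j \<longrightarrow> L1 \<le> \<bar>snd (x j) - snd (x j')\<bar>"
    "int (length (forced l ord)) \<le> int n * hlen"
    "\<forall>g ls. (\<forall>y. 0 \<le> g y) \<longrightarrow> (1/4) ^ length (forced l ord) * surv (goodc n B) g ls x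
       \<le> surv (goodc n B) g (forced l ord @ ls) z" using all_moves[of n] by auto
  have so: "set ord = {..<n}"
    by (rule card_subset_eq[OF _ m(2)]) (use m in \<open>auto simp: distinct_card\<close>)
  have len: "length (forced l ord) = (\<Sum>i<n. l i)"
    unfolding length_forced using m(1) so by (simp add: sum_list_distinct_conv_sum_set)
  show thesis
  proof (rule that[of ord l x])
    show "L1 \<le> \<bar>snd b - snd (x i)\<bar>" if ib: "i < n" "b \<in> B" for i b
    proof -
      obtain q where q: "q \<in> Q" "enl 1 q b" using BQ[OF ib(2)] by blast
      obtain a b' c d where abcd: "q = (a, b', c, d)" by (cases q)
      have "\<not> (c - L1 \<le> snd (x i) \<and> snd (x i) \<le> d + L1)"
        using m(5) so ib(1) q(1) unfolding rowfree_def abcd by fastforce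
      then show ?thesis using q(2) unfolding abcd by (cases b) auto
    qed
  qed (use m so in \<open>auto simp: len[symmetric]\<close>)
qed

end

subsection \<open>A direction that avoids all obstacles\<close>

text \<open>If |y2| > |y1|, no slope below 1 is bad, since |P y2 - k y1| >= |y2|. Otherwise the
  cross products for two slopes differ by at least |y1|, which is the maximum, and they cannot both
  be smaller than a quarter of it.\<close>

lemma one_bad_slope:
  fixes P y1 y2 :: int and k k' :: nat
  assumes k: "int k < P" "int k' < P" and ne: "k \<noteq> k'" and y: "0 < max \<bar>y1\<bar> \<bar>y2\<bar>"
    and b: "4 * \<bar>P * y2 - k * y1\<bar> < max \<bar>y1\<bar> \<bar>y2\<bar>" "4 * \<bar>P * y2 - k' * y1\<bar> < max \<bar>y1\<bar> \<bar>y2\<bar>"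
  shows False
proof (cases "\<bar>y1\<bar> < \<bar>y2\<bar>")
  case True
  have "\<bar>int k * y1\<bar> \<le> int k * \<bar>y2\<bar>" unfolding abs_mult using mult_left_mono[of "\<bar>y1\<bar>" "\<bar>y2\<bar>" "int k"] True by simp
  moreover have "(int k + 1) * \<bar>y2\<bar> \<le> P * \<bar>y2\<bar>" using k by (intro mult_right_mono) auto
  moreover have "P * \<bar>y2\<bar> = \<bar>P * y2\<bar>" using k by (simp add: abs_mult)
  moreover have "\<bar>P * y2\<bar> - \<bar>int k * y1\<bar> \<le> \<bar>P * y2 - k * y1\<bar>" by (rule abs_triangle_ineq2)
  ultimately have "\<bar>y2\<bar> \<le> \<bar>P * y2 - k * y1\<bar>" by (simp add: algebra_simps)
  moreover have "max \<bar>y1\<bar> \<bar>y2\<bar> = \<bar>y2\<bar>" using True by simp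
  ultimately show False using b(1) y by linarith
next
  case False
  have "1 \<le> \<bar>int k - int k'\<bar>" using ne by simp
  then have "1 * \<bar>y1\<bar> \<le> \<bar>int k - int k'\<bar> * \<bar>y1\<bar>" by (rule mult_right_mono) simp
  also have "\<dots> = \<bar>(P * y2 - k' * y1) - (P * y2 - k * y1)\<bar>" by (simp add: algebra_simps flip: abs_mult)
  also have "\<dots> \<le> \<bar>P * y2 - k' * y1\<bar> + \<bar>P * y2 - k * y1\<bar>" by (rule abs_triangle_ineq4)
  finally have "1 * \<bar>y1\<bar> \<le> \<bar>P * y2 - k' * y1\<bar> + \<bar>P * y2 - k * y1\<bar>" .
  moreover have "max \<bar>y1\<bar> \<bar>y2\<bar> = \<bar>y1\<bar>" using False by simp
  ultimately show False using b y by linarith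
qed

text \<open>There are n p + 1 slopes k / (n p + 1) but at most n p pairs of a walk and a border
  site, and by \<open>one_bad_slope\<close> each pair spoils at most one slope.\<close>

lemma exists_direction:
  fixes B :: "(int \<times> int) set" and X :: "nat \<Rightarrow> int \<times> int" and n p :: nat
  assumes B: "finite B" "card B \<le> p" and far: "\<And>i b. i < n \<Longrightarrow> b \<in> B \<Longrightarrow> fst b - fst (X i) \<noteq> 0 \<or> snd b - snd (X i) \<noteq> 0"
  shows "\<exists>k\<le>n * p. \<forall>i<n. \<forall>b\<in>B. max \<bar>fst b - fst (X i)\<bar> \<bar>snd b - snd (X i)\<bar> \<le>
    4 * \<bar>int (n * p + 1) * (snd b - snd (X i)) - int k * (fst b - fst (X i))\<bar>"
proof (rule ccontr)
  let ?P = "int (n * p + 1)"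
  define bad where "bad ib k \<longleftrightarrow> (case ib of (i, b) \<Rightarrow>
    4 * \<bar>?P * (snd b - snd (X i)) - int k * (fst b - fst (X i))\<bar> < max \<bar>fst b - fst (X i)\<bar> \<bar>snd b - snd (X i)\<bar>)"
    for ib :: "nat \<times> int \<times> int" and k :: nat
  assume neg: "\<not> ?thesis"
  have "\<forall>k\<in>{..n * p}. \<exists>ib. ib \<in> {..<n} \<times> B \<and> bad ib k"
  proof
    fix k assume "k \<in> {..n * p}"
    then have "\<not> (\<forall>i<n. \<forall>b\<in>B. max \<bar>fst b - fst (X i)\<bar> \<bar>snd b - snd (X i)\<bar> \<le>
      4 * \<bar>?P * (snd b - snd (X i)) - int k * (fst b - fst (X i))\<bar>)"
      using neg by (meson atMost_iff)
    then obtain i b where "i < n" "b \<in> B" "\<not> max \<bar>fst b - fst (X i)\<bar> \<bar>snd b - snd (X i)\<bar> \<le>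
      4 * \<bar>?P * (snd b - snd (X i)) - int k * (fst b - fst (X i))\<bar>" by meson
    then show "\<exists>ib. ib \<in> {..<n} \<times> B \<and> bad ib k"
      by (intro exI[of _ "(i, b)"]) (simp only: bad_def not_le prod.case mem_Sigma_iff lessThan_iff simp_thms)
  qed
  from bchoice[OF this] obtain f where "\<forall>k\<in>{..n * p}. f k \<in> {..<n} \<times> B \<and> bad (f k) k" by blast
  then have f: "\<And>k. k \<le> n * p \<Longrightarrow> f k \<in> {..<n} \<times> B \<and> bad (f k) k" by simp
  have "inj_on f {..n * p}"
  proof (rule inj_onI)
    fix k k' assume k: "k \<in> {..n * p}" "k' \<in> {..n * p}" and eq: "f k = f k'"
    obtain i b where ib: "f k = (i, b)" by (cases "f k")
    show "k = k'"
    proof (rule ccontr)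
      assume "k \<noteq> k'"
      have "i < n" "b \<in> B" using f[of k] k ib by auto
      then have "0 < max \<bar>fst b - fst (X i)\<bar> \<bar>snd b - snd (X i)\<bar>" using far[of i b] by auto
      moreover have "bad (i, b) k" "bad (i, b) k'" using f[of k] f[of k'] k eq ib by simp_all
      then have "4 * \<bar>?P * (snd b - snd (X i)) - int k * (fst b - fst (X i))\<bar> < max \<bar>fst b - fst (X i)\<bar> \<bar>snd b - snd (X i)\<bar>"
        "4 * \<bar>?P * (snd b - snd (X i)) - int k' * (fst b - fst (X i))\<bar> < max \<bar>fst b - fst (X i)\<bar> \<bar>snd b - snd (X i)\<bar>"
        unfolding bad_def by simp_all
      moreover have "int k < ?P" "int k' < ?P" using k by (simp_all only: atMost_iff of_nat_less_iff)
      ultimately show False using one_bad_slope[OF _ _ \<open>k \<noteq> k'\<close>] by blast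
    qed
  qed
  moreover have "f ` {..n * p} \<subseteq> {..<n} \<times> B"
  proof (rule image_subsetI)
    fix k assume "k \<in> {..n * p}"
    then show "f k \<in> {..<n} \<times> B" using f[of k] by simp
  qed
  ultimately have "card {..n * p} \<le> card ({..<n} \<times> B)" using B by (intro card_inj_on_le) auto
  also have "\<dots> \<le> n * p" using B by (simp add: card_cartesian_product)
  finally show False by simp
qed

text \<open>The speeds are 1 + rank / n in the order of the key, with ties broken by the index;
  distinct ranks give speeds at least 1 / n apart.\<close>

lemma exists_ranks:
  fixes key :: "nat \<Rightarrow> int" and n :: nat
  assumes n: "0 < n"
  shows "\<exists>v :: nat \<Rightarrow> real. (\<forall>i<n. 1 \<le> v i \<and> v i \<le> 2) \<and>
    (\<forall>i<n. \<forall>j<n. i \<noteq> j \<longrightarrow> (v j + 1 / n \<le> v i \<and> key j \<le> key i) \<or> (v i + 1 / n \<le> v j \<and> key i \<le> key j))"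
proof -
  define lt where "lt i j \<longleftrightarrow> key i < key j \<or> key i = key j \<and> i < j" for i j
  define r where "r i = card {j. j < n \<and> lt j i}" for i
  define v where "v i = 1 + real (r i) / n" for i
  have rn: "r i \<le> n" for i
  proof -
    have "r i \<le> card {..<n}" unfolding r_def by (rule card_mono) auto
    then show ?thesis by simp
  qed
  have less: "v j + 1 / n \<le> v i \<and> key j \<le> key i" if "j < n" "lt j i" for i j
  proof -
    have "{k. k < n \<and> lt k j} \<subset> {k. k < n \<and> lt k i}" using that unfolding lt_def by auto
    then have "r j < r i" unfolding r_def by (intro psubset_card_mono) auto
    then have "real (r j) + 1 \<le> r i" by simp
    then have "(real (r j) + 1) / n \<le> real (r i) / n" by (rule divide_right_mono) simp
    then show ?thesis using that unfolding v_def lt_def by (auto simp: add_divide_distrib)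
  qed
  have "lt i j \<or> lt j i" if "i \<noteq> j" for i j using that unfolding lt_def by auto
  then show ?thesis using less rn n
    by (intro exI[of _ v]) (auto simp: v_def divide_le_eq)
qed

subsection \<open>From distances to boxes\<close>

definition boxset :: "box \<Rightarrow> (int \<times> int) set" where
  "boxset = (\<lambda>(a, b, c, d). {a..b} \<times> {c..d})"

lemma enl_near:
  assumes "enl k (a, b, c, d) r" "a \<le> b" "c \<le> d" "0 \<le> k"
  shows "\<exists>w\<in>boxset (a, b, c, d). \<bar>fst w - fst r\<bar> \<le> k \<and> \<bar>snd w - snd r\<bar> \<le> k"
proof -
  obtain x y where r: "r = (x, y)" by (cases r)
  show ?thesis using assms unfolding r boxset_def
    by (intro bexI[of _ "(max a (min b x), max c (min d y))"]) auto
qed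

text \<open>\<open>bad\<close> asks for a distance of exactly 1. A walk inside a rectangle makes the
  infimum at most 0, so this is not \<open>bad\<close>. If no walk is inside, all distances to the
  rectangles are positive integers, and avoiding the borders excludes 1.\<close>

lemma not_bad_goodc:
  assumes g: "goodc n B x" and B: "B = (\<Union>R\<in>S. ext_border R)" and S: "finite S" and n: "2 \<le> n"
  shows "\<not> bad n S x"
proof
  assume "bad n S x"
  then have m: "min (points_sep n x) (points_rects_sep d1 n x S) = 1" unfolding bad_def .
  have "ereal 2 \<le> points_sep n x"
    unfolding points_sep_def using g unfolding goodc_def by (intro INF_greatest) auto
  then have pr: "points_rects_sep d1 n x S = 1" using m by (auto simp: min_def split: if_splits)
  show False
  proof (cases "\<exists>i<n. \<exists>R\<in>S. x i \<in> R")
    case True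
    then obtain i R where i: "i < n" "R \<in> S" "x i \<in> R" by auto
    have "points_rects_sep d1 n x S \<le> pt_set_dist d1 (x i) R"
      unfolding points_rects_sep_def using i by (intro INF_lower2[of i] INF_lower) auto
    also have "\<dots> \<le> ereal (d1 (x i) (x i))" unfolding pt_set_dist_def using i by (intro INF_lower)
    also have "\<dots> = 0" by (simp add: d1_def)
    finally show False using pr by simp
  next
    case False
    have "ereal 2 \<le> points_rects_sep d1 n x S"
      unfolding points_rects_sep_def pt_set_dist_def
    proof (intro INF_greatest)
      fix i R w assume a: "i \<in> {..<n}" "R \<in> S" "w \<in> R"
      have nR: "x i \<notin> R" using False a by auto
      have "x i \<notin> ext_border R" using g a unfolding goodc_def B by auto
      then have n1: "d1 (x i) w \<noteq> 1" using nR a unfolding ext_border_def by auto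
      define t where "t = \<bar>fst (x i) - fst w\<bar> + \<bar>snd (x i) - snd w\<bar>"
      have t: "d1 (x i) w = real_of_int t" unfolding d1_def t_def by simp
      have "x i \<noteq> w" using nR a by metis
      then have "t \<noteq> 0" unfolding t_def prod_eq_iff by linarith
      moreover have "t \<noteq> 1" using n1 unfolding t by auto
      moreover have "0 \<le> t" unfolding t_def by simp
      ultimately have "2 \<le> t" by simp
      then show "ereal 2 \<le> ereal (d1 (x i) w)" unfolding t by simp
    qed
    then show False using pr by simp
  qed
qed

lemma sepc_goodc: "sepc n B 2 x \<Longrightarrow> goodc n B x"
proof -
  assume s: "sepc n B 2 x"
  have a: "2 \<le> d1 (x i) (x j)" if "i < n" "j < n" "i \<noteq> j" for i j
  proof -
    have "(i, Inl j) \<in> prs n B" using that unfolding prs_def by auto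
    then have "2 \<le> d1z (x i - x j)" using s unfolding sepc_def by fastforce
    then show ?thesis by (simp add: d1z_def d1_def)
  qed
  have b: "x i \<notin> B" if "i < n" for i
  proof
    assume "x i \<in> B"
    then have "(i, Inr (x i)) \<in> prs n B" using that unfolding prs_def by blast
    then have "2 \<le> d1z (pdiff x (i, Inr (x i)))" using s unfolding sepc_def by blast
    then show False by (simp add: d1z_def)
  qed
  show ?thesis unfolding goodc_def using a b by auto
qed

text \<open>A point in the enlargements of two boxes by 2 and by 1 would put the rectangles within
  sup distance 2 + 1 = 3, and a start in an enlargement by 3 would be within 3 of the rectangle;
  both contradict the strict bounds.\<close>

lemma boxes_of_rectangles:
  assumes S: "finite S" "\<forall>R\<in>S. rectangle R" and card: "(\<Sum>R\<in>S. card (ext_border R)) \<le> p"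
    and sepR: "rects_sep S > 3" and zsep: "points_sep n z > 1" and zR: "points_rects_sep dinf n z S > 3"
  defines "B \<equiv> (\<Union>R\<in>S. ext_border R)"
  obtains Q where "finite Q" "\<And>a b c d. (a, b, c, d) \<in> Q \<Longrightarrow> a \<le> b \<and> c \<le> d"
    "\<And>q q' r. q \<in> Q \<Longrightarrow> q' \<in> Q \<Longrightarrow> q \<noteq> q' \<Longrightarrow> enl 2 q r \<Longrightarrow> \<not> enl 1 q' r"
    "(\<Sum>(a, b, c, d)\<in>Q. b - a + (d - c) + 2) \<le> int p" "\<And>b. b \<in> B \<Longrightarrow> \<exists>q\<in>Q. enl 1 q b"
    "\<And>i q. i < n \<Longrightarrow> q \<in> Q \<Longrightarrow> \<not> enl 3 q (z i)" "goodc n B z" "finite B" "card B \<le> p"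
proof -
  have "\<forall>R\<in>S. \<exists>q. (case q of (a, b, c, d) \<Rightarrow> a \<le> b \<and> c \<le> d) \<and> R = boxset q"
  proof
    fix R assume "R \<in> S"
    then obtain a b c d :: int where "a \<le> b" "c \<le> d" "R = {a..b} \<times> {c..d}" using S(2) rectangle_box by blast
    then show "\<exists>q. (case q of (a, b, c, d) \<Rightarrow> a \<le> b \<and> c \<le> d) \<and> R = boxset q"
      by (intro exI[of _ "(a, b, c, d)"]) (simp add: boxset_def)
  qed
  then obtain bx where bx: "\<And>R. R \<in> S \<Longrightarrow> (case bx R of (a, b, c, d) \<Rightarrow> a \<le> b \<and> c \<le> d) \<and> R = boxset (bx R)"
    by metis
  define Q where "Q = bx ` S"
  have wf: "a \<le> b \<and> c \<le> d" if "(a, b, c, d) \<in> Q" for a b c d using that bx unfolding Q_def by force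
  have QS: "boxset q \<in> S \<and> bx (boxset q) = q" if "q \<in> Q" for q using that bx unfolding Q_def by auto
  have near: "\<exists>w\<in>boxset q. \<bar>fst w - fst r\<bar> \<le> k \<and> \<bar>snd w - snd r\<bar> \<le> k" if "q \<in> Q" "enl k q r" "0 \<le> k" for q k r
    using that wf by (cases q) (auto intro!: enl_near)
  have dinf_le: "dinf w w' \<le> real_of_int t" if "\<bar>fst w - fst w'\<bar> \<le> t" "\<bar>snd w - snd w'\<bar> \<le> t" for w w' t
  proof -
    have "\<bar>real_of_int (fst w) - real_of_int (fst w')\<bar> = real_of_int \<bar>fst w - fst w'\<bar>"
      "\<bar>real_of_int (snd w) - real_of_int (snd w')\<bar> = real_of_int \<bar>snd w - snd w'\<bar>" by simp_all
    then have "\<bar>real_of_int (fst w) - real_of_int (fst w')\<bar> \<le> real_of_int t"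
      "\<bar>real_of_int (snd w) - real_of_int (snd w')\<bar> \<le> real_of_int t" using that by (simp_all only: of_int_le_iff)
    then show ?thesis unfolding dinf_def by simp
  qed
  have sep: "\<not> enl 1 q' r" if q: "q \<in> Q" "q' \<in> Q" "q \<noteq> q'" and e2: "enl 2 q r" for q q' r
  proof
    assume e1: "enl 1 q' r"
    obtain w where w: "w \<in> boxset q" "\<bar>fst w - fst r\<bar> \<le> 2" "\<bar>snd w - snd r\<bar> \<le> 2" using near[OF q(1) e2] by auto
    obtain w' where w': "w' \<in> boxset q'" "\<bar>fst w' - fst r\<bar> \<le> 1" "\<bar>snd w' - snd r\<bar> \<le> 1" using near[OF q(2) e1] by auto
    have "dinf w w' \<le> real_of_int 3" by (rule dinf_le) (use w w' in auto)
    have ne: "boxset q \<noteq> boxset q'" using QS[OF q(1)] QS[OF q(2)] q(3) by metis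
    have "rects_sep S \<le> set_set_dist dinf (boxset q) (boxset q')"
      unfolding rects_sep_def using QS[OF q(1)] QS[OF q(2)] ne by (intro INF_lower2[of "boxset q"] INF_lower) auto
    also have "\<dots> \<le> ereal (dinf w w')" unfolding set_set_dist_def using w w' by (intro INF_lower2[of w] INF_lower) auto
    also have "\<dots> \<le> 3" using \<open>dinf w w' \<le> real_of_int 3\<close> by simp
    finally show False using sepR by simp
  qed
  have zQ: "\<not> enl 3 q (z i)" if i: "i < n" and q: "q \<in> Q" for i q
  proof
    assume e: "enl 3 q (z i)"
    obtain w where w: "w \<in> boxset q" "\<bar>fst w - fst (z i)\<bar> \<le> 3" "\<bar>snd w - snd (z i)\<bar> \<le> 3" using near[OF q e] by auto
    have "dinf (z i) w \<le> real_of_int 3" by (rule dinf_le) (use w in auto)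
    have "points_rects_sep dinf n z S \<le> pt_set_dist dinf (z i) (boxset q)"
      unfolding points_rects_sep_def using QS[OF q] i by (intro INF_lower2[of i] INF_lower) auto
    also have "\<dots> \<le> ereal (dinf (z i) w)" unfolding pt_set_dist_def using w by (intro INF_lower)
    also have "\<dots> \<le> 3" using \<open>dinf (z i) w \<le> real_of_int 3\<close> by simp
    finally show False using zR by simp
  qed
  have bb: "(b \<in> ext_border (boxset q) \<longrightarrow> enl 1 q b) \<and> finite (ext_border (boxset q)) \<and>
      (case q of (a, b, c, d) \<Rightarrow> b - a + (d - c) + 2) \<le> int (card (ext_border (boxset q)))" if "q \<in> Q" for q b
    using border_box wf[of "fst q" "fst (snd q)" "fst (snd (snd q))" "snd (snd (snd q))"] that
    unfolding boxset_def by (cases q) auto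
  have finB: "finite B" unfolding B_def
  proof (rule finite_UN_I[OF S(1)])
    fix R assume "R \<in> S"
    then show "finite (ext_border R)" using bb[of "bx R"] bx[of R] unfolding Q_def by auto
  qed
  have BQ: "\<exists>q\<in>Q. enl 1 q b" if bB: "b \<in> B" for b
  proof -
    obtain R where R: "R \<in> S" "b \<in> ext_border R" using bB unfolding B_def by auto
    then show ?thesis using bb[of "bx R" b] bx[OF R(1)] unfolding Q_def by auto
  qed
  have inj: "inj_on bx S" using bx by (metis inj_onI)
  have "(\<Sum>(a, b, c, d)\<in>Q. b - a + (d - c) + 2) \<le> (\<Sum>q\<in>Q. int (card (ext_border (boxset q))))"
    using bb by (intro sum_mono) auto
  also have "\<dots> = (\<Sum>R\<in>S. int (card (ext_border R)))"
    unfolding Q_def using bx inj by (subst sum.reindex) (auto intro!: sum.cong)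
  also have "\<dots> \<le> int p" using card by (simp flip: of_nat_sum)
  finally have size: "(\<Sum>(a, b, c, d)\<in>Q. b - a + (d - c) + 2) \<le> int p" .
  have cB: "card B \<le> p" unfolding B_def using card_UN_le[OF S(1), of ext_border] card by simp
  have good: "goodc n B z"
    unfolding goodc_def
  proof (intro conjI allI impI)
    fix i assume i: "i < n"
    show "z i \<notin> B"
    proof
      assume "z i \<in> B"
      then obtain q where q: "q \<in> Q" "enl 1 q (z i)" using BQ[of "z i"] by metis
      have "enl 3 q (z i)" using q(2) by (cases q; cases "z i") auto
      then show False using zQ[OF i q(1)] by simp
    qed
  next
    fix i j assume ij: "i < n" "j < n" "i \<noteq> j"
    have "points_sep n z \<le> ereal (d1 (z i) (z j))"
      unfolding points_sep_def using ij by (intro INF_lower2[of i] INF_lower) auto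
    then have g1: "1 < d1 (z i) (z j)" using zsep by (metis ereal_less_eq(3) less_le_trans not_le one_ereal_def)
    define t where "t = \<bar>fst (z i) - fst (z j)\<bar> + \<bar>snd (z i) - snd (z j)\<bar>"
    have t: "d1 (z i) (z j) = real_of_int t" unfolding d1_def t_def by simp
    show "2 \<le> d1 (z i) (z j)" using g1 unfolding t by simp
  qed
  show thesis
    by (rule that[of Q]) (use S wf sep size BQ zQ good finB cB in \<open>auto simp: Q_def\<close>)
qed

subsection \<open>Constants\<close>

text \<open>The target is exp (- \<nu> \<kappa>), and all costs are measured in multiples of W
  \<kappa>. \<open>N\<close> bounds the number of pairs and \<open>M\<close> the number of forced
  jumps. \<open>L1\<close> is the initial distance required by \<open>tubes\<close>,
  \<open>k0\<close> is the first stage length \<open>A 0\<close>, \<open>2 ^ J\<close> brings the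
  tubes to the scale where the logarithmic estimate starts, and \<open>b\<close> blocks lead from
  there to time \<open>T\<close>.\<close>

locale constants =
  fixes n p :: nat and c0 T :: real
  assumes n2: "2 \<le> n" and p2: "2 \<le> p" and c0: "c0 = 10 ^ 7"
    and T: "exp ((c0 * real n ^ 4 * real p ^ 2 * ln (real p))\<^sup>2) \<le> T"
begin

definition W :: real where "W = real n ^ 4 * real p ^ 2"
definition \<nu> :: real where "\<nu> = c0 * real n ^ 4 * real p ^ 2 * ln (real p)"
definition \<kappa> :: real where "\<kappa> = ln (ln T)"
definition N :: real where "N = real n * real n + real n * real p"
definition P :: nat where "P = n * p + 1"
definition s0 :: nat where "s0 = 1000 * n"
definition L1 :: nat where "L1 = 20 * s0 * P"
definition M :: nat where "M = n * ((2 * L1 + 4) * (n + p))"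
definition k0 :: nat where "k0 = P * s0\<^sup>2"
definition J :: nat where "J = nat \<lceil>16 * N * (6 + 2 * ln N)\<rceil>"
definition b :: nat where "b = nat \<lceil>32 * N * \<kappa>\<rceil>"

lemma np: "2 \<le> real n" "2 \<le> real p" "0 < real n" "0 < real p"
  using n2 p2 by auto

lemma ln_p: "1 / 2 \<le> ln (real p)"
proof -
  have "1 / 2 \<le> ln (2 :: real)" using ln_le_minus_one[of "1 / 2 :: real"] by (simp add: ln_div)
  also have "\<dots> \<le> ln (real p)" using np by (intro ln_mono) auto
  finally show ?thesis .
qed

lemma monomials:
  "real n * real n * real p * (real n * real n * real p) = W"
  "real n * real n * real p \<le> W" "N \<le> real n * real n * real p" "real n * real n * real p * N \<le> W"
  "real n * real n \<le> N" "real n * real p \<le> N" "8 \<le> N" "64 \<le> W" "real n \<le> N"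
proof -
  show W: "real n * real n * real p * (real n * real n * real p) = W"
    unfolding W_def by (simp add: power2_eq_square power4_eq_xxxx)
  have n4: "2 * 2 \<le> real n * real n" using np by (intro mult_mono) auto
  have q: "(2 * 2) * 2 \<le> real n * real n * real p" using np n4 by (intro mult_mono) auto
  have "1 * (real n * real n * real p) \<le> real n * real n * real p * (real n * real n * real p)"
    using q by (intro mult_right_mono) auto
  then show "real n * real n * real p \<le> W" unfolding W by simp
  have "real n * real n * 2 \<le> real n * real n * real p" using np by (intro mult_left_mono) auto
  moreover have "2 * (real n * real p) \<le> real n * (real n * real p)" using np by (intro mult_right_mono) auto
  ultimately show N: "N \<le> real n * real n * real p" unfolding N_def by simp
  have "real n * real n * real p * N \<le> real n * real n * real p * (real n * real n * real p)"
    using N by (intro mult_left_mono) auto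
  then show "real n * real n * real p * N \<le> W" unfolding W .
  show "real n * real n \<le> N" "real n * real p \<le> N" unfolding N_def by auto
  have "2 * 2 \<le> real n * real p" using np by (intro mult_mono) auto
  then show "8 \<le> N" unfolding N_def using n4 by simp
  have "8 * 8 \<le> real n * real n * real p * (real n * real n * real p)" using q by (intro mult_mono) auto
  then show "64 \<le> W" unfolding W by simp
  have "real n * 1 \<le> real n * real n" using np by (intro mult_left_mono) auto
  then show "real n \<le> N" unfolding N_def by (simp add: add_increasing2)
qed

lemma nu_ge: "5000000 * W \<le> \<nu>" "1 \<le> \<nu>" "0 < \<nu>"
proof -
  have "\<nu> = 10 ^ 7 * W * ln (real p)" unfolding \<nu>_def W_def by (simp add: c0)
  moreover have "10 ^ 7 * W * (1 / 2) \<le> 10 ^ 7 * W * ln (real p)" using ln_p monomials(8) by (intro mult_left_mono) auto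
  ultimately show "5000000 * W \<le> \<nu>" by simp
  then show "1 \<le> \<nu>" "0 < \<nu>" using monomials(8) by auto
qed

lemma T_ge: "6 * \<nu> \<le> T" "1 \<le> T" "\<nu>\<^sup>2 \<le> ln T" "0 < T"
proof -
  have T': "exp (\<nu>\<^sup>2) \<le> T" using T unfolding \<nu>_def .
  have "6 * \<nu> \<le> \<nu> * \<nu>" using nu_ge monomials(8) by (intro mult_right_mono) auto
  also have "\<dots> \<le> exp (\<nu>\<^sup>2)" using exp_ge_add_one_self[of "\<nu>\<^sup>2"] unfolding power2_eq_square by linarith
  finally show "6 * \<nu> \<le> T" using T' by simp
  then show "1 \<le> T" "0 < T" using nu_ge by auto
  then show "\<nu>\<^sup>2 \<le> ln T" using T' by (subst ln_ge_iff) auto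
qed

text \<open>This is where T >= exp (\<nu>^2) enters: ln T >= \<nu>^2 gives \<kappa> >= 2 ln \<nu>,
  so the logarithm of any positive quantity below \<nu> is at most \<kappa> / 2.\<close>

lemma lam_ge: "2 * ln \<nu> \<le> \<kappa>" "2 \<le> \<kappa>" "ln N \<le> \<kappa> / 2" "0 < ln T"
proof -
  have nu2: "0 < \<nu>\<^sup>2" using nu_ge by simp
  then show "0 < ln T" using T_ge(3) by linarith
  have "ln (\<nu>\<^sup>2) \<le> ln (ln T)" using T_ge(3) nu2 by (intro ln_mono) auto
  then show l: "2 * ln \<nu> \<le> \<kappa>" unfolding \<kappa>_def using nu_ge by (simp add: ln_realpow)
  have "exp 1 \<le> (3::real)" by (rule exp_le)
  then have "exp 1 \<le> \<nu>" using nu_ge monomials(8) by linarith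
  then have "1 \<le> ln \<nu>" using nu_ge by (subst ln_ge_iff) auto
  then show "2 \<le> \<kappa>" using l by simp
  have "N \<le> \<nu>" using monomials(2,3,8) nu_ge(1) by linarith
  then have "ln N \<le> ln \<nu>" using monomials(7) by (intro ln_mono) auto
  then show "ln N \<le> \<kappa> / 2" using l by simp
qed

lemma P_bounds: "real P \<le> 2 * N" "2 * n \<le> P" "1 \<le> P" "real P \<le> 2 * (real n * real p)"
proof -
  have q: "2 * 2 \<le> real n * real p" using np by (intro mult_mono) auto
  show "real P \<le> 2 * (real n * real p)" unfolding P_def using q by simp
  then show "real P \<le> 2 * N" using monomials(6) by linarith
  have "n * 2 \<le> n * p" using p2 by (intro mult_left_mono) auto
  then show "2 * n \<le> P" unfolding P_def by linarith
  show "1 \<le> P" unfolding P_def by simp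
qed

lemma M_le: "real M \<le> 80004 * W" "0 < M"
proof -
  have L1r: "real L1 = 20000 * real n * real P" unfolding L1_def s0_def by simp
  have "real L1 \<le> 20000 * real n * (2 * (real n * real p))" unfolding L1r using P_bounds(4) by (intro mult_left_mono) auto
  then have L: "real L1 \<le> 40000 * (real n * real n * real p)" by simp
  have q1: "1 \<le> real n * real n * real p" using monomials(3,7) by linarith
  have "real (2 * L1 + 4) \<le> 80004 * (real n * real n * real p)" using L q1 by simp
  then have "real (2 * L1 + 4) * (real n * (real n + real p)) \<le> 80004 * (real n * real n * real p) * (real n * (real n + real p))"
    by (intro mult_right_mono) auto
  also have "real n * (real n + real p) = N" unfolding N_def by (simp add: algebra_simps)
  also have "80004 * (real n * real n * real p) * N \<le> 80004 * W" using monomials(4) by simp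
  finally show "real M \<le> 80004 * W" unfolding M_def N_def by (simp add: algebra_simps)
  show "0 < M" unfolding M_def using n2 by auto
qed

text \<open>The choice s0 = 1000 n makes k0 / (1024 n^2) at least 900 n, so that the quadratic lower
  bound for the exponential already suffices.\<close>

lemma k0_props: "32 * real n * (real n + 2) \<le> k0" "8192 * (real n)\<^sup>2 \<le> exp (k0 / (1024 * (real n)\<^sup>2))"
  "real k0 \<le> \<nu>"
proof -
  have kr: "real k0 = 1000000 * (real n)\<^sup>2 * P" unfolding k0_def s0_def by (simp add: power_mult_distrib)
  have P4: "1 \<le> real P" using P_bounds(3) by linarith
  have "32 * real n * (real n + 2) \<le> 32 * real n * (2 * real n)" using np by (intro mult_left_mono) auto
  also have "\<dots> \<le> 1000000 * (real n)\<^sup>2 * 1" by (simp add: power2_eq_square)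
  also have "\<dots> \<le> 1000000 * (real n)\<^sup>2 * P" using P4 by (intro mult_left_mono) auto
  finally show "32 * real n * (real n + 2) \<le> k0" unfolding kr .
  have "k0 / (1024 * (real n)\<^sup>2) = 1000000 / 1024 * P" unfolding kr using np by simp
  moreover have "real (2 * n) \<le> real P" using P_bounds(2) by (rule of_nat_mono)
  then have "900 * real n \<le> 1000000 / 1024 * real P" by simp
  ultimately have x: "900 * real n \<le> k0 / (1024 * (real n)\<^sup>2)" by simp
  have "8192 * (real n)\<^sup>2 \<le> (900 * real n)\<^sup>2 / 2" by (simp add: power2_eq_square)
  also have "\<dots> \<le> 1 + 900 * real n + (900 * real n)\<^sup>2 / 2" by simp
  also have "\<dots> \<le> exp (900 * real n)" by (rule exp_lower_Taylor_quadratic) simp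
  also have "\<dots> \<le> exp (k0 / (1024 * (real n)\<^sup>2))" using x by simp
  finally show "8192 * (real n)\<^sup>2 \<le> exp (k0 / (1024 * (real n)\<^sup>2))" .
  have "real k0 \<le> 1000000 * (real n)\<^sup>2 * (2 * (real n * real p))" unfolding kr using P_bounds(4) by (intro mult_left_mono) auto
  also have "\<dots> = 2000000 * (real n * (real n * real n * real p))" by (simp add: power2_eq_square)
  also have "\<dots> \<le> 2000000 * (N * (real n * real n * real p))" using monomials(9) by (intro mult_left_mono mult_right_mono) auto
  also have "\<dots> \<le> 2000000 * W" using monomials(4) by (simp add: mult.commute)
  finally show "real k0 \<le> \<nu>" using nu_ge monomials(8) by linarith
qed

text \<open>The 16 in \<open>J\<close> is twice the 8 of the required exponent because ln 2 is
  estimated from below by 1/2.\<close>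

lemma J_props: "1 \<le> J" "exp (8 * N * (6 + 2 * ln N)) \<le> 2 ^ J" "real J + 2 \<le> 66 * (N * \<kappa>)"
proof -
  have N8: "8 \<le> N" by (rule monomials(7))
  have lnN: "0 \<le> ln N" using N8 by simp
  define X where "X = 16 * N * (6 + 2 * ln N)"
  have X: "1 \<le> X" unfolding X_def using N8 lnN mult_mono[of 1 "16 * N" 1 "6 + 2 * ln N"] by simp
  have J1: "X \<le> J" "J \<le> X + 1" unfolding J_def X_def[symmetric] using X by linarith+
  then show "1 \<le> J" using X by linarith
  have "8 * N * (6 + 2 * ln N) = X * (1 / 2)" unfolding X_def by simp
  also have "\<dots> \<le> real J * ln 2"
  proof -
    have "1 / 2 \<le> ln (2 :: real)" using ln_le_minus_one[of "1 / 2 :: real"] by (simp add: ln_div)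
    then show ?thesis using J1 X by (intro mult_mono) auto
  qed
  finally have "exp (8 * N * (6 + 2 * ln N)) \<le> exp (real J * ln 2)" by simp
  also have "\<dots> = 2 ^ J" by (simp add: exp_of_nat_mult)
  finally show "exp (8 * N * (6 + 2 * ln N)) \<le> 2 ^ J" .
  have "X = N * (96 + 32 * ln N)" unfolding X_def by (simp add: algebra_simps)
  moreover have "N * (96 + 32 * ln N) \<le> N * (96 + 16 * \<kappa>)" using lam_ge(3) N8 by (intro mult_left_mono) auto
  ultimately have "real J + 2 \<le> N * (96 + 16 * \<kappa>) + 3" using J1 by linarith
  also have "\<dots> \<le> N * (96 + 16 * \<kappa>) + N" using N8 by simp
  also have "\<dots> = N * (97 + 16 * \<kappa>)" by (simp add: algebra_simps)
  also have "\<dots> \<le> N * (66 * \<kappa>)" using lam_ge(2) N8 by (intro mult_left_mono) auto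
  finally show "real J + 2 \<le> 66 * (N * \<kappa>)" by simp
qed

text \<open>The number of blocks b >= 32 N \<kappa> gives (1 + 1 / (8 N))^b >= exp (b / (16 N)) >=
  exp (2 \<kappa>) = (ln T)^2 >= 2 ln T, so the final scale is at least T^2, which dominates the
  number of jumps.\<close>

lemma length_bound:
  assumes "x \<le> n * (2 * (T + 1) + k0 + 1)" "1 \<le> l"
  shows "x \<le> exp (l * (1 + 1 / (8 * N)) ^ b)"
proof -
  have N8: "8 \<le> N" by (rule monomials(7))
  have nnu: "real n \<le> \<nu>" using monomials(2,3,8,9) nu_ge(1) by linarith
  have "real n * (2 * (T + 1) + k0 + 1) \<le> \<nu> * (6 * T)"
    using k0_props(3) nnu T_ge nu_ge by (intro mult_mono) auto
  also have "\<dots> = (6 * \<nu>) * T" by simp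
  also have "\<dots> \<le> T * T" using T_ge by (intro mult_right_mono) auto
  also have "\<dots> = exp (2 * ln T)" using T_ge by (simp add: exp_double power2_eq_square)
  finally have x: "x \<le> exp (2 * ln T)" using assms(1) by linarith
  have "2 * ln T \<le> (ln T)\<^sup>2"
  proof -
    have "2 \<le> ln T"
    proof -
      have "2 \<le> \<nu> * 1" using nu_ge monomials(8) by linarith
      also have "\<dots> \<le> \<nu> * \<nu>" using nu_ge by (intro mult_left_mono) auto
      finally show ?thesis using T_ge(3) by (simp add: power2_eq_square)
    qed
    then have "2 * ln T \<le> ln T * ln T" by (intro mult_right_mono) auto
    then show ?thesis by (simp add: power2_eq_square)
  qed
  also have "(ln T)\<^sup>2 = exp (2 * \<kappa>)" unfolding \<kappa>_def using lam_ge(4) by (simp add: exp_double)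
  also have "\<dots> \<le> exp (real b * (1 / (16 * N)))"
  proof -
    have "32 * N * \<kappa> \<le> b" unfolding b_def by (rule real_nat_ceiling_ge)
    then have "32 * N * \<kappa> * (1 / (16 * N)) \<le> b * (1 / (16 * N))" using N8 by (intro mult_right_mono) auto
    then show ?thesis using N8 by simp
  qed
  also have "\<dots> = exp (1 / (16 * N)) ^ b" by (rule exp_of_nat_mult)
  also have "\<dots> \<le> (1 + 1 / (8 * N)) ^ b"
  proof (rule power_mono)
    define y where "y = 1 / (16 * N)"
    have y: "0 \<le> y" "y \<le> 1" unfolding y_def using N8 by (auto simp: divide_le_eq)
    have "exp y \<le> 1 + y + y\<^sup>2" by (rule exp_bound[OF y])
    also have "\<dots> \<le> 1 + 2 * y" using y by (simp add: power2_eq_square mult_left_le)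
    finally show "exp (1 / (16 * N)) \<le> 1 + 1 / (8 * N)" unfolding y_def by simp
  qed simp
  also have "\<dots> \<le> l * (1 + 1 / (8 * N)) ^ b"
  proof -
    have "1 * (1 + 1 / (8 * N)) ^ b \<le> l * (1 + 1 / (8 * N)) ^ b" using assms(2) N8 by (intro mult_right_mono) auto
    then show ?thesis by simp
  qed
  finally have "exp (2 * ln T) \<le> exp (l * (1 + 1 / (8 * N)) ^ b)" by simp
  then show ?thesis using x by linarith
qed

text \<open>The exponents come from the forced steps and their time windows, of order M ln M, from
  the tubes, from the blocks, and from the remaining waiting times, of order n^2. The tubes dominate
  with 2 * 4803 * 66 = 633996 times n^2 p N \<kappa>; the total stays below 5000000 W \<kappa>,
  hence below \<nu> \<kappa>.\<close>

lemma total_cost: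
  "1 / (ln T) powr \<nu> \<le> ((1/4) ^ M * (exp (- (real n * ((4800 * real P + 3) * (real J + 2)))) * (1/2) ^ (b + 1)))
    * ((exp (- (2 * real n + 1)) / 2) ^ n * (1 / (4 * real M)) ^ M)"
proof -
  have N8: "8 \<le> N" by (rule monomials(7))
  have M0: "0 < real M" using M_le by simp
  have lam0: "0 \<le> \<kappa>" using lam_ge by simp
  have ex: "(1/4::real) = exp (- ln 4)" "(1/2::real) = exp (- ln 2)" "1 / (4 * real M) = exp (- ln (4 * real M))"
    using M0 by (simp_all add: exp_minus inverse_eq_divide)
  have e2: "exp (- (2 * real n + 1)) / 2 = exp (- (2 * real n + 1 + ln 2))" 
  proof -
    have "- (2 * real n + 1 + ln 2) = - (2 * real n + 1) - ln 2" by simp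
    then show ?thesis by (simp only: exp_diff) simp
  qed
  have rhs: "((1/4) ^ M * (exp (- (real n * ((4800 * real P + 3) * (real J + 2)))) * (1/2) ^ (b + 1)))
      * ((exp (- (2 * real n + 1)) / 2) ^ n * (1 / (4 * real M)) ^ M) =
    exp (- (real M * ln 4 + real n * ((4800 * real P + 3) * (real J + 2)) + real (b + 1) * ln 2 +
      real n * (2 * real n + 1 + ln 2) + real M * ln (4 * real M)))"
    unfolding ex(1,3) e2 by (subst ex(2)) (simp add: algebra_simps flip: exp_add exp_of_nat_mult)
  have c1: "real M * ln 4 + real M * ln (4 * real M) \<le> 40002 * (W * \<kappa>)"
  proof -
    have "real M * ln 4 + real M * ln (4 * real M) = real M * ln (16 * real M)"
      using ln_mult_pos[of 4 "4 * real M"] M0 by (simp flip: distrib_left)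
    also have "\<dots> \<le> real M * ln \<nu>"
    proof (intro mult_left_mono ln_mono)
      show "16 * real M \<le> \<nu>" using M_le(1) nu_ge(1) monomials(8) by linarith
    qed (use M0 in auto)
    also have "\<dots> \<le> (80004 * W) * (\<kappa> / 2)"
      using M_le(1) lam_ge(1) nu_ge monomials(8) by (intro mult_mono) auto
    finally show ?thesis by (simp add: mult.commute)
  qed
  have c2: "real n * ((4800 * real P + 3) * (real J + 2)) \<le> 640000 * (W * \<kappa>)"
  proof -
    have "1 \<le> real P" using P_bounds(3) by linarith
    then have "4800 * real P + 3 \<le> 4803 * (2 * (real n * real p))" using P_bounds(4) by linarith
    then have "real n * ((4800 * real P + 3) * (real J + 2)) \<le> real n * (4803 * (2 * (real n * real p)) * (66 * (N * \<kappa>)))"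
      using J_props(3) by (intro mult_left_mono mult_mono) auto
    also have "\<dots> = 633996 * ((real n * real n * real p * N) * \<kappa>)" by simp
    also have "\<dots> \<le> 640000 * (W * \<kappa>)"
      using monomials(4,8) lam0 N8 by (intro mult_mono mult_nonneg_nonneg) auto
    finally show ?thesis .
  qed
  have NW: "N \<le> W" using monomials(2,3) by linarith
  have W\<kappa>: "128 \<le> W * \<kappa>" using mult_mono[of 64 W 2 \<kappa>] monomials(8) lam_ge(2) by simp
  have ln2: "ln 2 \<le> (1::real)" using ln_le_minus_one[of "2::real"] by simp
  have c3: "real (b + 1) * ln 2 \<le> 34 * (W * \<kappa>)"
  proof -
    have "0 \<le> 32 * N * \<kappa>" using N8 lam0 by simp
    then have "real b \<le> 32 * (N * \<kappa>) + 1" unfolding b_def by linarith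
    also have "N * \<kappa> \<le> W * \<kappa>" using NW lam0 by (rule mult_right_mono)
    finally have "real (b + 1) \<le> 34 * (W * \<kappa>)" using W\<kappa> by simp
    moreover have "real (b + 1) * ln 2 \<le> real (b + 1)" using ln2 by (intro mult_left_le) auto
    ultimately show ?thesis by (rule order_trans[rotated])
  qed
  have c4: "real n * (2 * real n + 1 + ln 2) \<le> 2 * (W * \<kappa>)"
  proof -
    have "real n * (2 * real n + 1 + ln 2) \<le> real n * (4 * real n)" using ln2 np by (intro mult_left_mono) auto
    also have "\<dots> \<le> 4 * W" using monomials(5) NW by simp
    also have "\<dots> \<le> 2 * (W * \<kappa>)" using mult_left_mono[OF lam_ge(2), of W] monomials(8) by simp
    finally show ?thesis .
  qed
  have "real M * ln 4 + real n * ((4800 * real P + 3) * (real J + 2)) + real (b + 1) * ln 2 +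
      real n * (2 * real n + 1 + ln 2) + real M * ln (4 * real M) \<le> 5000000 * (W * \<kappa>)"
    using c1 c2 c3 c4 W\<kappa> by linarith
  also have "\<dots> \<le> \<nu> * \<kappa>" using mult_right_mono[OF nu_ge(1) lam0] by simp
  finally have "exp (- (\<nu> * \<kappa>)) \<le> exp (- (real M * ln 4 + real n * ((4800 * real P + 3) * (real J + 2)) + real (b + 1) * ln 2 +
      real n * (2 * real n + 1 + ln 2) + real M * ln (4 * real M)))" by simp
  moreover have "1 / (ln T) powr \<nu> = exp (- (\<nu> * \<kappa>))"
    unfolding powr_def \<kappa>_def using lam_ge(4) by (simp add: exp_minus inverse_eq_divide)
  ultimately show ?thesis unfolding rhs by simp
qed

lemma survival_bound:
  assumes S: "finite S" "\<forall>R\<in>S. rectangle R" and card: "(\<Sum>R\<in>S. card (ext_border R)) \<le> p"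
    and sepR: "rects_sep S > 3" and zsep: "points_sep n z > 1" and zR: "points_rects_sep dinf n z S > 3"
  shows "1 / (ln T) powr \<nu> \<le> measure (walks_noise n) {\<omega> \<in> space (walks_noise n). ereal T < collision_time n S (walks z \<omega>)}"
proof -
  define B where "B = (\<Union>R\<in>S. ext_border R)"
  obtain Q where Q: "finite Q" "\<And>a b c d. (a, b, c, d) \<in> Q \<Longrightarrow> a \<le> b \<and> c \<le> d"
    "\<And>q q' r. q \<in> Q \<Longrightarrow> q' \<in> Q \<Longrightarrow> q \<noteq> q' \<Longrightarrow> enl 2 q r \<Longrightarrow> \<not> enl 1 q' r"
    "(\<Sum>(a, b, c, d)\<in>Q. b - a + (d - c) + 2) \<le> int p" "\<And>b. b \<in> B \<Longrightarrow> \<exists>q\<in>Q. enl 1 q b"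
    "\<And>i q. i < n \<Longrightarrow> q \<in> Q \<Longrightarrow> \<not> enl 3 q (z i)" "goodc n B z" "finite B" "card B \<le> p"
    by (rule boxes_of_rectangles[OF S card sepR zsep zR, folded B_def]) (rule that)
  have P4: "4 \<le> P" using P_bounds(2) n2 by linarith
  have s48: "48 \<le> s0" unfolding s0_def using n2 by linarith
  have L1pos: "4 \<le> int L1" 
  proof -
    have "20 * 48 * 4 \<le> 20 * s0 * P" using s48 P4 by (intro mult_le_mono) auto
    then show ?thesis unfolding L1_def by linarith
  qed
  obtain ord l X where F: "distinct ord" "set ord = {..<n}" "int (\<Sum>i<n. l i) \<le> int n * hlen n p (int L1)"
    "\<And>g ls. (\<And>y. 0 \<le> g y) \<Longrightarrow> (1/4) ^ (\<Sum>i<n. l i) * surv (goodc n B) g ls X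
       \<le> surv (goodc n B) g (forced l ord @ ls) z"
    "\<And>i j. i < n \<Longrightarrow> j < n \<Longrightarrow> i \<noteq> j \<Longrightarrow> int L1 \<le> \<bar>snd (X i) - snd (X j)\<bar>"
    "\<And>i b. i < n \<Longrightarrow> b \<in> B \<Longrightarrow> int L1 \<le> \<bar>snd b - snd (X i)\<bar>"
  proof (rule forced_phase[where n = n and p = p and Q = Q and B = B and z = z])
    show "4 \<le> int L1" "2 \<le> p" "finite Q" "(\<Sum>(a, b, c, d)\<in>Q. b - a + (d - c) + 2) \<le> int p" "goodc n B z"
      by (fact L1pos p2 Q(1,4,7))+
    show "a \<le> b \<and> c \<le> d" if "(a, b, c, d) \<in> Q" for a b c d using Q(2)[OF that] .
    show "\<not> enl 1 q' r" if "q \<in> Q" "q' \<in> Q" "q \<noteq> q'" "enl 2 q r" for q q' r using Q(3)[OF that] .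
    show "\<exists>q\<in>Q. enl 1 q b" if "b \<in> B" for b using Q(5)[OF that] .
    show "\<not> enl 3 q (z i)" if "i < n" "q \<in> Q" for i q using Q(6)[OF that] .
    fix ord :: "nat list" and l :: "nat \<Rightarrow> nat" and X :: "nat \<Rightarrow> int \<times> int"
    assume a: "distinct ord" "set ord = {..<n}" "int (\<Sum>i<n. l i) \<le> int n * hlen n p (int L1)"
      and surv: "\<And>g ls. (\<And>y. 0 \<le> g y) \<Longrightarrow> (1/4) ^ (\<Sum>i<n. l i) * surv (goodc n B) g ls X
        \<le> surv (goodc n B) g (forced l ord @ ls) z"
      and rows: "\<And>i j. i < n \<Longrightarrow> j < n \<Longrightarrow> i \<noteq> j \<Longrightarrow> int L1 \<le> \<bar>snd (X i) - snd (X j)\<bar>"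
      and rowsB: "\<And>i b. i < n \<Longrightarrow> b \<in> B \<Longrightarrow> int L1 \<le> \<bar>snd b - snd (X i)\<bar>"
    show thesis
    proof (rule that[of ord l X])
      show "distinct ord" "set ord = {..<n}" "int (\<Sum>i<n. l i) \<le> int n * hlen n p (int L1)" by (fact a)+
      show "(1/4) ^ (\<Sum>i<n. l i) * surv (goodc n B) g ls X \<le> surv (goodc n B) g (forced l ord @ ls) z"
        if g: "\<And>y. 0 \<le> g y" for g ls using surv[OF g] .
      show "int L1 \<le> \<bar>snd (X i) - snd (X j)\<bar>" if "i < n" "j < n" "i \<noteq> j" for i j using rows[OF that] .
      show "int L1 \<le> \<bar>snd b - snd (X i)\<bar>" if "i < n" "b \<in> B" for i b using rowsB[OF that] .
    qed
  qed
  have lM: "(\<Sum>i<n. l i) \<le> M"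
  proof -
    have "hlen n p (int L1) = (2 * int L1 + 4) * (int n + int p)"
    proof (rule hlen_def[where Q = Q and B = B and z = z])
      show "4 \<le> int L1" "2 \<le> p" "finite Q" "(\<Sum>(a, b, c, d)\<in>Q. b - a + (d - c) + 2) \<le> int p" "goodc n B z"
        by (fact L1pos p2 Q(1,4,7))+
      show "a \<le> b \<and> c \<le> d" if "(a, b, c, d) \<in> Q" for a b c d using Q(2)[OF that] .
      show "\<not> enl 1 q' r" if "q \<in> Q" "q' \<in> Q" "q \<noteq> q'" "enl 2 q r" for q q' r using Q(3)[OF that] .
      show "\<exists>q\<in>Q. enl 1 q b" if "b \<in> B" for b using Q(5)[OF that] .
      show "\<not> enl 3 q (z i)" if "i < n" "q \<in> Q" for i q using Q(6)[OF that] .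
    qed
    then have "int n * hlen n p (int L1) = int M" unfolding M_def by simp
    then show ?thesis using F(3) by linarith
  qed
  have "\<exists>k\<le>n * p. \<forall>i<n. \<forall>b\<in>B. max \<bar>fst b - fst (X i)\<bar> \<bar>snd b - snd (X i)\<bar> \<le>
    4 * \<bar>int (n * p + 1) * (snd b - snd (X i)) - int k * (fst b - fst (X i))\<bar>"
  proof (rule exists_direction[OF Q(8,9)])
    fix i b assume "i < n" "b \<in> B"
    then have "int L1 \<le> \<bar>snd b - snd (X i)\<bar>" by (rule F(6))
    then show "fst b - fst (X i) \<noteq> 0 \<or> snd b - snd (X i) \<noteq> 0" using L1pos by linarith
  qed
  then obtain k where k: "k \<le> n * p" "\<And>i b. i < n \<Longrightarrow> b \<in> B \<Longrightarrow> max \<bar>fst b - fst (X i)\<bar> \<bar>snd b - snd (X i)\<bar> \<le>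
    4 * \<bar>int P * (snd b - snd (X i)) - int k * (fst b - fst (X i))\<bar>" unfolding P_def by auto
  obtain v :: "nat \<Rightarrow> real" where v: "\<And>i. i < n \<Longrightarrow> 1 \<le> v i \<and> v i \<le> 2"
    "\<And>i j. i < n \<Longrightarrow> j < n \<Longrightarrow> i \<noteq> j \<Longrightarrow>
      (v j + 1 / n \<le> v i \<and> int P * fst (X j) + int k * snd (X j) \<le> int P * fst (X i) + int k * snd (X i)) \<or>
      (v i + 1 / n \<le> v j \<and> int P * fst (X i) + int k * snd (X i) \<le> int P * fst (X j) + int k * snd (X j))"
    using exists_ranks[of n "\<lambda>i. int P * fst (X i) + int k * snd (X i)"] n2 by auto
  have rdiff: "0 \<le> real P * real_of_int (fst (X i - X j)) + real k * real_of_int (snd (X i - X j))"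
    if "int P * fst (X j) + int k * snd (X j) \<le> int P * fst (X i) + int k * snd (X i)" for i j
  proof -
    have "real_of_int (int P * fst (X j) + int k * snd (X j)) \<le> real_of_int (int P * fst (X i) + int k * snd (X i))"
      using that by linarith
    then show ?thesis by (simp add: algebra_simps)
  qed
  have L1r: "20 * real s0 * real P = real_of_int (int L1)" unfolding L1_def by simp
  interpret tubes P s0 n k B X v
  proof
    show "1 \<le> P" "48 \<le> s0" "2 \<le> n" "2 * n \<le> P" "finite B" using P_bounds s48 n2 Q(8) by auto
    show "k \<le> P" using k(1) unfolding P_def by simp
    show "1 \<le> v i \<and> v i \<le> 2" if "i < n" for i using v(1)[OF that] .
    show "v j + 1 / n \<le> v i \<and> 0 \<le> real P * real_of_int (fst (X i - X j)) + real k * real_of_int (snd (X i - X j)) \<or>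
      v i + 1 / n \<le> v j \<and> 0 \<le> real P * real_of_int (fst (X j - X i)) + real k * real_of_int (snd (X j - X i))"
      if "i < n" "j < n" "i \<noteq> j" for i j
      using v(2)[OF that] rdiff by blast
    show "20 * real s0 * real P \<le> max \<bar>real_of_int (fst (X i - X j))\<bar> \<bar>real_of_int (snd (X i - X j))\<bar>"
      if "i < n" "j < n" "i \<noteq> j" for i j
    proof -
      have "real_of_int (int L1) \<le> real_of_int \<bar>snd (X i) - snd (X j)\<bar>" using F(5)[OF that] by linarith
      then show ?thesis unfolding L1r by (simp add: le_max_iff_disj)
    qed
    show "max \<bar>real_of_int (fst (b - X i))\<bar> \<bar>real_of_int (snd (b - X i))\<bar> \<le>
      4 * \<bar>real P * real_of_int (snd (b - X i)) - real k * real_of_int (fst (b - X i))\<bar>"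
      if "i < n" "b \<in> B" for i b
    proof -
      have "real_of_int (max \<bar>fst b - fst (X i)\<bar> \<bar>snd b - snd (X i)\<bar>) \<le>
        real_of_int (4 * \<bar>int P * (snd b - snd (X i)) - int k * (fst b - fst (X i))\<bar>)"
        using k(2)[OF that] by linarith
      then show ?thesis by (simp add: of_int_max)
    qed
    show "20 * real s0 * real P \<le> max \<bar>real_of_int (fst (b - X i))\<bar> \<bar>real_of_int (snd (b - X i))\<bar>"
      if "i < n" "b \<in> B" for i b
    proof -
      have "real_of_int (int L1) \<le> real_of_int \<bar>snd b - snd (X i)\<bar>" using F(6)[OF that] by linarith
      then show ?thesis unfolding L1r by (simp add: le_max_iff_disj)
    qed
  qed
  \<comment> \<open>The threshold below which the counts are not controlled is the length of the
    first stage, on which the scale is constant.\<close>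
  have A0: "A 0 = k0" unfolding A_def k0_def by simp
  have cardN: "real (card (prs n B)) \<le> N"
  proof -
    have "card (prs n B) \<le> n * n + n * p"
      using card_prs[OF Q(8), of n] Q(9) mult_le_mono2[of "card B" p n] by linarith
    then have "real (card (prs n B)) \<le> real (n * n + n * p)" by linarith
    then show ?thesis unfolding N_def by simp
  qed
  have sJ: "exp (8 * N * (6 + 2 * ln N)) \<le> sj J / 48"
  proof -
    have "48 * 2 ^ J \<le> real s0 * 2 ^ J" using s48 by (intro mult_right_mono) auto
    then show ?thesis using J_props(2) unfolding sj_def of_nat_mult of_nat_power of_nat_numeral by linarith
  qed
  define q0 where "q0 = exp (- (real n * ((4800 * real P + 3) * (real J + 2)))) * (1/2 :: real) ^ (b + 1)"
  have q00: "0 \<le> q0" unfolding q0_def by simp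
  have main: "(1/4) ^ M * q0 \<le> surv (goodc n B) (\<lambda>_. 1) (forced l ord @ ys) z"
    if ys: "synced n k0 (1 / (4 * real n)) ys" and len: "real (length ys) \<le> n * (2 * (T + 1) + k0 + 1)" for ys
  proof -
    have "1 \<le> ln (sj J / 48)"
    proof -
      have "0 \<le> ln N" using monomials(7) by simp
      then have "1 * 1 \<le> (8 * N) * (6 + 2 * ln N)" using monomials(7) by (intro mult_mono) auto
      then have "exp 1 \<le> sj J / 48" using sJ by (intro order_trans[OF _ sJ]) simp
      then show ?thesis using sj_pos[of J] by (subst ln_ge_iff) auto
    qed
    then have "real (length ys) \<le> exp (ln (sj J / 48) * (1 + 1 / (8 * N)) ^ b)"
      by (rule length_bound[OF len])
    then have "q0 \<le> surv (sepc n B 2) (\<lambda>_. 1) ys X" unfolding q0_def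
      by (intro surv_mid_super[OF cardN monomials(9) P_bounds(1) _ _ J_props(1) sJ]) (use ys monomials(7) in \<open>auto simp: A0\<close>)
    also have "\<dots> \<le> surv (goodc n B) (\<lambda>_. 1) ys X" by (rule surv_mono) (auto intro: sepc_goodc)
    finally have q: "q0 \<le> surv (goodc n B) (\<lambda>_. 1) ys X" .
    have "(1/4 :: real) ^ M \<le> (1/4) ^ (\<Sum>i<n. l i)" using lM by (intro power_decreasing) auto
    then have "(1/4) ^ M * q0 \<le> (1/4) ^ (\<Sum>i<n. l i) * surv (goodc n B) (\<lambda>_. 1) ys X"
      using q q00 by (intro mult_mono) auto
    also have "\<dots> \<le> surv (goodc n B) (\<lambda>_. 1) (forced l ord @ ys) z" by (rule F(4)) simp
    finally show ?thesis .
  qed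
  have nT: "real n \<le> T + 1" using monomials(2,3,9) nu_ge(1) T_ge(1) monomials(8) by linarith
  have "((1/4) ^ M * q0) * ((exp (- (2 * real n + 1)) / 2) ^ n * (1 / (4 * real M)) ^ M) \<le>
    measure (walks_noise n) {\<omega> \<in> space (walks_noise n). ereal T < collision_time n S (walks z \<omega>)}"
  proof (rule walks_lower_bound[OF S(1) _ _ nT _ F(1,2) M_le(2) lM k0_props(1,2)])
    show "\<not> bad n S x" if "goodc n B x" for x by (rule not_bad_goodc[OF that B_def S(1) n2])
    show "0 < n" "0 \<le> T" "0 \<le> (1/4) ^ M * q0" using n2 T_ge q00 by auto
  qed (rule main)
  then show ?thesis using total_cost unfolding q0_def by linarith
qed

end

theorem theorem1:
  "\<exists>c0 :: real. c0 > 0 \<and>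
     (\<forall>(n :: nat) (p :: nat) (S :: (int \<times> int) set set) (z :: nat \<Rightarrow> int \<times> int).
        n \<ge> 2 \<longrightarrow> p \<ge> 2 \<longrightarrow>
        finite S \<longrightarrow> (\<forall>R\<in>S. rectangle R) \<longrightarrow>
        (\<Sum>R\<in>S. card (ext_border R)) \<le> p \<longrightarrow>
        rects_sep S > 3 \<longrightarrow>
        points_sep n z > 1 \<longrightarrow>
        points_rects_sep dinf n z S > 3 \<longrightarrow>
        (let \<nu> = c0 * real n ^ 4 * real p ^ 2 * ln (real p); T0 = exp (\<nu> ^ 2) in
           \<forall>T :: real. T \<ge> T0 \<longrightarrow>
             \<P>(\<omega> in walks_noise n. collision_time n S (walks z \<omega>) > ereal T) \<ge> 1 / (ln T) powr \<nu>))"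
proof (intro exI[of _ "10 ^ 7"] conjI allI impI)
  show "(0 :: real) < 10 ^ 7" by simp
  fix n p :: nat and S :: "(int \<times> int) set set" and z :: "nat \<Rightarrow> int \<times> int"
  assume a: "n \<ge> 2" "p \<ge> 2" "finite S" "\<forall>R\<in>S. rectangle R" "(\<Sum>R\<in>S. card (ext_border R)) \<le> p"
    "rects_sep S > 3" "points_sep n z > 1" "points_rects_sep dinf n z S > 3"
  show "let \<nu> = 10 ^ 7 * real n ^ 4 * real p ^ 2 * ln (real p); T0 = exp (\<nu> ^ 2) in
           \<forall>T :: real. T \<ge> T0 \<longrightarrow>
             \<P>(\<omega> in walks_noise n. collision_time n S (walks z \<omega>) > ereal T) \<ge> 1 / (ln T) powr \<nu>"
    unfolding Let_def
  proof (intro allI impI)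
    fix T :: real
    assume T: "exp ((10 ^ 7 * real n ^ 4 * real p ^ 2 * ln (real p)) ^ 2) \<le> T"
    interpret constants n p "10 ^ 7" T by unfold_locales (use a T in auto)
    show "1 / (ln T) powr (10 ^ 7 * real n ^ 4 * real p ^ 2 * ln (real p)) \<le>
        \<P>(\<omega> in walks_noise n. collision_time n S (walks z \<omega>) > ereal T)"
      using survival_bound[OF a(3-8)] unfolding \<nu>_def by simp
  qed
qed

end
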